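(* Let $m, n\in\mathbb{N}_0$ and let $P_n(\underline{x})$ be an $\mathbb{R}_{0,d}$-valued homogeneous polynomial of degree $n$ on $\mathbb{R}^d$ with $\underline{D}P_n=0$. Let $\Omega\subset\mathbb{C}^+=\{z=t+\mathbf{i}s\in\mathbb{C}: s>0\}$ be open, and let $f(z)=u(t,s)+\mathbf{i}v(t,s)$, $z=t+\mathbf{i}s$, be a complex-valued function on $\Omega$ ($u,v$ real-valued, of class $C^{2m+1}$) satisfying $$\partial_{\bar z}\Delta_z^m f(z)=0\quad\text{in }\Omega,$$ where $\partial_{\bar z}=\frac12(\partial_t+\mathbf{i}\partial_s)$ and $\Delta_z=\partial_t^2+\partial_s^2$. If $\mu$ is an odd integer, then the function $$\Delta^{m+n+\frac{\mu-1}{2}}\left(\left(u(x_0,|\underline{x}|)+\frac{\underline{x}}{|\underline{x}|}v(x_0,|\underline{x}|)\right)P_n(\underline{x})\right)$$ is Dunkl-monogenic in $\vec{\Omega}=\{x=x_0+\underline{x}\in\mathbb{R}^d_1: (x_0,|\underline{x}|)\in\Omega\}$, i.e. it is annihilated by the Dunkl-Cauchy-Riemann operator $D$ there.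
   Context: $\mathbb{R}_{0,d}$ is the real Clifford algebra of dimension $2^d$ generated by an orthonormal basis $\mathbf{e}_1,\dots,\mathbf{e}_d$ of $\mathbb{R}^d$ with $\mathbf{e}_i\mathbf{e}_j+\mathbf{e}_j\mathbf{e}_i=-2\delta_{ij}$. A vector of $\mathbb{R}^d$ is identified with $\underline{x}=\sum_{i=1}^d x_i\mathbf{e}_i$, and $\mathbb{R}^d_1$ denotes the space of elements $x=x_0+\underline{x}$ with $x_0\in\mathbb{R}$, $\underline{x}\in\mathbb{R}^d$. Complex-plane points $z=t+\mathbf{i}s$ are identified with $(t,s)\in\mathbb{R}^2$. $R$ is a (reduced) root system: a finite set of nonzero vectors with $R\cap\mathbb{R}\alpha=\{\alpha,-\alpha\}$ and $\sigma_\alpha R=R$ for all $\alpha\in R$, where $\sigma_\alpha x=x-2\frac{\langle\alpha,x\rangle}{|\alpha|^2}\alpha$. $W$ is the finite reflection group generated by the $\sigma_\alpha$. It is assumed that $W$ leaves the $x_0$-axis invariant, in the sense that all roots lie in $\mathbb{R}^d$ (so the reflections act only on $\underline{x}$). $R_+\subset R$ is a fixed positive subsystem, $\kappa:R\to[0,\infty)$ is a $W$-invariant function (multiplicity function), $\gamma_\kappa=\sum_{\alpha\in R_+}\kappa(\alpha)$ is assumed to satisfy $\gamma_\kappa>0$, and $\mu=2\gamma_\kappa+d$ is the Dunkl-dimension. The Dunkl operators are $$T_{x_i}f(x)=\frac{\partial f}{\partial x_i}(x)+\sum_{\alpha\in R_+}\kappa(\alpha)\frac{f(x)-f(\sigma_\alpha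 x)}{\langle\alpha,x\rangle}\alpha_i,\quad i=0,1,\dots,d,$$ acting on functions on $W$-invariant open sets (componentwise on $\mathbb{R}_{0,d}$-valued functions; the quotient is understood as its limit where $\langle\alpha,x\rangle=0$); in particular $T_{x_0}=\partial_{x_0}$. The Dunkl-Dirac operator is $\underline{D}f=\sum_{i=1}^d\mathbf{e}_iT_{x_i}f$ (left multiplication), the Dunkl-Cauchy-Riemann operator is $D=\partial_{x_0}+\underline{D}$, and the Dunkl Laplacian in $\mathbb{R}^d_1$ is $\Delta=\partial_{x_0}^2+\sum_{i=1}^dT_{x_i}^2$. Functions in the kernel of $\underline{D}$ (on $\mathbb{R}^d$) or of $D$ (on $\mathbb{R}^d_1$) are called Dunkl-monogenic. *)

theory Defs
  imports "HOL-Analysis.Analysis"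
begin

section \<open>The real Clifford algebra\<close>

text \<open>
  The index type \<open>'d\<close>, with \<open>CARD('d) = d\<close>, carries a linear order, which fixes the order of the
  factors in the basis blades \<open>e\<^sub>A = e\<^sub>i\<^sub>1 \<dots> e\<^sub>i\<^sub>k\<close> for \<open>A = {i\<^sub>1 < \<dots> < i\<^sub>k}\<close>. An element of the algebra is the
  family of its \<open>2\<^sup>d\<close> coordinates with respect to the blades. The unit is \<open>cl_blade {}\<close>; the library
  constant \<open>1\<close> of the type \<open>vec\<close> is the all-ones vector and is not used.
\<close>

type_synonym 'd clifford = "(real, 'd set) vec"

definition cl_blade :: "'d set \<Rightarrow> 'd::{finite,linorder} clifford" where
  "cl_blade A = axis A 1"

abbreviation cl_gen :: "'d \<Rightarrow> 'd::{finite,linorder} clifford" where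
  "cl_gen i \<equiv> cl_blade {i}"

text \<open>
  In \<open>e\<^sub>A e\<^sub>B\<close>, each pair \<open>(a, b) \<in> A \<times> B\<close> with \<open>a > b\<close> costs a sign for a transposition and each
  pair with \<open>a = b\<close> costs a sign for \<open>e\<^sub>a e\<^sub>a = -1\<close>.
\<close>

definition cl_sign :: "'d::{finite,linorder} set \<Rightarrow> 'd set \<Rightarrow> real" where
  "cl_sign A B = (\<Prod>a\<in>A. \<Prod>b\<in>B. if a < b then 1 else -1)"

definition cl_mult :: "'d::{finite,linorder} clifford \<Rightarrow> 'd clifford \<Rightarrow> 'd clifford"
    (infixl "\<odot>" 70) where
  "x \<odot> y = (\<Sum>A\<in>UNIV. \<Sum>B\<in>UNIV. (x $ A * y $ B * cl_sign A B) *\<^sub>R cl_blade (sym_diff A B))"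

definition cl_vec :: "(real, 'd) vec \<Rightarrow> 'd::{finite,linorder} clifford" where
  "cl_vec x = (\<Sum>i\<in>UNIV. (x $ i) *\<^sub>R cl_gen i)"

subsection \<open>The defining properties of the algebra\<close>

lemma DIM_clifford: "DIM('d::{finite,linorder} clifford) = 2 ^ CARD('d)"
  by (simp add: card_Pow flip: Pow_UNIV)

lemma bilinear_cl_mult: "bilinear (\<odot>)"
  unfolding bilinear_def
  by (auto intro!: linearI
      simp: cl_mult_def algebra_simps sum.distrib scaleR_sum_right)

lemma cl_blade_expansion: "x = (\<Sum>A\<in>UNIV. (x $ A) *\<^sub>R cl_blade A)"
  by (simp add: vec_eq_iff cl_blade_def axis_def if_distrib cong: if_cong)

lemma cl_blade_mult: "cl_blade A \<odot> cl_blade B = cl_sign A B *\<^sub>R cl_blade (sym_diff A B)"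
proof -
  have "cl_blade A \<odot> cl_blade B
      = (\<Sum>A'\<in>UNIV. \<Sum>B'\<in>UNIV. if A' = A \<and> B' = B
           then cl_sign A B *\<^sub>R cl_blade (sym_diff A B) else 0)"
    unfolding cl_mult_def
    by (intro sum.cong refl) (simp add: cl_blade_def[of A] cl_blade_def[of B] axis_def)
  also have "\<dots> = (\<Sum>A'\<in>UNIV. if A' = A then
      (\<Sum>B'\<in>UNIV. if B' = B then cl_sign A B *\<^sub>R cl_blade (sym_diff A B) else 0) else 0)"
    by (intro sum.cong refl) simp
  finally show ?thesis by simp
qed

lemma cl_sign_sym_diff_left: "cl_sign (sym_diff A B) C = cl_sign A C * cl_sign B C"
proof -
  let ?g = "\<lambda>a. \<Prod>c\<in>C. if a < c then 1 else (-1::real)"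
  have sq: "?g a * ?g a = 1" for a
    by (simp flip: prod.distrib) (simp add: if_distrib cong: if_cong)
  have "prod ?g A * prod ?g B
      = (prod ?g (A - B) * prod ?g (A \<inter> B)) * (prod ?g (B - A) * prod ?g (A \<inter> B))"
    using prod.Int_Diff[of A ?g B] prod.Int_Diff[of B ?g A] by (simp add: mult_ac Int_commute)
  also have "\<dots> = prod ?g (A - B) * prod ?g (B - A) * (\<Prod>a\<in>A \<inter> B. ?g a * ?g a)"
    by (simp only: prod.distrib mult_ac)
  also have "\<dots> = prod ?g (sym_diff A B)"
    unfolding sq by (subst prod.union_disjoint) auto
  finally show ?thesis by (simp add: cl_sign_def)
qed

lemma cl_sign_sym_diff_right: "cl_sign C (sym_diff A B) = cl_sign C A * cl_sign C B"
proof -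
  let ?g = "\<lambda>a. \<Prod>c\<in>C. if c < a then 1 else (-1::real)"
  have sq: "?g a * ?g a = 1" for a
    by (simp flip: prod.distrib) (simp add: if_distrib cong: if_cong)
  have swap: "cl_sign C X = prod ?g X" for X
    unfolding cl_sign_def by (rule prod.swap)
  have "prod ?g A * prod ?g B
      = (prod ?g (A - B) * prod ?g (A \<inter> B)) * (prod ?g (B - A) * prod ?g (A \<inter> B))"
    using prod.Int_Diff[of A ?g B] prod.Int_Diff[of B ?g A] by (simp add: mult_ac Int_commute)
  also have "\<dots> = prod ?g (A - B) * prod ?g (B - A) * (\<Prod>a\<in>A \<inter> B. ?g a * ?g a)"
    by (simp only: prod.distrib mult_ac)
  also have "\<dots> = prod ?g (sym_diff A B)"
    unfolding sq by (subst prod.union_disjoint) auto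
  finally show ?thesis by (simp add: swap)
qed

lemma cl_mult_assoc: "(x \<odot> y) \<odot> z = x \<odot> (y \<odot> z)"
proof -
  note bl = bilinear_cl_mult
  have blade: "(cl_blade A \<odot> cl_blade B) \<odot> cl_blade C = cl_blade A \<odot> (cl_blade B \<odot> cl_blade C)"
    for A B C :: "'a set"
  proof -
    have "sym_diff (sym_diff A B) C = sym_diff A (sym_diff B C)" by blast
    then show ?thesis
      by (simp only: cl_blade_mult bilinear_lmul[OF bl] bilinear_rmul[OF bl]
          cl_sign_sym_diff_left cl_sign_sym_diff_right scaleR_scaleR mult_ac)
  qed
  have sl: "sum f S \<odot> w = (\<Sum>i\<in>S. f i \<odot> w)"
    and sr: "w \<odot> sum f S = (\<Sum>i\<in>S. w \<odot> f i)" for f S and w :: "'a clifford"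
    using bl linear_sum[of "\<lambda>v. v \<odot> w" f S] linear_sum[of "\<lambda>v. w \<odot> v" f S]
    by (auto simp: bilinear_def)
  let ?e = "\<lambda>x::'a clifford. \<Sum>A\<in>UNIV. (x $ A) *\<^sub>R cl_blade A"
  have "(?e x \<odot> ?e y) \<odot> ?e z = ?e x \<odot> (?e y \<odot> ?e z)"
    by (simp only: sl sr bilinear_lmul[OF bl] bilinear_rmul[OF bl] blade)
  then show ?thesis by (simp flip: cl_blade_expansion)
qed

lemma cl_mult_unit: "cl_blade {} \<odot> x = x" "x \<odot> cl_blade {} = x"
proof -
  have "linear (\<lambda>v. cl_blade {} \<odot> v)" "linear (\<lambda>v. v \<odot> cl_blade {})"
    using bilinear_cl_mult by (auto simp: bilinear_def)
  note linear_sum[OF this(1)] linear_sum[OF this(2)]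
  note * = this bilinear_lmul[OF bilinear_cl_mult] bilinear_rmul[OF bilinear_cl_mult] cl_blade_mult
  have "cl_blade {} \<odot> (\<Sum>A\<in>UNIV. (x $ A) *\<^sub>R cl_blade A) = (\<Sum>A\<in>UNIV. (x $ A) *\<^sub>R cl_blade A)"
    by (simp add: *) (simp add: cl_sign_def)
  then show "cl_blade {} \<odot> x = x" by (simp flip: cl_blade_expansion)
  have "(\<Sum>A\<in>UNIV. (x $ A) *\<^sub>R cl_blade A) \<odot> cl_blade {} = (\<Sum>A\<in>UNIV. (x $ A) *\<^sub>R cl_blade A)"
    by (simp add: *) (simp add: cl_sign_def)
  then show "x \<odot> cl_blade {} = x" by (simp flip: cl_blade_expansion)
qed

lemma cl_gen_anticommute:
  "cl_gen i \<odot> cl_gen j + cl_gen j \<odot> cl_gen i = (if i = j then -2 else 0) *\<^sub>R cl_blade {}"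
proof (cases "i = j")
  case True
  then show ?thesis by (simp add: cl_blade_mult cl_sign_def flip: scaleR_2)
next
  case False
  then have "sym_diff {i} {j} = {i, j}" "sym_diff {j} {i} = {i, j}"
    and "cl_sign {i} {j} + cl_sign {j} {i} = 0"
    by (auto simp: cl_sign_def)
  then show ?thesis using False by (simp only: cl_blade_mult flip: scaleR_left_distrib) simp
qed

lemma cl_blade_insert:
  assumes "\<And>a. a \<in> A \<Longrightarrow> i < a"
  shows "cl_blade (insert i A) = cl_gen i \<odot> cl_blade A"
proof -
  have "sym_diff {i} A = insert i A" "cl_sign {i} A = 1"
    using assms by (auto simp: cl_sign_def)
  then show ?thesis by (simp add: cl_blade_mult)
qed

section \<open>Differentiability and partial derivatives\<close>

definition dir_deriv ::
    "'a::euclidean_space \<Rightarrow> ('a \<Rightarrow> 'b::real_normed_vector) \<Rightarrow> 'a \<Rightarrow> 'b" where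
  "dir_deriv \<xi> f x = frechet_derivative f (at x) \<xi>"

text \<open>Class \<open>C\<^sup>k\<close> in the real sense, on an open set \<open>U\<close>.\<close>

primrec Ck_on ::
    "nat \<Rightarrow> ('a::euclidean_space \<Rightarrow> 'b::real_normed_vector) \<Rightarrow> 'a set \<Rightarrow> bool" where
  "Ck_on 0 f U \<longleftrightarrow> continuous_on U f"
| "Ck_on (Suc k) f U \<longleftrightarrow>
     (\<forall>x\<in>U. f differentiable (at x)) \<and> (\<forall>b\<in>Basis. Ck_on k (dir_deriv b f) U)"

text \<open>The operators on the complex plane, where \<open>t\<close> has direction \<open>1\<close> and \<open>s\<close> has direction \<open>\<i>\<close>.\<close>

definition dbar :: "(complex \<Rightarrow> complex) \<Rightarrow> complex \<Rightarrow> complex" where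
  "dbar f z = (1/2) * (dir_deriv 1 f z + \<i> * dir_deriv \<i> f z)"

definition laplace_plane :: "(complex \<Rightarrow> complex) \<Rightarrow> complex \<Rightarrow> complex" where
  "laplace_plane f z = dir_deriv 1 (dir_deriv 1 f) z + dir_deriv \<i> (dir_deriv \<i> f) z"

section \<open>Root systems\<close>

definition reflection :: "'a::real_inner \<Rightarrow> 'a \<Rightarrow> 'a" where
  "reflection \<alpha> x = x - (2 * (\<alpha> \<bullet> x) / (norm \<alpha>)\<^sup>2) *\<^sub>R \<alpha>"

definition root_system :: "'a::real_inner set \<Rightarrow> bool" where
  "root_system R \<longleftrightarrow> finite R \<and> 0 \<notin> R \<and>
     (\<forall>\<alpha>\<in>R. R \<inter> range (\<lambda>c. c *\<^sub>R \<alpha>) = {\<alpha>, -\<alpha>}) \<and>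
     (\<forall>\<alpha>\<in>R. reflection \<alpha> ` R = R)"

definition positive_subsystem :: "'a::real_inner set \<Rightarrow> 'a set \<Rightarrow> bool" where
  "positive_subsystem R Rp \<longleftrightarrow>
     (\<exists>\<beta>. (\<forall>\<alpha>\<in>R. \<beta> \<bullet> \<alpha> \<noteq> 0) \<and> Rp = {\<alpha>\<in>R. \<beta> \<bullet> \<alpha> > 0})"

text \<open>Reflections are involutions, so the monoid they generate is the group they generate.\<close>

inductive_set reflection_group :: "'a::real_inner set \<Rightarrow> ('a \<Rightarrow> 'a) set" for R where
  id: "id \<in> reflection_group R"
| comp: "\<alpha> \<in> R \<Longrightarrow> w \<in> reflection_group R \<Longrightarrow> reflection \<alpha> \<circ> w \<in> reflection_group R"

definition multiplicity_function :: "'a::real_inner set \<Rightarrow> ('a \<Rightarrow> real) \<Rightarrow> bool" where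
  "multiplicity_function R \<kappa> \<longleftrightarrow>
     (\<forall>\<alpha>\<in>R. 0 \<le> \<kappa> \<alpha>) \<and> (\<forall>w\<in>reflection_group R. \<forall>\<alpha>\<in>R. \<kappa> (w \<alpha>) = \<kappa> \<alpha>)"

definition dunkl_gamma :: "'a set \<Rightarrow> ('a \<Rightarrow> real) \<Rightarrow> real" where
  "dunkl_gamma Rp \<kappa> = (\<Sum>\<alpha>\<in>Rp. \<kappa> \<alpha>)"

definition dunkl_dimension :: "(real ^ 'd) set \<Rightarrow> (real ^ 'd \<Rightarrow> real) \<Rightarrow> real" where
  "dunkl_dimension Rp \<kappa> = 2 * dunkl_gamma Rp \<kappa> + real CARD('d)"

section \<open>Dunkl operators\<close>

definition dunkl_quotient ::
    "'a::euclidean_space \<Rightarrow> ('a \<Rightarrow> 'b::real_normed_vector) \<Rightarrow> 'a \<Rightarrow> 'b" where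
  "dunkl_quotient \<alpha> f x =
     (let q = (\<lambda>y. (f y - f (reflection \<alpha> y)) /\<^sub>R (\<alpha> \<bullet> y))
      in if \<alpha> \<bullet> x = 0 then Lim (at x within {y. \<alpha> \<bullet> y \<noteq> 0}) q else q x)"

text \<open>The Dunkl operator in direction \<open>\<xi>\<close>; \<open>T\<^sub>x\<^sub>i\<close> is the case that \<open>\<xi>\<close> is the \<open>i\<close>-th basis vector.\<close>

definition dunkl_op ::
    "'a::euclidean_space set \<Rightarrow> ('a \<Rightarrow> real) \<Rightarrow> 'a \<Rightarrow> ('a \<Rightarrow> 'b::real_normed_vector) \<Rightarrow> 'a \<Rightarrow> 'b" where
  "dunkl_op Rp \<kappa> \<xi> f x =
     dir_deriv \<xi> f x + (\<Sum>\<alpha>\<in>Rp. (\<kappa> \<alpha> * (\<alpha> \<bullet> \<xi>)) *\<^sub>R dunkl_quotient \<alpha> f x)"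

definition dunkl_dirac ::
    "(real, 'd) vec set \<Rightarrow> ((real, 'd) vec \<Rightarrow> real) \<Rightarrow>
     ((real, 'd) vec \<Rightarrow> 'd::{finite,linorder} clifford) \<Rightarrow> (real, 'd) vec \<Rightarrow> 'd clifford" where
  "dunkl_dirac Rp \<kappa> f x = (\<Sum>i\<in>UNIV. cl_gen i \<odot> dunkl_op Rp \<kappa> (axis i 1) f x)"

text \<open>
  The space \<open>\<real>\<^sup>d\<^sub>1\<close> of the elements \<open>x\<^sub>0 + x\<close> is \<open>real \<times> (real ^ 'd)\<close>. A root \<open>\<alpha>\<close> in \<open>\<real>\<^sup>d\<close> is the vector
  \<open>(0, \<alpha>)\<close> of this space.
\<close>

definition dunkl_op1 ::
    "(real ^ 'd) set \<Rightarrow> (real ^ 'd \<Rightarrow> real) \<Rightarrow> real \<times> (real ^ 'd) \<Rightarrow>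
     (real \<times> (real ^ 'd) \<Rightarrow> 'b::real_normed_vector) \<Rightarrow> real \<times> (real ^ 'd) \<Rightarrow> 'b" where
  "dunkl_op1 Rp \<kappa> = dunkl_op (Pair 0 ` Rp) (\<kappa> \<circ> snd)"

definition dunkl_cauchy_riemann ::
    "(real, 'd) vec set \<Rightarrow> ((real, 'd) vec \<Rightarrow> real) \<Rightarrow>
     (real \<times> (real, 'd) vec \<Rightarrow> 'd::{finite,linorder} clifford) \<Rightarrow> real \<times> (real, 'd) vec \<Rightarrow> 'd clifford" where
  "dunkl_cauchy_riemann Rp \<kappa> f x =
     dir_deriv (1, 0) f x + (\<Sum>i\<in>UNIV. cl_gen i \<odot> dunkl_op1 Rp \<kappa> (0, axis i 1) f x)"

definition dunkl_laplacian ::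
    "(real ^ 'd) set \<Rightarrow> (real ^ 'd \<Rightarrow> real) \<Rightarrow>
     (real \<times> (real ^ 'd) \<Rightarrow> 'b::real_normed_vector) \<Rightarrow> real \<times> (real ^ 'd) \<Rightarrow> 'b" where
  "dunkl_laplacian Rp \<kappa> f x =
     dir_deriv (1, 0) (dir_deriv (1, 0) f) x +
     (\<Sum>i\<in>UNIV. dunkl_op1 Rp \<kappa> (0, axis i 1) (dunkl_op1 Rp \<kappa> (0, axis i 1) f) x)"

text \<open>
  Since derivatives are total functions with unspecified values where they do not exist, the kernel
  of the first-order operator is taken among the functions of class \<open>C\<^sup>1\<close>.
\<close>

definition dunkl_monogenic_on ::
    "(real, 'd) vec set \<Rightarrow> ((real, 'd) vec \<Rightarrow> real) \<Rightarrow>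
     (real \<times> (real, 'd) vec \<Rightarrow> 'd::{finite,linorder} clifford) \<Rightarrow> (real \<times> (real, 'd) vec) set \<Rightarrow> bool" where
  "dunkl_monogenic_on Rp \<kappa> f U \<longleftrightarrow>
     Ck_on 1 f U \<and> (\<forall>x\<in>U. dunkl_cauchy_riemann Rp \<kappa> f x = 0)"

section \<open>Polynomials and axially symmetric functions\<close>

definition homogeneous_polynomial :: "nat \<Rightarrow> (real ^ 'd \<Rightarrow> 'b::real_vector) \<Rightarrow> bool" where
  "homogeneous_polynomial n P \<longleftrightarrow>
     (\<exists>c. \<forall>x. P x = (\<Sum>a | (\<Sum>i\<in>UNIV. a i) = n. (\<Prod>i\<in>UNIV. (x $ i) ^ a i) *\<^sub>R c a))"

definition axial_domain :: "complex set \<Rightarrow> (real \<times> (real ^ 'd)) set" where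
  "axial_domain \<Omega> = {(x0, x). Complex x0 (norm x) \<in> \<Omega>}"

text \<open>For \<open>f = u + \<i> v\<close>, the function \<open>u(x\<^sub>0, |x|) + (x / |x|) v(x\<^sub>0, |x|)\<close>.\<close>

definition axial_extension ::
    "(complex \<Rightarrow> complex) \<Rightarrow> real \<times> (real, 'd) vec \<Rightarrow> 'd::{finite,linorder} clifford" where
  "axial_extension f = (\<lambda>(x0, x).
     Re (f (Complex x0 (norm x))) *\<^sub>R cl_blade {} +
     Im (f (Complex x0 (norm x))) *\<^sub>R cl_vec (x /\<^sub>R norm x))"

end

(*
  With nu = mu + 2 n = 2 k + 1, the function under the iterated Laplacian is A P + B xP, where A = u and
  B = v / s depend on t = x0 and s = |x| only and xP is the product of x and P. Since P and xP are
  homogeneous and Dunkl-harmonic (the latter facts rest on the commutativity of the Dunkl operators),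
  the Laplacian acts on A as L_nu and on B as L_(nu + 2), where L_c = d_t^2 + d_s^2 + ((c - 1) / s) d_s.
  Put delta = (1 / s) d_s. Then delta L_c = L_(c + 2) delta and L_(c + 2 k) = L_c + 2 k delta, so
  L_(c + 2 k)^(m + k) h is a constant multiple of delta^k L_c^m h whenever L_c^(m + 1) h = 0. This applies
  to (c, h) = (1, u) and (3, v / s), with the same constant, and reduces the claim to the Cauchy-Riemann
  equations for the holomorphic function Laplace^m f. The function f is smooth, because it is
  locally a finite sum of terms cnj z ^ j * F z and their conjugates with F holomorphic.
*)

theory Submission
  imports Defs "HOL-Complex_Analysis.Complex_Analysis"
begin

section \<open>Directional derivatives and functions of class \<open>C\<^sup>k\<close>\<close>

text \<open>The m + k Laplacians and D take 2 (m + k) + 1 derivatives, in general more than the 2 m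
  + 1 that are assumed, so smoothness comes first; it is proved on balls, where holomorphic
  primitives exist. On the root hyperplanes the Dunkl quotient is a limit, which is awkward for
  general functions. Every function that arises is, however, a finite sum of terms \<phi>(x0, |x|)
  g(x) with g a polynomial function. The factor \<phi> is invariant under the reflections, so the
  quotient acts on g alone, and there it is an exact division. Put E = nu + s d_s. Then L_nu = d_t^2
  + E delta, and D (A P + B xP) = (d_t A - E B) P + (delta A + d_t B) xP, because the Dirac operator
  sends xP to - nu P and x xP = - s^2 P. The number nu is the eigenvalue on P of the sum of the
  anticommutators of T_i and x_i; on xP it is nu + 2, the degree being higher by one. For nu = 1 the
  system d_t A = E B, delta A = - d_t B is the Cauchy-Riemann system of A + i s B. Applying delta^k
  carries it to nu = 1 + 2 k, since delta E = (E + 2) delta.\<close>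

lemma dir_deriv_eqI: "(f has_derivative f') (at x) \<Longrightarrow> dir_deriv \<xi> f x = f' \<xi>"
  unfolding dir_deriv_def by (metis frechet_derivative_at)

lemma has_derivative_dir_deriv:
  "f differentiable (at x) \<Longrightarrow> (f has_derivative (\<lambda>\<xi>. dir_deriv \<xi> f x)) (at x)"
  unfolding dir_deriv_def using frechet_derivative_works by blast

lemma has_derivative_transform_open:
  assumes "(f has_derivative f') (at x)" "open U" "x \<in> U" "\<And>y. y \<in> U \<Longrightarrow> f y = g y"
  shows "(g has_derivative f') (at x)"
  using has_derivative_transform_within_open[OF assms(1-3), of g] assms(4) by blast

lemma has_derivative_cong_open:
  assumes "open U" "x \<in> U" "\<And>y. y \<in> U \<Longrightarrow> f y = g y"
  shows "(f has_derivative f') (at x) \<longleftrightarrow> (g has_derivative f') (at x)"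
  using has_derivative_transform_open[OF _ assms(1,2), of f f' g]
    has_derivative_transform_open[OF _ assms(1,2), of g f' f] assms(3) by auto

lemma differentiable_cong_open:
  assumes "open U" "x \<in> U" "\<And>y. y \<in> U \<Longrightarrow> f y = g y"
  shows "f differentiable (at x) \<longleftrightarrow> g differentiable (at x)"
  unfolding differentiable_def using has_derivative_cong_open[of U x f g, OF assms] by simp

lemma dir_deriv_cong_open:
  assumes "open U" "x \<in> U" "\<And>y. y \<in> U \<Longrightarrow> f y = g y"
  shows "dir_deriv \<xi> f x = dir_deriv \<xi> g x"
  using has_derivative_cong_open[of U x f g, OF assms] by (simp add: dir_deriv_def frechet_derivative_def)

lemma Ck_on_cong:
  assumes "open U" "\<And>y. y \<in> U \<Longrightarrow> f y = g y"
  shows "Ck_on k f U \<longleftrightarrow> Ck_on k g U"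
  using assms(2)
proof (induction k arbitrary: f g)
  case 0
  then show ?case by (simp cong: continuous_on_cong)
next
  case (Suc k)
  have "Ck_on k (dir_deriv b f) U \<longleftrightarrow> Ck_on k (dir_deriv b g) U" for b
    by (rule Suc.IH) (metis dir_deriv_cong_open assms(1) Suc.prems)
  moreover have "f differentiable (at x) \<longleftrightarrow> g differentiable (at x)" if "x \<in> U" for x
    using differentiable_cong_open[of U x f g, OF assms(1) that Suc.prems] by blast
  ultimately show ?case by simp
qed

lemma Ck_on_mono: "Ck_on k f U \<Longrightarrow> l \<le> k \<Longrightarrow> Ck_on l f U"
proof (induction l arbitrary: k f)
  case 0
  then show ?case
    by (cases k)
      (auto intro!: continuous_at_imp_continuous_on simp: differentiable_imp_continuous_within)
next
  case (Suc l)
  then show ?case by (cases k) auto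
qed

lemma Ck_on_Suc_mono: "Ck_on (Suc k) f U \<Longrightarrow> Ck_on k f U"
  by (rule Ck_on_mono[of "Suc k"]) auto

lemma Ck_on_differentiable: "Ck_on k f U \<Longrightarrow> 0 < k \<Longrightarrow> x \<in> U \<Longrightarrow> f differentiable (at x)"
  by (cases k) auto

lemma Ck_on_subset: "Ck_on k f U \<Longrightarrow> V \<subseteq> U \<Longrightarrow> Ck_on k f V"
  by (induction k arbitrary: f) (auto intro: continuous_on_subset)

lemma Ck_on_local:
  assumes "\<And>x. x \<in> U \<Longrightarrow> \<exists>V. open V \<and> x \<in> V \<and> Ck_on k f V"
  shows "Ck_on k f U"
  using assms
proof (induction k arbitrary: f)
  case 0
  then show ?case
    by (force intro!: continuous_at_imp_continuous_on simp: continuous_on_eq_continuous_at)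
next
  case (Suc k)
  show ?case
    unfolding Ck_on.simps
  proof (intro conjI ballI)
    show "f differentiable (at x)" if "x \<in> U" for x
      using Suc.prems[OF that] by auto
    show "Ck_on k (dir_deriv b f) U" if "b \<in> Basis" for b
      by (rule Suc.IH) (use Suc.prems that in fastforce)
  qed
qed

lemma dir_deriv_const [simp]: "dir_deriv \<xi> (\<lambda>_. c) x = 0"
  by (rule dir_deriv_eqI[of _ "\<lambda>_. 0"]) auto

lemma dir_deriv_add:
  assumes "f differentiable (at x)" "g differentiable (at x)"
  shows "dir_deriv \<xi> (\<lambda>y. f y + g y) x = dir_deriv \<xi> f x + dir_deriv \<xi> g x"
  by (rule dir_deriv_eqI) (intro has_derivative_add has_derivative_dir_deriv assms)

lemma dir_deriv_diff:
  assumes "f differentiable (at x)" "g differentiable (at x)"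
  shows "dir_deriv \<xi> (\<lambda>y. f y - g y) x = dir_deriv \<xi> f x - dir_deriv \<xi> g x"
  by (rule dir_deriv_eqI) (intro has_derivative_diff has_derivative_dir_deriv assms)

lemma dir_deriv_bounded_linear:
  assumes "bounded_linear L" "f differentiable (at x)"
  shows "dir_deriv \<xi> (\<lambda>y. L (f y)) x = L (dir_deriv \<xi> f x)"
  by (rule dir_deriv_eqI)
    (intro bounded_linear.has_derivative[OF assms(1)] has_derivative_dir_deriv assms(2))

lemma differentiable_bounded_linear:
  assumes "bounded_linear L" "f differentiable (at x)"
  shows "(\<lambda>y. L (f y)) differentiable (at x)"
  using assms bounded_linear.has_derivative unfolding differentiable_def by blast

lemma dir_deriv_bilinear:
  assumes "bounded_bilinear mul" "f differentiable (at x)" "g differentiable (at x)"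
  shows "dir_deriv \<xi> (\<lambda>y. mul (f y) (g y)) x = mul (f x) (dir_deriv \<xi> g x) + mul (dir_deriv \<xi> f x) (g x)"
  by (rule dir_deriv_eqI)
    (intro bounded_bilinear.FDERIV[OF assms(1)] has_derivative_dir_deriv assms(2,3))

lemma differentiable_bilinear:
  assumes "bounded_bilinear mul" "f differentiable (at x)" "g differentiable (at x)"
  shows "(\<lambda>y. mul (f y) (g y)) differentiable (at x)"
  using assms bounded_bilinear.FDERIV[OF assms(1)] unfolding differentiable_def by blast

lemmas dir_deriv_scaleR = dir_deriv_bilinear[OF bounded_bilinear_scaleR]
lemmas differentiable_scaleR = differentiable_bilinear[OF bounded_bilinear_scaleR]

lemma Ck_on_add:
  assumes "open U" "Ck_on k f U" "Ck_on k g U"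
  shows "Ck_on k (\<lambda>x. f x + g x) U"
  using assms(2,3)
proof (induction k arbitrary: f g)
  case 0
  then show ?case by (auto intro: continuous_on_add)
next
  case (Suc k)
  have "Ck_on k (dir_deriv b (\<lambda>x. f x + g x)) U" if "b \<in> Basis" for b
    using Suc that Ck_on_cong[OF assms(1), of "dir_deriv b (\<lambda>x. f x + g x)" "\<lambda>x. dir_deriv b f x + dir_deriv b g x" k]
    by (simp add: dir_deriv_add)
  with Suc.prems show ?case by (auto intro: differentiable_add)
qed

lemma Ck_on_bounded_linear:
  assumes "open U" "bounded_linear L" "Ck_on k f U"
  shows "Ck_on k (\<lambda>x. L (f x)) U"
  using assms(3)
proof (induction k arbitrary: f)
  case 0
  then show ?case using bounded_linear.continuous_on[OF assms(2)] by auto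
next
  case (Suc k)
  have "Ck_on k (dir_deriv b (\<lambda>x. L (f x))) U" if "b \<in> Basis" for b
    using Suc that Ck_on_cong[OF assms(1), of "dir_deriv b (\<lambda>x. L (f x))" "\<lambda>x. L (dir_deriv b f x)" k]
    by (simp add: dir_deriv_bounded_linear[OF assms(2)])
  with Suc.prems show ?case by (auto intro: differentiable_bounded_linear[OF assms(2)])
qed

lemma Ck_on_bilinear:
  assumes "bounded_bilinear mul" "open U" "Ck_on k f U" "Ck_on k g U"
  shows "Ck_on k (\<lambda>x. mul (f x) (g x)) U"
  using assms(3,4)
proof (induction k arbitrary: f g)
  case 0
  then show ?case by (auto intro: bounded_bilinear.continuous_on[OF assms(1)])
next
  case (Suc k)
  have "Ck_on k (dir_deriv b (\<lambda>x. mul (f x) (g x))) U" if b: "b \<in> Basis" for b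
  proof -
    have "Ck_on k (\<lambda>x. mul (f x) (dir_deriv b g x) + mul (dir_deriv b f x) (g x)) U"
      using Suc.prems b by (intro Ck_on_add assms(2) Suc.IH) (auto intro: Ck_on_Suc_mono)
    then show ?thesis
      by (rule Ck_on_cong[OF assms(2), THEN iffD1, rotated])
        (use Suc.prems in \<open>simp add: dir_deriv_bilinear[OF assms(1)]\<close>)
  qed
  with Suc.prems show ?case by (auto intro: differentiable_bilinear[OF assms(1)])
qed

lemmas Ck_on_scaleR = Ck_on_bilinear[OF bounded_bilinear_scaleR]
lemmas Ck_on_mult = Ck_on_bilinear[OF bounded_bilinear_mult]

lemma Ck_on_const: "Ck_on k (\<lambda>_::'a::euclidean_space. c) U"
proof (induction k arbitrary: c)
  case (Suc k)
  have "dir_deriv b (\<lambda>_. c) = (\<lambda>_. 0)" for b :: 'a by (simp add: fun_eq_iff)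
  with Suc show ?case by simp
qed auto

lemma Ck_on_inverse:
  fixes f :: "'a::euclidean_space \<Rightarrow> real"
  assumes "open U" "Ck_on k f U" "\<And>x. x \<in> U \<Longrightarrow> f x \<noteq> 0"
  shows "Ck_on k (\<lambda>x. inverse (f x)) U"
  using assms(2,3)
proof (induction k)
  case 0
  then show ?case by (auto intro: continuous_on_inverse)
next
  case (Suc k)
  have der: "((\<lambda>x. inverse (f x)) has_derivative
      (\<lambda>h. - (inverse (f x) * dir_deriv h f x * inverse (f x)))) (at x)" if "x \<in> U" for x
    using Suc.prems that by (intro Deriv.has_derivative_inverse has_derivative_dir_deriv) auto
  have "Ck_on k (dir_deriv b (\<lambda>x. inverse (f x))) U" if b: "b \<in> Basis" for b
  proof -
    have I: "Ck_on k (\<lambda>x. inverse (f x)) U" 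
      using Suc.IH[OF Ck_on_Suc_mono[OF Suc.prems(1)] Suc.prems(2)] .
    \<comment> \<open>The derivative - f' / f^2 needs 1 / f only to order k, which the induction
      hypothesis supplies.\<close>
    have "Ck_on k (\<lambda>x. (- 1) *\<^sub>R (inverse (f x) *\<^sub>R (inverse (f x) *\<^sub>R dir_deriv b f x))) U"
      using Suc.prems b I by (intro Ck_on_scaleR Ck_on_const assms(1)) auto
    then show ?thesis
      by (rule Ck_on_cong[OF assms(1), THEN iffD1, rotated]) (simp add: dir_deriv_eqI[OF der])
  qed
  then show ?case using der unfolding Ck_on.simps differentiable_def by blast
qed

lemma Ck_on_linear:
  assumes "open U" "bounded_linear L"
  shows "Ck_on k L U"
proof (cases k)
  case 0
  then show ?thesis by (simp add: assms(2) linear_continuous_on)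
next
  case (Suc l)
  have der: "(L has_derivative L) (at x)" for x
    using assms(2) by (rule bounded_linear_imp_has_derivative)
  have "dir_deriv b L = (\<lambda>_. L b)" for b
    using dir_deriv_eqI[OF der] by (simp add: fun_eq_iff)
  then show ?thesis using der by (auto simp: Suc Ck_on_const differentiable_def)
qed

section \<open>Symmetry of mixed partial derivatives\<close>

lemma DERIV_along_line:
  fixes h :: "'a::euclidean_space \<Rightarrow> real"
  assumes "h differentiable (at (w + x *\<^sub>R a))"
  shows "((\<lambda>x. h (w + x *\<^sub>R a)) has_real_derivative dir_deriv a h (w + x *\<^sub>R a)) (at x)"
proof -
  have "((\<lambda>x. w + x *\<^sub>R a) has_derivative (\<lambda>t. t *\<^sub>R a)) (at x)"
    by (auto intro!: derivative_eq_intros)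
  from has_derivative_compose[OF this has_derivative_dir_deriv[OF assms]]
  have "((\<lambda>x. h (w + x *\<^sub>R a)) has_derivative (\<lambda>t. dir_deriv (t *\<^sub>R a) h (w + x *\<^sub>R a))) (at x)" .
  moreover have "dir_deriv (t *\<^sub>R a) h (w + x *\<^sub>R a) = dir_deriv a h (w + x *\<^sub>R a) * t" for t
    using linear_cmul[OF has_derivative_linear[OF has_derivative_dir_deriv[OF assms]]] by simp
  ultimately show ?thesis by (simp add: has_field_derivative_def)
qed

text \<open>The mean value theorem is applied along \<open>a\<close> to the difference of two
  translates of \<open>h\<close>, then along \<open>b\<close> to the resulting derivative. The
  left-hand side is symmetric in \<open>a\<close> and \<open>b\<close>, so exchanging them equates
  the two mixed derivatives at points close to \<open>z\<close>.\<close>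

lemma second_difference_mean_value:
  fixes h :: "'a::euclidean_space \<Rightarrow> real"
  assumes "e > 0"
    and box: "\<And>x y. x \<in> {0..e} \<Longrightarrow> y \<in> {0..e} \<Longrightarrow> z + x *\<^sub>R a + y *\<^sub>R b \<in> U"
    and h: "\<And>w. w \<in> U \<Longrightarrow> h differentiable (at w)"
    and h': "\<And>w. w \<in> U \<Longrightarrow> dir_deriv a h differentiable (at w)"
  shows "\<exists>x\<in>{0..e}. \<exists>y\<in>{0..e}. h (z + e *\<^sub>R a + e *\<^sub>R b) - h (z + e *\<^sub>R a) - h (z + e *\<^sub>R b) + h z
      = e * e * dir_deriv b (dir_deriv a h) (z + x *\<^sub>R a + y *\<^sub>R b)"
proof -
  define D where "D = dir_deriv a h"
  have "((\<lambda>x. h ((z + e *\<^sub>R b) + x *\<^sub>R a) - h (z + x *\<^sub>R a)) has_real_derivative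
      D ((z + e *\<^sub>R b) + x *\<^sub>R a) - D (z + x *\<^sub>R a)) (at x)" if "0 \<le> x" "x \<le> e" for x
  proof -
    have "z + x *\<^sub>R a \<in> U" "(z + e *\<^sub>R b) + x *\<^sub>R a \<in> U"
      using box[of x 0] box[of x e] that \<open>e > 0\<close> by (auto simp: algebra_simps)
    then show ?thesis unfolding D_def by (intro DERIV_diff DERIV_along_line h)
  qed
  from MVT2[OF \<open>e > 0\<close> this] obtain x where x: "0 < x" "x < e"
    and 1: "h (z + e *\<^sub>R b + e *\<^sub>R a) - h (z + e *\<^sub>R a) - (h (z + e *\<^sub>R b) - h z)
      = e * (D (z + e *\<^sub>R b + x *\<^sub>R a) - D (z + x *\<^sub>R a))" by auto
  have "((\<lambda>y. D ((z + x *\<^sub>R a) + y *\<^sub>R b)) has_real_derivative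
      dir_deriv b D ((z + x *\<^sub>R a) + y *\<^sub>R b)) (at y)" if "0 \<le> y" "y \<le> e" for y
    unfolding D_def by (intro DERIV_along_line h' box) (use x that in auto)
  from MVT2[OF \<open>e > 0\<close> this] obtain y where y: "0 < y" "y < e"
    and 2: "D (z + x *\<^sub>R a + e *\<^sub>R b) - D (z + x *\<^sub>R a) = e * dir_deriv b D (z + x *\<^sub>R a + y *\<^sub>R b)"
    by auto
  show ?thesis
    using x y 1 2 by (intro bexI[of _ x] bexI[of _ y]) (auto simp: D_def algebra_simps)
qed

lemma mixed_derivatives_commute_real:
  fixes h :: "'a::euclidean_space \<Rightarrow> real"
  assumes "open U" "Ck_on 2 h U" "z \<in> U" "a \<in> Basis" "b \<in> Basis"
  shows "dir_deriv a (dir_deriv b h) z = dir_deriv b (dir_deriv a h) z"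
proof -
  have h: "\<And>w. w \<in> U \<Longrightarrow> h differentiable (at w)"
    and h': "\<And>w c. w \<in> U \<Longrightarrow> c \<in> Basis \<Longrightarrow> dir_deriv c h differentiable (at w)"
    and cont: "\<And>c d. c \<in> Basis \<Longrightarrow> d \<in> Basis \<Longrightarrow> continuous_on U (dir_deriv d (dir_deriv c h))"
    using assms(2) by (auto simp: numeral_2_eq_2)
  let ?p = "dir_deriv b (dir_deriv a h)" and ?q = "dir_deriv a (dir_deriv b h)"
  have "\<bar>?q z - ?p z\<bar> < \<epsilon>" if "\<epsilon> > 0" for \<epsilon>
  proof -
    have "isCont ?p z" "isCont ?q z"
      using cont assms continuous_on_eq_continuous_at by blast+
    then obtain d1 d2 where d: "d1 > 0" "d2 > 0"
        "\<And>w. dist w z < d1 \<Longrightarrow> dist (?p w) (?p z) < \<epsilon> / 2"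
        "\<And>w. dist w z < d2 \<Longrightarrow> dist (?q w) (?q z) < \<epsilon> / 2"
      using \<open>\<epsilon> > 0\<close> unfolding continuous_at_eps_delta by (metis half_gt_zero)
    obtain r where r: "r > 0" "ball z r \<subseteq> U" using assms open_contains_ball by blast
    \<comment> \<open>Points of the box are at distance at most 2 e from \<open>z\<close>; a third
      of the smallest radius leaves room for a strict inequality.\<close>
    define e where "e = Min {d1, d2, r} / 3"
    have e: "e > 0" "3 * e \<le> d1" "3 * e \<le> d2" "3 * e \<le> r" using d r by (auto simp: e_def)
    have near: "dist (z + x *\<^sub>R c + y *\<^sub>R c') z < 3 * e"
      if "x \<in> {0..e}" "y \<in> {0..e}" "c \<in> Basis" "c' \<in> Basis" for x y and c c' :: 'a
    proof -
      have "dist (z + x *\<^sub>R c + y *\<^sub>R c') z = norm (x *\<^sub>R c + y *\<^sub>R c')"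
        by (simp add: dist_norm add.assoc)
      also have "\<dots> \<le> e + e"
        using that by (intro norm_triangle_le add_mono) auto
      finally show ?thesis using e by linarith
    qed
    have box: "z + x *\<^sub>R c + y *\<^sub>R c' \<in> U"
      if "x \<in> {0..e}" "y \<in> {0..e}" "c \<in> Basis" "c' \<in> Basis" for x y c c'
      using near[OF that] e r by (auto simp: subset_eq dist_commute)
    obtain x y where xy: "x \<in> {0..e}" "y \<in> {0..e}"
      "h (z + e *\<^sub>R a + e *\<^sub>R b) - h (z + e *\<^sub>R a) - h (z + e *\<^sub>R b) + h z = e * e * ?p (z + x *\<^sub>R a + y *\<^sub>R b)"
      using second_difference_mean_value[OF e(1) box h h', of a b] assms(4,5) by blast
    obtain x' y' where xy': "x' \<in> {0..e}" "y' \<in> {0..e}"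
      "h (z + e *\<^sub>R b + e *\<^sub>R a) - h (z + e *\<^sub>R b) - h (z + e *\<^sub>R a) + h z = e * e * ?q (z + x' *\<^sub>R b + y' *\<^sub>R a)"
      using second_difference_mean_value[OF e(1) box h h', of b a] assms(4,5) by blast
    have "e * e * ?p (z + x *\<^sub>R a + y *\<^sub>R b) = e * e * ?q (z + x' *\<^sub>R b + y' *\<^sub>R a)"
      using xy(3) xy'(3) by (simp add: algebra_simps)
    then have eq: "?p (z + x *\<^sub>R a + y *\<^sub>R b) = ?q (z + x' *\<^sub>R b + y' *\<^sub>R a)" using e by simp
    show ?thesis
      using d(3)[OF less_le_trans[OF near[OF xy(1,2) assms(4,5)] e(2)]]
        d(4)[OF less_le_trans[OF near[OF xy'(1,2) assms(5,4)] e(3)]] eq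
      by (simp add: dist_real_def abs_if split: if_splits)
  qed
  then show ?thesis by (metis abs_0_eq eq_iff_diff_eq_0 less_irrefl zero_less_abs_iff)
qed

lemma mixed_derivatives_commute:
  fixes h :: "'a::euclidean_space \<Rightarrow> 'b::euclidean_space"
  assumes "open U" "Ck_on 2 h U" "z \<in> U" "a \<in> Basis" "b \<in> Basis"
  shows "dir_deriv a (dir_deriv b h) z = dir_deriv b (dir_deriv a h) z"
proof (rule euclidean_eqI)
  fix c :: 'b assume "c \<in> Basis"
  have L: "bounded_linear (\<lambda>y. y \<bullet> c)" by (rule bounded_linear_inner_left)
  have *: "dir_deriv d (dir_deriv d' (\<lambda>x. h x \<bullet> c)) z = dir_deriv d (dir_deriv d' h) z \<bullet> c"
    if "d' \<in> Basis" for d d'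
  proof -
    have "dir_deriv d (dir_deriv d' (\<lambda>x. h x \<bullet> c)) z = dir_deriv d (\<lambda>x. dir_deriv d' h x \<bullet> c) z"
      using assms(2) by (intro dir_deriv_cong_open[OF assms(1,3)] dir_deriv_bounded_linear[OF L])
        (auto simp: numeral_2_eq_2)
    also have "\<dots> = dir_deriv d (dir_deriv d' h) z \<bullet> c"
      using assms(2,3) that by (intro dir_deriv_bounded_linear[OF L]) (auto simp: numeral_2_eq_2)
    finally show ?thesis .
  qed
  show "dir_deriv a (dir_deriv b h) z \<bullet> c = dir_deriv b (dir_deriv a h) z \<bullet> c"
    using mixed_derivatives_commute_real[OF assms(1) Ck_on_bounded_linear[OF assms(1) L assms(2)] assms(3-5)]
    by (simp add: * assms)
qed

section \<open>Regularity of solutions of \<open>\<partial>\<^bsub>z bar\<^esub> \<Delta>\<^sup>m f = 0\<close>\<close>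

lemma Ck_on_2_laplace:
  assumes "Ck_on 2 (h :: complex \<Rightarrow> complex) U" "z \<in> U" "b \<in> {1, \<i>}"
  shows "h differentiable (at z)" "dir_deriv b h differentiable (at z)"
  using assms by (auto simp: numeral_2_eq_2 Basis_complex_def)

lemma laplace_plane_add:
  assumes "open U" "Ck_on 2 f U" "Ck_on 2 g U" "z \<in> U"
  shows "laplace_plane (\<lambda>z. f z + g z) z = laplace_plane f z + laplace_plane g z"
proof -
  note d = Ck_on_2_laplace[OF assms(2)] Ck_on_2_laplace[OF assms(3)]
  have "dir_deriv b (dir_deriv b (\<lambda>z. f z + g z)) z
      = dir_deriv b (dir_deriv b f) z + dir_deriv b (dir_deriv b g) z" if "b \<in> {1, \<i>}" for b
    using dir_deriv_cong_open[OF assms(1,4), of "dir_deriv b (\<lambda>z. f z + g z)" "\<lambda>z. dir_deriv b f z + dir_deriv b g z" b]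
      that assms(4) by (simp add: dir_deriv_add d)
  then show ?thesis by (simp add: laplace_plane_def)
qed

lemma laplace_plane_bounded_linear:
  assumes "open U" "Ck_on 2 f U" "z \<in> U" "bounded_linear L"
  shows "laplace_plane (\<lambda>z. L (f z)) z = L (laplace_plane f z)"
proof -
  note d = Ck_on_2_laplace[OF assms(2)]
  have "dir_deriv b (dir_deriv b (\<lambda>z. L (f z))) z = L (dir_deriv b (dir_deriv b f) z)"
    if "b \<in> {1, \<i>}" for b
    using dir_deriv_cong_open[OF assms(1,3), of "dir_deriv b (\<lambda>z. L (f z))" "\<lambda>z. L (dir_deriv b f z)" b]
      that assms(3) by (simp add: dir_deriv_bounded_linear[OF assms(4)] d)
  then show ?thesis
    by (simp add: laplace_plane_def linear_add[OF bounded_linear.linear[OF assms(4)]])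
qed

lemma dir_deriv_holomorphic:
  assumes "F holomorphic_on U" "open U" "z \<in> U"
  shows "F differentiable (at z)" "dir_deriv \<xi> F z = deriv F z * \<xi>"
proof -
  have *: "(F has_derivative (\<lambda>\<xi>. deriv F z * \<xi>)) (at z)"
    using holomorphic_derivI[OF assms(1,2,3)] by (simp add: has_field_derivative_def)
  then show "F differentiable (at z)" "dir_deriv \<xi> F z = deriv F z * \<xi>"
    using dir_deriv_eqI[OF *] by (auto simp: differentiable_def)
qed

lemma Ck_on_holomorphic:
  assumes "F holomorphic_on U" "open U"
  shows "Ck_on k F U"
  using assms(1)
proof (induction k arbitrary: F)
  case 0
  then show ?case by (simp add: holomorphic_on_imp_continuous_on)
next
  case (Suc k)
  have "Ck_on k (dir_deriv b F) U" for b
  proof -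
    have "Ck_on k (\<lambda>z. deriv F z * b) U"
      by (intro Suc.IH holomorphic_intros holomorphic_deriv Suc.prems assms(2))
    then show ?thesis
      by (rule Ck_on_cong[OF assms(2), THEN iffD1, rotated])
        (simp add: dir_deriv_holomorphic[OF Suc.prems assms(2)])
  qed
  then show ?case using dir_deriv_holomorphic(1)[OF Suc.prems assms(2)] by simp
qed

text \<open>The real differential is determined by the directions 1 and \<i>; the equation makes it
  multiplication by one complex number.\<close>

lemma cauchy_riemann_imp_holomorphic:
  assumes "open U" "\<And>z. z \<in> U \<Longrightarrow> f differentiable (at z)"
    and "\<And>z. z \<in> U \<Longrightarrow> dir_deriv \<i> f z = \<i> * dir_deriv 1 f z"
  shows "f holomorphic_on U"
proof -
  have "(f has_field_derivative dir_deriv 1 f z) (at z)" if "z \<in> U" for z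
  proof -
    note d = has_derivative_dir_deriv[OF assms(2)[OF that]]
    have "dir_deriv \<xi> f z = dir_deriv 1 f z * \<xi>" for \<xi>
    proof -
      note l = has_derivative_linear[OF d]
      have "\<xi> = Re \<xi> *\<^sub>R 1 + Im \<xi> *\<^sub>R \<i>" by (simp add: complex_eq_iff)
      then have "dir_deriv \<xi> f z = dir_deriv (Re \<xi> *\<^sub>R 1 + Im \<xi> *\<^sub>R \<i>) f z" by simp
      also have "\<dots> = Re \<xi> *\<^sub>R dir_deriv 1 f z + Im \<xi> *\<^sub>R dir_deriv \<i> f z"
        by (simp only: linear_add[OF l] linear_cmul[OF l])
      finally show ?thesis by (simp add: assms(3)[OF that] complex_eq_iff algebra_simps)
    qed
    then have "(\<lambda>\<xi>. dir_deriv \<xi> f z) = (*) (dir_deriv 1 f z)" by (rule ext)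
    with d show ?thesis unfolding has_field_derivative_def by metis
  qed
  then show ?thesis by (metis assms(1) at_within_open field_differentiable_def holomorphic_on_def)
qed

text \<open>Chosen to be visibly smooth and to be closed under solving the Poisson equation.
  Conjugation is included because a harmonic function is a holomorphic one plus the conjugate of
  another.\<close>

inductive polyanalytic :: "complex set \<Rightarrow> (complex \<Rightarrow> complex) \<Rightarrow> bool" for B where
  hol: "F holomorphic_on B \<Longrightarrow> polyanalytic B (\<lambda>z. cnj z ^ j * F z)"
| cnj: "polyanalytic B h \<Longrightarrow> polyanalytic B (\<lambda>z. cnj (h z))"
| add: "polyanalytic B g \<Longrightarrow> polyanalytic B h \<Longrightarrow> polyanalytic B (\<lambda>z. g z + h z)"

lemma holomorphic_imp_polyanalytic: "F holomorphic_on B \<Longrightarrow> polyanalytic B F"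
  using polyanalytic.hol[of F B 0] by simp

lemma Ck_on_cnj_power_mult:
  assumes "F holomorphic_on B" "open B"
  shows "Ck_on k (\<lambda>z. cnj z ^ j * F z) B"
proof -
  have "Ck_on k (\<lambda>z. cnj (z ^ j)) B"
    by (rule Ck_on_bounded_linear[OF assms(2) bounded_linear_cnj Ck_on_holomorphic[OF _ assms(2)]])
      (intro holomorphic_intros)
  then show ?thesis
    using Ck_on_mult[OF assms(2) _ Ck_on_holomorphic[OF assms], of k] by simp
qed

lemma Ck_on_polyanalytic:
  assumes "polyanalytic B h" "open B"
  shows "Ck_on k h B"
  using assms(1)
proof induction
  case (cnj h)
  show ?case by (rule Ck_on_bounded_linear[OF assms(2) bounded_linear_cnj cnj.IH])
qed (intro Ck_on_cnj_power_mult Ck_on_add assms(2); assumption)+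

text \<open>The plane Laplacian is four times the product of the derivatives in z and in its
  conjugate.\<close>

lemma laplace_plane_cnj_power_mult:
  assumes G: "G holomorphic_on B" and "open B" "z \<in> B"
  shows "laplace_plane (\<lambda>z. cnj z ^ Suc p * G z) z = 4 * of_nat (Suc p) * cnj z ^ p * deriv G z"
proof -
  define M where "M = (\<lambda>p (G :: complex \<Rightarrow> complex) z. cnj z ^ p * G z)"
  have dM: "M p G differentiable (at z)" if "G holomorphic_on B" "z \<in> B" for p G z
    unfolding M_def by (rule Ck_on_differentiable[OF Ck_on_cnj_power_mult[OF that(1) assms(2), of 1] _ that(2)]) simp
  \<comment> \<open>For p = 0 the truncated exponent \<open>p - 1\<close> does no harm, since it
    comes with the factor \<open>of_nat p\<close>.\<close>
  have M': "dir_deriv \<xi> (M p G) z = (of_nat p * cnj \<xi>) * M (p - 1) G z + \<xi> * M p (deriv G) z"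
    if "G holomorphic_on B" "z \<in> B" for p G z \<xi>
    unfolding M_def
    using holomorphic_derivI[OF that(1) assms(2) that(2)]
    by (intro dir_deriv_eqI[where f' = "\<lambda>\<xi>. (of_nat p * cnj \<xi>) * (cnj z ^ (p - 1) * G z) + \<xi> * (cnj z ^ p * deriv G z)"])
      (auto intro!: derivative_eq_intros has_derivative_cnj simp: has_field_derivative_def algebra_simps)
  note hd = holomorphic_deriv[OF _ assms(2)]
  have "dir_deriv \<xi> (dir_deriv \<xi> (M (Suc p) G)) z
      = (of_nat (Suc p) * cnj \<xi>) * ((of_nat p * cnj \<xi>) * M (p - 1) G z + \<xi> * M p (deriv G) z)
        + \<xi> * ((of_nat (Suc p) * cnj \<xi>) * M p (deriv G) z + \<xi> * M (Suc p) (deriv (deriv G)) z)"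
    for \<xi>
  proof -
    have "dir_deriv \<xi> (dir_deriv \<xi> (M (Suc p) G)) z
        = dir_deriv \<xi> (\<lambda>z. (of_nat (Suc p) * cnj \<xi>) * M p G z + \<xi> * M (Suc p) (deriv G) z) z"
      using M'[OF G] by (intro dir_deriv_cong_open[OF assms(2,3)]) simp
    also have "\<dots> = (of_nat (Suc p) * cnj \<xi>) * dir_deriv \<xi> (M p G) z + \<xi> * dir_deriv \<xi> (M (Suc p) (deriv G)) z"
      using assms(3) G hd[OF G]
      by (subst dir_deriv_add)
        (auto intro!: differentiable_bounded_linear[OF bounded_linear_mult_right] dM
          simp: dir_deriv_bounded_linear[OF bounded_linear_mult_right] dM simp del: of_nat_Suc)
    finally show ?thesis using assms(3) by (simp add: M' G hd del: of_nat_Suc)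
  qed
  \<comment> \<open>Over the directions 1 and \<i> the squares of \<open>\<xi>\<close> and of
    \<open>cnj \<xi>\<close> sum to 0, while \<open>\<xi> * cnj \<xi>\<close> occurs twice and sums
    to 2 each time; this is the 4.\<close>
  then have "laplace_plane (M (Suc p) G) z = 4 * of_nat (Suc p) * M p (deriv G) z"
    by (simp add: laplace_plane_def algebra_simps)
  then show ?thesis by (simp add: M_def)
qed

text \<open>A preimage of \<open>cnj z ^ j * F z\<close> arises by integrating in both z and its
  conjugate: convexity gives a primitive of \<open>F\<close>, and the factor 4 (j + 1) produced by
  the Laplacian is divided out.\<close>

lemma polyanalytic_laplace_surj:
  assumes "polyanalytic B g" "open B" "convex B"
  shows "\<exists>E. polyanalytic B E \<and> (\<forall>z\<in>B. laplace_plane E z = g z)"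
  using assms(1)
proof induction
  case (hol F j)
  obtain G where G: "\<And>x. x \<in> B \<Longrightarrow> (G has_field_derivative F x) (at x)"
    using holomorphic_convex_primitive'[OF assms(3,2) hol] by (metis assms(2) at_within_open)
  define H where "H = (\<lambda>z. G z / (4 * of_nat (Suc j)))"
  have H: "(H has_field_derivative F z / (4 * of_nat (Suc j))) (at z)" if "z \<in> B" for z
    unfolding H_def by (intro DERIV_cdivide G that)
  then have hH: "H holomorphic_on B"
    by (metis assms(2) at_within_open field_differentiable_def holomorphic_on_def)
  have "laplace_plane (\<lambda>z. cnj z ^ Suc j * H z) z = cnj z ^ j * F z" if "z \<in> B" for z
    using laplace_plane_cnj_power_mult[OF hH assms(2) that, of j] DERIV_imp_deriv[OF H[OF that]]
    by (simp del: of_nat_Suc)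
  then show ?case using polyanalytic.hol[OF hH] by blast
next
  case (cnj h)
  then obtain E where E: "polyanalytic B E" "\<forall>z\<in>B. laplace_plane E z = h z" by blast
  have "laplace_plane (\<lambda>z. cnj (E z)) z = cnj (h z)" if "z \<in> B" for z
    using laplace_plane_bounded_linear[OF assms(2) Ck_on_polyanalytic[OF E(1) assms(2)] that bounded_linear_cnj]
      E(2) that by simp
  then show ?case using polyanalytic.cnj[OF E(1)] by blast
next
  case (add g h)
  then obtain E E' where E: "polyanalytic B E" "\<forall>z\<in>B. laplace_plane E z = g z"
    "polyanalytic B E'" "\<forall>z\<in>B. laplace_plane E' z = h z" by blast
  have "laplace_plane (\<lambda>z. E z + E' z) z = g z + h z" if "z \<in> B" for z
    using laplace_plane_add[OF assms(2) Ck_on_polyanalytic[OF E(1) assms(2)] Ck_on_polyanalytic[OF E(3) assms(2)] that]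
      E that by simp
  then show ?case using polyanalytic.add[OF E(1,3)] by blast
qed

text \<open>Here \<open>w\<close> is twice the z-derivative of \<open>h\<close>, and it is
  holomorphic because its derivative in the conjugate variable is half the Laplacian of
  \<open>h\<close>. Subtracting a primitive \<open>G\<close> of \<open>w / 2\<close> leaves
  \<open>k\<close> with vanishing z-derivative, so the conjugate of \<open>k\<close> is
  holomorphic.\<close>

lemma harmonic_imp_polyanalytic:
  assumes "open B" "convex B" "Ck_on 2 h B" "\<And>z. z \<in> B \<Longrightarrow> laplace_plane h z = 0"
  shows "\<exists>g. polyanalytic B g \<and> (\<forall>z\<in>B. h z = g z)"
proof -
  note d = Ck_on_2_laplace[OF assms(3)]
  define w where "w = (\<lambda>z. dir_deriv 1 h z - \<i> * dir_deriv \<i> h z)"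
  have di: "(\<lambda>z. \<i> * dir_deriv \<i> h z) differentiable (at z)" if "z \<in> B" for z
    by (intro differentiable_bounded_linear[OF bounded_linear_mult_right] d that) auto
  have dw: "dir_deriv \<xi> w z = dir_deriv \<xi> (dir_deriv 1 h) z - \<i> * dir_deriv \<xi> (dir_deriv \<i> h) z"
    if "z \<in> B" for \<xi> z
    unfolding w_def using that
    by (simp add: dir_deriv_diff d di dir_deriv_bounded_linear[OF bounded_linear_mult_right])
  have "w holomorphic_on B"
  proof (rule cauchy_riemann_imp_holomorphic[OF assms(1)])
    show "w differentiable (at z)" if "z \<in> B" for z
      unfolding w_def using that d(2)[OF that, of 1] di by (intro differentiable_diff) auto
    show "dir_deriv \<i> w z = \<i> * dir_deriv 1 w z" if "z \<in> B" for z
    proof -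
      have "dir_deriv \<i> (dir_deriv \<i> h) z = - dir_deriv 1 (dir_deriv 1 h) z"
        using assms(4)[OF that] by (simp add: laplace_plane_def add_eq_0_iff2)
      moreover have "dir_deriv \<i> (dir_deriv 1 h) z = dir_deriv 1 (dir_deriv \<i> h) z"
        by (rule mixed_derivatives_commute[OF assms(1,3) that]) (auto simp: Basis_complex_def)
      ultimately show ?thesis by (simp add: dw[OF that] algebra_simps)
    qed
  qed
  then have "(\<lambda>z. w z / 2) holomorphic_on B" by (intro holomorphic_intros) auto
  from holomorphic_convex_primitive'[OF assms(2,1) this]
  obtain G where G: "\<And>z. z \<in> B \<Longrightarrow> (G has_field_derivative w z / 2) (at z)"
    by (metis assms(1) at_within_open)
  then have hG: "G holomorphic_on B"
    by (metis assms(1) at_within_open field_differentiable_def holomorphic_on_def)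
  note G' = dir_deriv_holomorphic[OF hG assms(1)]
  define k where "k = (\<lambda>z. h z - G z)"
  have dk: "k differentiable (at z)" "dir_deriv \<xi> k z = dir_deriv \<xi> h z - w z / 2 * \<xi>" if "z \<in> B" for z \<xi>
    using that d(1)[OF that, of 1] G'(1)[OF that] G'(2)[OF that] DERIV_imp_deriv[OF G[OF that]]
    by (auto simp: k_def dir_deriv_diff intro!: differentiable_diff)
  have "(\<lambda>z. cnj (k z)) holomorphic_on B"
  proof (rule cauchy_riemann_imp_holomorphic[OF assms(1)])
    show "(\<lambda>z. cnj (k z)) differentiable (at z)" if "z \<in> B" for z
      by (intro differentiable_bounded_linear[OF bounded_linear_cnj] dk that)
    show "dir_deriv \<i> (\<lambda>z. cnj (k z)) z = \<i> * dir_deriv 1 (\<lambda>z. cnj (k z)) z" if "z \<in> B" for z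
    proof -
      have "dir_deriv 1 k z = \<i> * dir_deriv \<i> k z"
        using that by (simp add: dk w_def field_simps)
      then have "cnj (dir_deriv 1 k z) = - \<i> * cnj (dir_deriv \<i> k z)" by simp
      then show ?thesis
        using that by (simp add: dir_deriv_bounded_linear[OF bounded_linear_cnj] dk(1))
    qed
  qed
  from polyanalytic.add[OF holomorphic_imp_polyanalytic[OF hG]
      polyanalytic.cnj[OF holomorphic_imp_polyanalytic[OF this]]]
  show ?thesis by (intro exI[of _ "\<lambda>z. G z + cnj (cnj (k z))"]) (auto simp: k_def)
qed

lemma Ck_on_laplace_plane:
  assumes "open U" "Ck_on (k + 2) f U"
  shows "Ck_on k (laplace_plane f) U"
proof -
  have "Ck_on k (\<lambda>z. dir_deriv 1 (dir_deriv 1 f) z + dir_deriv \<i> (dir_deriv \<i> f) z) U"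
    using assms by (intro Ck_on_add) (auto simp: Basis_complex_def)
  then show ?thesis by (simp add: laplace_plane_def[abs_def])
qed

text \<open>The induction hypothesis describes the Laplacian of \<open>f\<close>. A solution
  \<open>E\<close> of the same Poisson equation within the class differs from \<open>f\<close> by a
  harmonic function, which belongs to the class as well.\<close>

lemma dbar_laplace_power_imp_polyanalytic:
  assumes "open B" "convex B" "Ck_on (2 * m + 1) f B"
    and "\<And>z. z \<in> B \<Longrightarrow> dbar ((laplace_plane ^^ m) f) z = 0"
  shows "\<exists>g. polyanalytic B g \<and> (\<forall>z\<in>B. f z = g z)"
  using assms(3,4)
proof (induction m arbitrary: f)
  case 0
  have "f holomorphic_on B"
  proof (rule cauchy_riemann_imp_holomorphic[OF assms(1)])
    show "dir_deriv \<i> f z = \<i> * dir_deriv 1 f z" if "z \<in> B" for z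
    proof -
      have "dir_deriv 1 f z = - (\<i> * dir_deriv \<i> f z)"
        using 0(2)[OF that] by (simp add: dbar_def add_eq_0_iff2)
      then show ?thesis by simp
    qed
  qed (use 0 in auto)
  then show ?case using holomorphic_imp_polyanalytic by blast
next
  case (Suc m)
  have C: "Ck_on (2 * m + 3) f B" using Suc.prems(1) by (simp add: eval_nat_numeral)
  have "Ck_on (2 * m + 1) (laplace_plane f) B"
    by (rule Ck_on_laplace_plane[OF assms(1)]) (use C in \<open>simp add: eval_nat_numeral\<close>)
  moreover have "dbar ((laplace_plane ^^ m) (laplace_plane f)) z = 0" if "z \<in> B" for z
    using Suc.prems(2)[OF that] by (simp add: funpow_swap1)
  ultimately obtain g where g: "polyanalytic B g" "\<forall>z\<in>B. laplace_plane f z = g z"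
    using Suc.IH by blast
  obtain E where E: "polyanalytic B E" "\<forall>z\<in>B. laplace_plane E z = g z"
    using polyanalytic_laplace_surj[OF g(1) assms(1,2)] by blast
  have CE: "Ck_on 2 E B" and Cf: "Ck_on 2 f B"
    using Ck_on_polyanalytic[OF E(1) assms(1)] Ck_on_mono[OF C, of 2] by auto
  have m: "bounded_linear (\<lambda>x::complex. - x)"
    by (intro bounded_linear_minus bounded_linear_ident)
  note CE' = Ck_on_bounded_linear[OF assms(1) m CE]
  have Z: "laplace_plane (\<lambda>z. f z + - E z) z = 0" if "z \<in> B" for z
    using laplace_plane_add[OF assms(1) Cf CE' that] laplace_plane_bounded_linear[OF assms(1) CE that m]
      that g(2) E(2) by simp
  obtain h where h: "polyanalytic B h" "\<forall>z\<in>B. f z + - E z = h z"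
    using harmonic_imp_polyanalytic[OF assms(1,2) Ck_on_add[OF assms(1) Cf CE'] Z] by blast
  have "\<forall>z\<in>B. f z = E z + h z" using h(2) by (auto simp: algebra_simps)
  then show ?case using polyanalytic.add[OF E(1) h(1)] by blast
qed

text \<open>Smoothness is local, so it may be checked on balls; these are convex, as the
  construction of primitives requires.\<close>

proposition dbar_laplace_power_regularity:
  assumes "open U" "Ck_on (2 * m + 1) f U"
    and "\<And>z. z \<in> U \<Longrightarrow> dbar ((laplace_plane ^^ m) f) z = 0"
  shows "Ck_on k f U"
proof (rule Ck_on_local)
  fix z assume "z \<in> U"
  then obtain r where r: "r > 0" "ball z r \<subseteq> U" using assms(1) open_contains_ball by blast
  have "\<exists>g. polyanalytic (ball z r) g \<and> (\<forall>w\<in>ball z r. f w = g w)"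
    by (rule dbar_laplace_power_imp_polyanalytic[OF _ _ Ck_on_subset[OF assms(2) r(2)]])
      (use r assms(3) in auto)
  then obtain g where g: "polyanalytic (ball z r) g" "\<And>w. w \<in> ball z r \<Longrightarrow> f w = g w" by blast
  have "Ck_on k f (ball z r)"
    using Ck_on_polyanalytic[OF g(1)] Ck_on_cong[of "ball z r" f g] g(2) by auto
  then show "\<exists>V. open V \<and> z \<in> V \<and> Ck_on k f V" using r by (intro exI[of _ "ball z r"]) auto
qed

section \<open>Differential operators in the upper half plane\<close>

text \<open>
  The coordinates are \<open>t = Re z\<close> and \<open>s = Im z\<close>. All operators cut off outside \<open>\<Omega>\<close>, so that
  identities valid on \<open>\<Omega>\<close> become equations between functions.
\<close>

locale upper_domain =
  fixes \<Omega> :: "complex set"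
  assumes open_dom: "open \<Omega>" and dom_upper: "\<Omega> \<subseteq> {z. Im z > 0}"
begin

definition smooth :: "(complex \<Rightarrow> 'b::real_normed_vector) \<Rightarrow> bool" where
  "smooth f \<longleftrightarrow> (\<forall>k. Ck_on k f \<Omega>)"

definition cutoff :: "(complex \<Rightarrow> real) \<Rightarrow> complex \<Rightarrow> real" where
  "cutoff \<phi> z = (if z \<in> \<Omega> then \<phi> z else 0)"

text \<open>Vanishing outside \<Omega> makes such a function determined by its values on \<Omega>,
  so identities can be rewritten under iterates. No regularity across the boundary is asked
  for.\<close>

definition smooth0 :: "(complex \<Rightarrow> real) \<Rightarrow> bool" where
  "smooth0 \<phi> \<longleftrightarrow> smooth \<phi> \<and> (\<forall>z. z \<notin> \<Omega> \<longrightarrow> \<phi> z = 0)"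

definition dt :: "(complex \<Rightarrow> real) \<Rightarrow> complex \<Rightarrow> real" where
  "dt \<phi> = cutoff (dir_deriv 1 \<phi>)"

definition dl :: "(complex \<Rightarrow> real) \<Rightarrow> complex \<Rightarrow> real" where
  "dl \<phi> = cutoff (\<lambda>z. dir_deriv \<i> \<phi> z / Im z)"

text \<open>On \<Omega> this is c + s d_s. Writing s d_s as s^2 times \<open>dl\<close> keeps
  \<open>dl\<close> and \<open>dt\<close> as the only derivations, so commuting with them settles
  everything built from them.\<close>

definition euler :: "real \<Rightarrow> (complex \<Rightarrow> real) \<Rightarrow> complex \<Rightarrow> real" where
  "euler c \<phi> z = c * \<phi> z + (Im z)\<^sup>2 * dl \<phi> z"

text \<open>This is \<open>\<partial>\<^sub>t\<^sup>2 + \<partial>\<^sub>s\<^sup>2 + ((c - 1) / s) \<partial>\<^sub>s\<close>.\<close>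

definition lam :: "real \<Rightarrow> (complex \<Rightarrow> real) \<Rightarrow> complex \<Rightarrow> real" where
  "lam c \<phi> z = dt (dt \<phi>) z + euler c (dl \<phi>) z"

lemma Im_pos: "z \<in> \<Omega> \<Longrightarrow> 0 < Im z"
  using dom_upper by auto

lemma smooth_cong: "(\<And>z. z \<in> \<Omega> \<Longrightarrow> f z = g z) \<Longrightarrow> smooth f \<longleftrightarrow> smooth g"
  unfolding smooth_def using Ck_on_cong[OF open_dom, of f g] by blast

lemma smooth_differentiable: "smooth f \<Longrightarrow> z \<in> \<Omega> \<Longrightarrow> f differentiable (at z)"
  unfolding smooth_def using Ck_on_differentiable[of 1 f \<Omega> z] zero_less_one by blast

lemma smooth_dir_deriv: "smooth f \<Longrightarrow> b \<in> Basis \<Longrightarrow> smooth (dir_deriv b f)"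
  unfolding smooth_def by (metis Ck_on.simps(2))

lemma smooth_add: "smooth f \<Longrightarrow> smooth g \<Longrightarrow> smooth (\<lambda>z. f z + g z)"
  unfolding smooth_def using Ck_on_add[OF open_dom] by blast

lemma smooth_bounded_linear: "bounded_linear L \<Longrightarrow> smooth f \<Longrightarrow> smooth (\<lambda>z. L (f z))"
  unfolding smooth_def using Ck_on_bounded_linear[OF open_dom] by blast

lemma smooth_mult:
  fixes \<phi> \<psi> :: "complex \<Rightarrow> real"
  shows "smooth \<phi> \<Longrightarrow> smooth \<psi> \<Longrightarrow> smooth (\<lambda>z. \<phi> z * \<psi> z)"
  unfolding smooth_def using Ck_on_mult[OF open_dom] by blast

lemma smooth_const: "smooth (\<lambda>_. c)"
  unfolding smooth_def using Ck_on_const by blast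

lemma smooth_Im: "smooth Im"
  unfolding smooth_def using Ck_on_linear[OF open_dom bounded_linear_Im] by blast

lemma smooth_inverse_Im: "smooth (\<lambda>z. inverse (Im z))"
  unfolding smooth_def
proof
  show "Ck_on k (\<lambda>z. inverse (Im z)) \<Omega>" for k
    by (rule Ck_on_inverse[OF open_dom Ck_on_linear[OF open_dom bounded_linear_Im]])
      (use Im_pos in fastforce)
qed

lemma smooth0_outside: "smooth0 \<phi> \<Longrightarrow> z \<notin> \<Omega> \<Longrightarrow> \<phi> z = 0"
  by (simp add: smooth0_def)

lemma smooth0_smooth: "smooth0 \<phi> \<Longrightarrow> smooth \<phi>"
  by (simp add: smooth0_def)

lemma smooth0_differentiable: "smooth0 \<phi> \<Longrightarrow> z \<in> \<Omega> \<Longrightarrow> \<phi> differentiable (at z)"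
  by (simp add: smooth0_def smooth_differentiable)

lemma smooth0_cutoff: "smooth \<phi> \<Longrightarrow> smooth0 (cutoff \<phi>)"
  unfolding smooth0_def using smooth_cong[of "cutoff \<phi>" \<phi>] by (auto simp: cutoff_def)

lemma smooth0_mult_left: "smooth \<psi> \<Longrightarrow> smooth0 \<phi> \<Longrightarrow> smooth0 (\<lambda>z. \<psi> z * \<phi> z)"
  by (auto simp: smooth0_def intro: smooth_mult)

lemma smooth0_add: "smooth0 \<phi> \<Longrightarrow> smooth0 \<psi> \<Longrightarrow> smooth0 (\<lambda>z. \<phi> z + \<psi> z)"
  by (auto simp: smooth0_def intro: smooth_add)

lemma smooth0_dt: "smooth0 \<phi> \<Longrightarrow> smooth0 (dt \<phi>)"
  unfolding dt_def
  by (intro smooth0_cutoff smooth_dir_deriv smooth0_smooth) (auto simp: Basis_complex_def)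

lemma smooth0_dl:
  assumes "smooth0 \<phi>"
  shows "smooth0 (dl \<phi>)"
proof -
  have "smooth (\<lambda>z. dir_deriv \<i> \<phi> z * inverse (Im z))"
    using assms
    by (intro smooth_mult smooth_dir_deriv smooth0_smooth smooth_inverse_Im) (auto simp: Basis_complex_def)
  then show ?thesis unfolding dl_def divide_inverse by (rule smooth0_cutoff)
qed

lemma smooth0_euler: "smooth0 \<phi> \<Longrightarrow> smooth0 (euler c \<phi>)"
  unfolding euler_def[abs_def] power2_eq_square
  by (intro smooth0_add smooth0_mult_left smooth_const smooth0_dl smooth_mult smooth_Im)

lemma smooth0_lam: "smooth0 \<phi> \<Longrightarrow> smooth0 (lam c \<phi>)"
  unfolding lam_def[abs_def] by (intro smooth0_add smooth0_euler smooth0_dt smooth0_dl)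

lemma smooth0_lam_funpow: "smooth0 \<phi> \<Longrightarrow> smooth0 ((lam c ^^ j) \<phi>)"
  by (induction j) (auto intro: smooth0_lam)

lemma smooth0_dl_funpow: "smooth0 \<phi> \<Longrightarrow> smooth0 ((dl ^^ j) \<phi>)"
  by (induction j) (auto intro: smooth0_dl)

section \<open>Product rules and commutation relations of the plane operators\<close>

lemma dt_add: "smooth0 \<phi> \<Longrightarrow> smooth0 \<psi> \<Longrightarrow> dt (\<lambda>z. \<phi> z + \<psi> z) = (\<lambda>z. dt \<phi> z + dt \<psi> z)"
  by (auto simp: dt_def cutoff_def fun_eq_iff dir_deriv_add smooth0_differentiable)

lemma dl_add: "smooth0 \<phi> \<Longrightarrow> smooth0 \<psi> \<Longrightarrow> dl (\<lambda>z. \<phi> z + \<psi> z) = (\<lambda>z. dl \<phi> z + dl \<psi> z)"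
  by (auto simp: dl_def cutoff_def fun_eq_iff dir_deriv_add smooth0_differentiable add_divide_distrib)

lemma dir_deriv_mult_real:
  fixes \<phi> \<psi> :: "complex \<Rightarrow> real"
  assumes "\<phi> differentiable (at z)" "\<psi> differentiable (at z)"
  shows "dir_deriv \<xi> (\<lambda>z. \<phi> z * \<psi> z) z = \<phi> z * dir_deriv \<xi> \<psi> z + dir_deriv \<xi> \<phi> z * \<psi> z"
  using assms by (rule dir_deriv_bilinear[OF bounded_bilinear_mult])

lemma dt_mult:
  "smooth \<psi> \<Longrightarrow> smooth0 \<phi> \<Longrightarrow> dt (\<lambda>z. \<psi> z * \<phi> z) = (\<lambda>z. \<psi> z * dt \<phi> z + dir_deriv 1 \<psi> z * \<phi> z)"
  by (auto simp: dt_def cutoff_def fun_eq_iff dir_deriv_mult_real smooth_differentiable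
      smooth0_differentiable smooth0_outside)

lemma dl_mult:
  "smooth \<psi> \<Longrightarrow> smooth0 \<phi> \<Longrightarrow>
    dl (\<lambda>z. \<psi> z * \<phi> z) = (\<lambda>z. \<psi> z * dl \<phi> z + dir_deriv \<i> \<psi> z / Im z * \<phi> z)"
  by (auto simp: dl_def cutoff_def fun_eq_iff dir_deriv_mult_real smooth_differentiable
      smooth0_differentiable smooth0_outside add_divide_distrib)

lemma dir_deriv_Im: "dir_deriv \<xi> Im z = Im \<xi>"
  by (rule dir_deriv_eqI) (auto intro!: derivative_eq_intros)

lemma dir_deriv_Im_squared: "dir_deriv \<xi> (\<lambda>z. (Im z)\<^sup>2) z = 2 * Im z * Im \<xi>"
  by (rule dir_deriv_eqI[of _ "\<lambda>\<xi>. 2 * Im z * Im \<xi>"]) (auto intro!: derivative_eq_intros)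

lemma smooth_Im_squared: "smooth (\<lambda>z. (Im z)\<^sup>2)"
  unfolding power2_eq_square by (intro smooth_mult smooth_Im)

lemma dt_scale: "smooth0 \<phi> \<Longrightarrow> dt (\<lambda>z. c * \<phi> z) = (\<lambda>z. c * dt \<phi> z)"
  using dt_mult[OF smooth_const] by simp

lemma dl_scale: "smooth0 \<phi> \<Longrightarrow> dl (\<lambda>z. c * \<phi> z) = (\<lambda>z. c * dl \<phi> z)"
  using dl_mult[OF smooth_const] by simp

lemma dt_Im_squared_mult: "smooth0 \<phi> \<Longrightarrow> dt (\<lambda>z. (Im z)\<^sup>2 * \<phi> z) = (\<lambda>z. (Im z)\<^sup>2 * dt \<phi> z)"
  using dt_mult[OF smooth_Im_squared, of \<phi>] by (simp add: dir_deriv_Im_squared)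

lemma dl_Im_squared_mult:
  assumes "smooth0 \<phi>"
  shows "dl (\<lambda>z. (Im z)\<^sup>2 * \<phi> z) = (\<lambda>z. (Im z)\<^sup>2 * dl \<phi> z + 2 * \<phi> z)"
proof -
  \<comment> \<open>Off \<Omega> the quotient \<open>Im z / Im z\<close> may be 0 by convention, but
    there \<open>\<phi>\<close> vanishes.\<close>
  have *: "2 * Im z * Im \<i> / Im z * \<phi> z = 2 * \<phi> z" for z
    using Im_pos[of z] smooth0_outside[OF assms, of z] by (cases "z \<in> \<Omega>") auto
  then show ?thesis
    using dl_mult[OF smooth_Im_squared assms] by (simp only: dir_deriv_Im_squared *)
qed

lemma dt_Im_mult: "smooth0 \<phi> \<Longrightarrow> dt (\<lambda>z. Im z * \<phi> z) = (\<lambda>z. Im z * dt \<phi> z)"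
  using dt_mult[OF smooth_Im, of \<phi>] by (simp add: dir_deriv_Im)

text \<open>Since \<open>euler 1\<close> is multiplication by s followed by d_s, this rule is the
  bridge between a function v and its quotient v / s.\<close>

lemma dl_Im_mult: "smooth0 \<phi> \<Longrightarrow> dl (\<lambda>z. Im z * \<phi> z) = (\<lambda>z. euler 1 \<phi> z / Im z)"
  using dl_mult[OF smooth_Im, of \<phi>]
  by (auto simp: dir_deriv_Im fun_eq_iff euler_def add_divide_distrib power2_eq_square)

text \<open>The weight 1 / s does not depend on t, so the symmetry of mixed derivatives
  suffices.\<close>

lemma dl_dt:
  assumes "smooth0 \<phi>"
  shows "dl (dt \<phi>) = dt (dl \<phi>)"
proof
  fix z
  show "dl (dt \<phi>) z = dt (dl \<phi>) z"
  proof (cases "z \<in> \<Omega>")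
    case True
    have C: "Ck_on 2 \<phi> \<Omega>" using assms by (simp add: smooth0_def smooth_def)
    have i: "\<i> \<in> Basis" by (simp add: Basis_complex_def)
    have di: "dir_deriv \<i> \<phi> differentiable (at z)"
      using smooth_differentiable[OF smooth_dir_deriv[OF smooth0_smooth[OF assms] i] True] .
    have inv: "((\<lambda>z. inverse (Im z)) has_derivative
        (\<lambda>\<xi>. - (inverse (Im z) * Im \<xi> * inverse (Im z)))) (at z)"
      using Im_pos[OF True] by (intro Deriv.has_derivative_inverse) (auto intro!: derivative_eq_intros)
    have "dir_deriv \<i> (dt \<phi>) z = dir_deriv \<i> (dir_deriv 1 \<phi>) z"
      by (rule dir_deriv_cong_open[OF open_dom True]) (simp add: dt_def cutoff_def)
    also have "\<dots> = dir_deriv 1 (dir_deriv \<i> \<phi>) z"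
      by (rule mixed_derivatives_commute_real[OF open_dom C True]) (auto simp: Basis_complex_def)
    finally have 1: "dl (dt \<phi>) z = dir_deriv 1 (dir_deriv \<i> \<phi>) z / Im z"
      using True by (simp add: dl_def cutoff_def)
    have "dir_deriv 1 (dl \<phi>) z = dir_deriv 1 (\<lambda>z. dir_deriv \<i> \<phi> z * inverse (Im z)) z"
      by (rule dir_deriv_cong_open[OF open_dom True]) (simp add: dl_def cutoff_def divide_inverse)
    also have "\<dots> = dir_deriv 1 (dir_deriv \<i> \<phi>) z / Im z"
      using inv by (subst dir_deriv_mult_real[OF di])
        (auto simp: differentiable_def dir_deriv_eqI[OF inv] divide_inverse)
    finally show ?thesis using 1 True by (simp add: dt_def cutoff_def)
  qed (simp add: dl_def dt_def cutoff_def)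
qed

lemma euler_add: "smooth0 \<phi> \<Longrightarrow> smooth0 \<psi> \<Longrightarrow> euler c (\<lambda>z. \<phi> z + \<psi> z) = (\<lambda>z. euler c \<phi> z + euler c \<psi> z)"
  by (simp add: euler_def dl_add fun_eq_iff algebra_simps)

lemma euler_scale: "smooth0 \<phi> \<Longrightarrow> euler c (\<lambda>z. a * \<phi> z) = (\<lambda>z. a * euler c \<phi> z)"
  by (simp add: euler_def dl_scale fun_eq_iff algebra_simps)

lemma lam_add:
  "smooth0 \<phi> \<Longrightarrow> smooth0 \<psi> \<Longrightarrow> lam c (\<lambda>z. \<phi> z + \<psi> z) = (\<lambda>z. lam c \<phi> z + lam c \<psi> z)"
  by (simp add: lam_def dl_add dt_add euler_add smooth0_dt smooth0_dl fun_eq_iff)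

lemma lam_scale: "smooth0 \<phi> \<Longrightarrow> lam c (\<lambda>z. a * \<phi> z) = (\<lambda>z. a * lam c \<phi> z)"
  by (simp add: lam_def dl_scale dt_scale euler_scale smooth0_dt smooth0_dl fun_eq_iff algebra_simps)

lemma smooth0_zero: "smooth0 (\<lambda>_. 0)"
  by (simp add: smooth0_def smooth_const)

lemma smooth0_scale: "smooth0 \<phi> \<Longrightarrow> smooth0 (\<lambda>z. a * \<phi> z)"
  by (intro smooth0_mult_left smooth_const)

lemma lam_funpow_add:
  "smooth0 \<phi> \<Longrightarrow> smooth0 \<psi> \<Longrightarrow>
    (lam c ^^ j) (\<lambda>z. \<phi> z + \<psi> z) = (\<lambda>z. (lam c ^^ j) \<phi> z + (lam c ^^ j) \<psi> z)"
  by (induction j) (simp_all add: lam_add smooth0_lam_funpow)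

lemma lam_funpow_scale:
  "smooth0 \<phi> \<Longrightarrow> (lam c ^^ j) (\<lambda>z. a * \<phi> z) = (\<lambda>z. a * (lam c ^^ j) \<phi> z)"
  by (induction j) (simp_all add: lam_scale smooth0_lam_funpow)

lemma dl_funpow_scale:
  "smooth0 \<phi> \<Longrightarrow> (dl ^^ j) (\<lambda>z. a * \<phi> z) = (\<lambda>z. a * (dl ^^ j) \<phi> z)"
  by (induction j) (simp_all add: dl_scale smooth0_dl_funpow)

lemma dl_funpow_zero: "(dl ^^ j) (\<lambda>_. 0) = (\<lambda>_. 0)"
  using dl_funpow_scale[OF smooth0_zero, where a = 0] by simp

lemma dl_funpow_dt: "smooth0 \<phi> \<Longrightarrow> (dl ^^ j) (dt \<phi>) = dt ((dl ^^ j) \<phi>)"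
  by (induction j) (simp_all add: dl_dt smooth0_dl_funpow)

lemma dt_euler: "smooth0 \<phi> \<Longrightarrow> dt (euler c \<phi>) = euler c (dt \<phi>)"
  unfolding euler_def[abs_def]
  by (simp add: dt_add dt_scale dt_Im_squared_mult smooth0_scale smooth0_dl dl_dt
      smooth0_mult_left[OF smooth_Im_squared])

text \<open>The shift by 2 is the value of \<open>dl\<close> on s^2.\<close>

lemma dl_euler: "smooth0 \<phi> \<Longrightarrow> dl (euler c \<phi>) = euler (c + 2) (dl \<phi>)"
  unfolding euler_def[abs_def]
  by (simp add: dl_add dl_scale dl_Im_squared_mult smooth0_scale smooth0_dl
      smooth0_mult_left[OF smooth_Im_squared]) (simp add: fun_eq_iff algebra_simps)

lemma dl_funpow_euler: "smooth0 \<phi> \<Longrightarrow> (dl ^^ j) (euler c \<phi>) = euler (c + 2 * real j) ((dl ^^ j) \<phi>)"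
  by (induction j) (simp_all add: dl_euler smooth0_dl_funpow algebra_simps)

text \<open>Immediate from writing \<open>lam\<close> as the square of \<open>dt\<close> plus
  \<open>euler\<close> after \<open>dl\<close>: the first part commutes with \<open>dl\<close>, the
  second contributes the shift.\<close>

lemma dl_lam: "smooth0 \<phi> \<Longrightarrow> dl (lam c \<phi>) = lam (c + 2) (dl \<phi>)"
  unfolding lam_def[abs_def]
  by (simp add: dl_add dl_dt dl_euler smooth0_dt smooth0_dl smooth0_euler)

lemma dl_lam_funpow: "smooth0 \<phi> \<Longrightarrow> dl ((lam c ^^ j) \<phi>) = (lam (c + 2) ^^ j) (dl \<phi>)"
  by (induction j) (simp_all add: dl_lam smooth0_lam_funpow)

lemma lam_shift: "lam (c + a) \<phi> = (\<lambda>z. lam c \<phi> z + a * dl \<phi> z)"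
  by (simp add: lam_def euler_def fun_eq_iff algebra_simps)

text \<open>
  By \<open>lam_shift\<close> and \<open>dl_lam\<close> the constants satisfy \<open>C m k = C (m - 1) k + 2 k C m (k - 1)\<close>. They do not
  depend on \<open>c\<close>, which makes the factors of \<open>A\<close> and \<open>B\<close> below agree.
\<close>

lemma lam_funpow_collapse:
  "\<exists>C. \<forall>c h. smooth0 h \<longrightarrow> (lam c ^^ Suc m) h = (\<lambda>_. 0) \<longrightarrow>
    (lam (c + 2 * real k) ^^ (m + k)) h = (\<lambda>z. C * (dl ^^ k) ((lam c ^^ m) h) z)"
proof (induction k arbitrary: m)
  case 0
  show ?case by (intro exI[of _ 1]) simp
next
  case (Suc k)
  note IHk = Suc.IH
  show ?case
  proof (induction m)
    case 0
    obtain C where C: "\<And>c h. smooth0 h \<Longrightarrow> (lam c ^^ Suc 0) h = (\<lambda>_. 0) \<Longrightarrow>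
      (lam (c + 2 * real k) ^^ k) h = (\<lambda>z. C * (dl ^^ k) h z)" using IHk[of 0] by auto
    have "(lam (c + 2 * real (Suc k)) ^^ Suc k) h = (\<lambda>z. (2 * real (Suc k) * C) * (dl ^^ Suc k) h z)"
      if h: "smooth0 h" and 0: "(lam c ^^ Suc 0) h = (\<lambda>_. 0)" for c h
    proof -
      \<comment> \<open>As \<open>lam c h\<close> vanishes, one factor leaves only a multiple of
        \<open>dl h\<close>. By \<open>dl_lam\<close>, \<open>dl h\<close> is in the kernel of
        \<open>lam (c + 2)\<close>, so the case k applies at parameter c + 2.\<close>
      have "(lam (c + 2 * real (Suc k)) ^^ Suc k) h
          = (lam (c + 2 * real (Suc k)) ^^ k) (\<lambda>z. 2 * real (Suc k) * dl h z)"
        using 0 by (simp add: funpow_swap1 lam_shift[of c "2 * real (Suc k)"] del: of_nat_Suc)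
      also have "\<dots> = (\<lambda>z. 2 * real (Suc k) * (lam (c + 2 + 2 * real k) ^^ k) (dl h) z)"
        unfolding lam_funpow_scale[OF smooth0_dl[OF h]] by (simp add: algebra_simps)
      also have "(lam (c + 2 + 2 * real k) ^^ k) (dl h) = (\<lambda>z. C * (dl ^^ k) (dl h) z)"
        using dl_lam[OF h, of c] 0 dl_funpow_zero[of 1] by (intro C smooth0_dl h) simp
      finally show ?thesis by (simp add: funpow_swap1 mult.assoc)
    qed
    then show ?case by (intro exI[of _ "2 * real (Suc k) * C"]) auto
  next
    case (Suc m)
    obtain C1 where C1: "\<And>c h. smooth0 h \<Longrightarrow> (lam c ^^ Suc m) h = (\<lambda>_. 0) \<Longrightarrow>
      (lam (c + 2 * real (Suc k)) ^^ (m + Suc k)) h = (\<lambda>z. C1 * (dl ^^ Suc k) ((lam c ^^ m) h) z)"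
      using Suc.IH by blast
    obtain C2 where C2: "\<And>c h. smooth0 h \<Longrightarrow> (lam c ^^ Suc (Suc m)) h = (\<lambda>_. 0) \<Longrightarrow>
      (lam (c + 2 * real k) ^^ (Suc m + k)) h = (\<lambda>z. C2 * (dl ^^ k) ((lam c ^^ Suc m) h) z)"
      using IHk[of "Suc m"] by blast
    have "(lam (c + 2 * real (Suc k)) ^^ (Suc m + Suc k)) h
        = (\<lambda>z. (C1 + 2 * real (Suc k) * C2) * (dl ^^ Suc k) ((lam c ^^ Suc m) h) z)"
      if h: "smooth0 h" and 0: "(lam c ^^ Suc (Suc m)) h = (\<lambda>_. 0)" for c h
    proof -
      let ?c = "c + 2 * real (Suc k)" and ?N = "m + Suc k"
      have "(lam ?c ^^ (Suc m + Suc k)) h = (lam ?c ^^ ?N) (lam ?c h)"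
        by (simp add: funpow_swap1)
      \<comment> \<open>The first summand has one power of \<open>lam c\<close> fewer left before it
        dies and falls to the induction on m; the second keeps m, moves to c + 2 and falls to the
        induction on k.\<close>
      also have "\<dots> = (lam ?c ^^ ?N) (\<lambda>z. lam c h z + 2 * real (Suc k) * dl h z)"
        by (simp only: lam_shift)
      also have "\<dots> = (\<lambda>z. (lam ?c ^^ ?N) (lam c h) z + 2 * real (Suc k) * (lam ?c ^^ ?N) (dl h) z)"
        using h by (simp only: lam_funpow_add lam_funpow_scale smooth0_scale smooth0_lam smooth0_dl)
      also have "(lam ?c ^^ ?N) (lam c h) = (\<lambda>z. C1 * (dl ^^ Suc k) ((lam c ^^ m) (lam c h)) z)"
        using 0 by (intro C1 smooth0_lam h) (simp add: funpow_swap1)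
      also have "(lam ?c ^^ ?N) (dl h) = (lam (c + 2 + 2 * real k) ^^ (Suc m + k)) (dl h)"
        by (simp add: algebra_simps)
      also have "\<dots> = (\<lambda>z. C2 * (dl ^^ k) ((lam (c + 2) ^^ Suc m) (dl h)) z)"
        using dl_lam_funpow[OF h, where c = c and j = "Suc (Suc m)"] 0 dl_funpow_zero[of 1]
        by (intro C2 smooth0_dl h) simp
      also have "(lam (c + 2) ^^ Suc m) (dl h) = dl ((lam c ^^ Suc m) h)"
        by (rule dl_lam_funpow[OF h, symmetric])
      finally show ?thesis by (simp add: funpow_swap1 algebra_simps)
    qed
    then show ?case by blast
  qed
qed

text \<open>With b = v / s, \<open>euler 1 b\<close> is s times \<open>dl v\<close>. Applying
  \<open>dl\<close> turns its left side into \<open>euler 3 (dl b)\<close> and its right side into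
  \<open>euler 1 (dl v)\<close> divided by s.\<close>

lemma lam_div_Im:
  assumes "smooth0 v"
  shows "smooth0 (\<lambda>z. v z / Im z)" "lam 3 (\<lambda>z. v z / Im z) = (\<lambda>z. lam 1 v z / Im z)"
proof -
  show b0: "smooth0 (\<lambda>z. v z / Im z)"
    using smooth0_mult_left[OF smooth_inverse_Im assms] by (simp add: divide_inverse_commute)
  define b where "b = (\<lambda>z. v z / Im z)"
  have b: "smooth0 b" using b0 by (simp add: b_def)
  have v: "v = (\<lambda>z. Im z * b z)"
    using smooth0_outside[OF assms] Im_pos by (force simp: b_def fun_eq_iff)
  have "euler 1 b = (\<lambda>z. Im z * dl v z)"
    using smooth0_outside[OF smooth0_euler[OF b]] Im_pos
    by (force simp: v dl_Im_mult[OF b] fun_eq_iff)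
  then have "euler 3 (dl b) = (\<lambda>z. euler 1 (dl v) z / Im z)"
    using dl_euler[OF b, of 1] dl_Im_mult[OF smooth0_dl[OF assms]] by simp
  moreover have "dt (dt b) = (\<lambda>z. dt (dt v) z / Im z)"
    using smooth0_outside[OF smooth0_dt[OF smooth0_dt[OF b]]] Im_pos
    by (force simp: v dt_Im_mult b smooth0_dt fun_eq_iff)
  ultimately show "lam 3 (\<lambda>z. v z / Im z) = (\<lambda>z. lam 1 v z / Im z)"
    by (simp add: lam_def fun_eq_iff add_divide_distrib flip: b_def)
qed

lemma lam_funpow_div_Im:
  "smooth0 v \<Longrightarrow> (lam 3 ^^ j) (\<lambda>z. v z / Im z) = (\<lambda>z. (lam 1 ^^ j) v z / Im z)"
  by (induction j) (simp_all add: lam_div_Im smooth0_lam_funpow)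

text \<open>In terms of U and b = V / s the Cauchy-Riemann equations contain only \<open>dt\<close>,
  \<open>dl\<close> and \<open>euler 1\<close>. Applying \<open>dl\<close> k times preserves their
  shape and turns \<open>euler 1\<close> into \<open>euler (1 + 2 * real k)\<close>; by the collapse
  lemma A and B are the results up to a constant.\<close>

proposition generalized_cauchy_riemann:
  fixes m k :: nat
  assumes u: "smooth0 u" and v: "smooth0 v"
    and cr1: "dt ((lam 1 ^^ m) u) = (\<lambda>z. Im z * dl ((lam 1 ^^ m) v) z)"
    and cr2: "dt ((lam 1 ^^ m) v) = (\<lambda>z. - Im z * dl ((lam 1 ^^ m) u) z)"
  defines "A \<equiv> (lam (1 + 2 * real k) ^^ (m + k)) u"
    and "B \<equiv> (lam (3 + 2 * real k) ^^ (m + k)) (\<lambda>z. v z / Im z)"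
  shows "dt A = euler (1 + 2 * real k) B" "dl A z + dt B z = 0"
proof -
  define U V b where "U = (lam 1 ^^ m) u" "V = (lam 1 ^^ m) v" "b = (\<lambda>z. V z / Im z)"
  have U: "smooth0 U" and V: "smooth0 V" and b: "smooth0 b"
    using smooth0_lam_funpow u v lam_div_Im(1) by (auto simp: U_V_b_def)
  have V_eq: "V = (\<lambda>z. Im z * b z)"
    using smooth0_outside[OF V] Im_pos by (force simp: U_V_b_def(3) fun_eq_iff)
  have eul: "euler 1 b = (\<lambda>z. Im z * dl V z)"
    using smooth0_outside[OF smooth0_euler[OF b]] Im_pos
    by (force simp: V_eq dl_Im_mult[OF b] fun_eq_iff)
  have dtU: "dt U = euler 1 b" using cr1 eul by (simp add: U_V_b_def)
  have dlU: "dl U = (\<lambda>z. (- 1) * dt b z)"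
  proof
    fix z
    show "dl U z = (- 1) * dt b z"
    proof (cases "z \<in> \<Omega>")
      case True
      have "Im z * (dl U z + dt b z) = 0"
        using cr2 dt_Im_mult[OF b] by (simp add: distrib_left flip: U_V_b_def(1,2) V_eq) (metis add.right_inverse)
      then show ?thesis using Im_pos[OF True] by auto
    qed (use smooth0_outside[OF smooth0_dl[OF U]] smooth0_outside[OF smooth0_dt[OF b]] in auto)
  qed
  \<comment> \<open>The two halves are \<open>euler 1 (dt b)\<close> and its negative.\<close>
  have "lam 1 U = (\<lambda>_. 0)"
    by (simp only: lam_def[abs_def] dtU dlU dt_euler[OF b] euler_scale[OF smooth0_dt[OF b]]) simp
  then have U0: "(lam 1 ^^ Suc m) u = (\<lambda>_. 0)" by (simp add: U_V_b_def)
  have dtb: "dt b = (\<lambda>z. (- 1) * dl U z)" using dlU by simp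
  have "euler 3 (dl b) = dl (dt U)" using dl_euler[OF b, of 1] dtU by simp
  then have "lam 3 b = (\<lambda>_. 0)"
    by (simp only: lam_def[abs_def] dtb dt_scale[OF smooth0_dl[OF U]] dl_dt[OF U]) simp
  then have b0: "(lam 3 ^^ Suc m) (\<lambda>z. v z / Im z) = (\<lambda>_. 0)"
    by (simp add: U_V_b_def lam_funpow_div_Im[OF v])
  \<comment> \<open>One constant serves both c = 1 and c = 3; otherwise the two equations would be
    scaled differently.\<close>
  obtain C where C: "\<And>c h. smooth0 h \<Longrightarrow> (lam c ^^ Suc m) h = (\<lambda>_. 0) \<Longrightarrow>
      (lam (c + 2 * real k) ^^ (m + k)) h = (\<lambda>z. C * (dl ^^ k) ((lam c ^^ m) h) z)"
    using lam_funpow_collapse[of m k] by blast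
  have A: "A = (\<lambda>z. C * (dl ^^ k) U z)"
    unfolding A_def U_V_b_def by (rule C[OF u U0])
  have B: "B = (\<lambda>z. C * (dl ^^ k) b z)"
    unfolding B_def U_V_b_def
    using C[OF lam_div_Im(1)[OF v] b0] by (simp add: lam_funpow_div_Im[OF v])
  note s = smooth0_dl_funpow[OF U] smooth0_dl_funpow[OF b]
  show "dt A = euler (1 + 2 * real k) B"
    by (simp only: A B dt_scale euler_scale s dl_funpow_euler[OF b, symmetric]
        dl_funpow_dt[OF U, symmetric] dtU)
  have "(dl ^^ k) (dl U) = (\<lambda>z. (- 1) * dt ((dl ^^ k) b) z)"
    unfolding dlU by (simp only: dl_funpow_scale smooth0_dt b dl_funpow_dt)
  then have "dl ((dl ^^ k) U) z = - dt ((dl ^^ k) b) z" by (simp add: funpow_swap1)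
  then show "dl A z + dt B z = 0"
    by (simp add: A B dt_scale dl_scale s)
qed

section \<open>The plane Laplacian and dbar expressed for real and imaginary parts\<close>

lemma lam_1_eq:
  assumes "smooth0 \<phi>" "z \<in> \<Omega>"
  shows "lam 1 \<phi> z = dir_deriv 1 (dir_deriv 1 \<phi>) z + dir_deriv \<i> (dir_deriv \<i> \<phi>) z"
proof -
  have "dt (dt \<phi>) z = dir_deriv 1 (dt \<phi>) z" using assms by (simp add: dt_def cutoff_def)
  also have "\<dots> = dir_deriv 1 (dir_deriv 1 \<phi>) z"
    by (rule dir_deriv_cong_open[OF open_dom assms(2)]) (simp add: dt_def cutoff_def)
  finally have 1: "dt (dt \<phi>) z = dir_deriv 1 (dir_deriv 1 \<phi>) z" .
  note d = smooth0_dl[OF assms(1)]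
  have "dir_deriv \<i> (dir_deriv \<i> \<phi>) z = dir_deriv \<i> (\<lambda>z. Im z * dl \<phi> z) z"
    using Im_pos by (intro dir_deriv_cong_open[OF open_dom assms(2)]) (force simp: dl_def cutoff_def)
  also have "\<dots> = Im z * dl (\<lambda>z. Im z * dl \<phi> z) z"
    using Im_pos[OF assms(2)] assms(2) by (simp add: dl_def[of "\<lambda>z. Im z * dl \<phi> z"] cutoff_def)
  also have "\<dots> = euler 1 (dl \<phi>) z"
    using Im_pos[OF assms(2)] by (simp add: dl_Im_mult[OF d])
  finally show ?thesis using 1 by (simp add: lam_def)
qed

lemma smooth_laplace_plane: "smooth f \<Longrightarrow> smooth (laplace_plane f)"
  unfolding smooth_def using Ck_on_laplace_plane[OF open_dom] by blast

lemma smooth_laplace_plane_funpow: "smooth f \<Longrightarrow> smooth ((laplace_plane ^^ j) f)"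
  by (induction j) (auto intro: smooth_laplace_plane)

text \<open>Used with \<open>Re\<close> and \<open>Im\<close> for \<open>L\<close>, to pass from the
  complex Laplacian of f to u and v separately.\<close>

lemma lam_1_component:
  assumes "smooth f" "bounded_linear L"
  shows "lam 1 (cutoff (\<lambda>z. L (f z))) = cutoff (\<lambda>z. L (laplace_plane f z))"
proof
  fix z
  note s = smooth0_cutoff[OF smooth_bounded_linear[OF assms(2,1)]]
  show "lam 1 (cutoff (\<lambda>z. L (f z))) z = cutoff (\<lambda>z. L (laplace_plane f z)) z"
  proof (cases "z \<in> \<Omega>")
    case True
    have "dir_deriv b (dir_deriv b (cutoff (\<lambda>z. L (f z)))) z = L (dir_deriv b (dir_deriv b f) z)"
      if "b \<in> Basis" for b
    proof -
      have "dir_deriv b (cutoff (\<lambda>z. L (f z))) w = L (dir_deriv b f w)" if "w \<in> \<Omega>" for w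
      proof -
        have "dir_deriv b (cutoff (\<lambda>z. L (f z))) w = dir_deriv b (\<lambda>z. L (f z)) w"
          by (rule dir_deriv_cong_open[OF open_dom that]) (simp add: cutoff_def)
        also have "\<dots> = L (dir_deriv b f w)"
          by (rule dir_deriv_bounded_linear[OF assms(2) smooth_differentiable[OF assms(1) that]])
        finally show ?thesis .
      qed
      then have "dir_deriv b (dir_deriv b (cutoff (\<lambda>z. L (f z)))) z = dir_deriv b (\<lambda>w. L (dir_deriv b f w)) z"
        by (rule dir_deriv_cong_open[OF open_dom True])
      also have "\<dots> = L (dir_deriv b (dir_deriv b f) z)"
        by (rule dir_deriv_bounded_linear[OF assms(2) smooth_differentiable[OF smooth_dir_deriv[OF assms(1) that] True]])
      finally show ?thesis .
    qed
    then show ?thesis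
      using True linear_add[OF bounded_linear.linear[OF assms(2)]]
      by (simp add: lam_1_eq[OF s True] cutoff_def laplace_plane_def Basis_complex_def)
  qed (simp add: smooth0_outside[OF smooth0_lam[OF s]] cutoff_def)
qed

lemma lam_1_funpow_component:
  assumes "smooth f" "bounded_linear L"
  shows "(lam 1 ^^ j) (cutoff (\<lambda>z. L (f z))) = cutoff (\<lambda>z. L ((laplace_plane ^^ j) f z))"
  by (induction j) (simp_all add: lam_1_component assms smooth_laplace_plane_funpow)

lemma dbar_eq_0_imp:
  assumes "smooth g" "\<And>z. z \<in> \<Omega> \<Longrightarrow> dbar g z = 0"
  shows "dt (cutoff (\<lambda>z. Re (g z))) = (\<lambda>z. Im z * dl (cutoff (\<lambda>z. Im (g z))) z)"
    "dt (cutoff (\<lambda>z. Im (g z))) = (\<lambda>z. - Im z * dl (cutoff (\<lambda>z. Re (g z))) z)"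
proof -
  have c: "dir_deriv \<xi> (cutoff (\<lambda>z. L (g z))) z = L (dir_deriv \<xi> g z)"
    if "bounded_linear L" "z \<in> \<Omega>" for \<xi> L z
  proof -
    have "dir_deriv \<xi> (cutoff (\<lambda>z. L (g z))) z = dir_deriv \<xi> (\<lambda>z. L (g z)) z"
      by (rule dir_deriv_cong_open[OF open_dom that(2)]) (simp add: cutoff_def)
    also have "\<dots> = L (dir_deriv \<xi> g z)"
      by (rule dir_deriv_bounded_linear[OF that(1) smooth_differentiable[OF assms(1) that(2)]])
    finally show ?thesis .
  qed
  note c = c[OF bounded_linear_Re] c[OF bounded_linear_Im]
  have cr: "Re (dir_deriv 1 g z) = Im (dir_deriv \<i> g z)" "Im (dir_deriv 1 g z) = - Re (dir_deriv \<i> g z)"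
    if "z \<in> \<Omega>" for z
    using assms(2)[OF that] by (auto simp: dbar_def complex_eq_iff)
  have "Im z \<noteq> 0" if "z \<in> \<Omega>" for z using Im_pos[OF that] by simp
  then show "dt (cutoff (\<lambda>z. Re (g z))) = (\<lambda>z. Im z * dl (cutoff (\<lambda>z. Im (g z))) z)"
    "dt (cutoff (\<lambda>z. Im (g z))) = (\<lambda>z. - Im z * dl (cutoff (\<lambda>z. Re (g z))) z)"
    by (auto simp: fun_eq_iff dt_def dl_def cutoff_def[of "dir_deriv _ _"]
        cutoff_def[of "\<lambda>z. dir_deriv _ _ z / _ z"] c cr)
qed

end

section \<open>Polynomial functions\<close>

text \<open>Multiplication by arbitrary linear forms, rather than coordinates, keeps the generators
  stable under reflections and lets commutation with multiplications drive the inductions.\<close>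

inductive polyfun :: "('a::euclidean_space \<Rightarrow> 'b::real_normed_vector) \<Rightarrow> bool" where
  const: "polyfun (\<lambda>_. c)"
| add: "polyfun p \<Longrightarrow> polyfun q \<Longrightarrow> polyfun (\<lambda>x. p x + q x)"
| mult: "polyfun p \<Longrightarrow> polyfun (\<lambda>x. (x \<bullet> \<eta>) *\<^sub>R p x)"

lemma polyfun_bounded_linear:
  assumes "polyfun p" "bounded_linear L"
  shows "polyfun (\<lambda>x. L (p x))"
proof -
  interpret bounded_linear L by fact
  show ?thesis
    using assms(1) by induction (auto simp: add scaleR intro: polyfun.intros)
qed

lemma polyfun_scaleR: "polyfun p \<Longrightarrow> polyfun (\<lambda>x. c *\<^sub>R p x)"
  using polyfun_bounded_linear bounded_linear_scaleR_right by blast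

lemma polyfun_sum: "(\<And>i. i \<in> I \<Longrightarrow> polyfun (f i)) \<Longrightarrow> polyfun (\<lambda>x. \<Sum>i\<in>I. f i x)"
  by (induction I rule: infinite_finite_induct) (auto intro: polyfun.intros)

lemma polyfun_differentiable: "polyfun p \<Longrightarrow> p differentiable (at x)"
proof (induction rule: polyfun.induct)
  case (mult p \<eta>)
  have "(\<lambda>x. x \<bullet> \<eta>) differentiable (at x)"
    unfolding differentiable_def by (auto intro!: derivative_eq_intros exI)
  then show ?case using mult by (intro differentiable_scaleR)
qed (auto intro: differentiable_add)

lemma polyfun_isCont: "polyfun p \<Longrightarrow> isCont p x"
  using polyfun_differentiable differentiable_imp_continuous_within by blast

section \<open>Reflections\<close>

lemma reflection_eq: "reflection \<alpha> x = x - (2 * (\<alpha> \<bullet> x) / (\<alpha> \<bullet> \<alpha>)) *\<^sub>R \<alpha>"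
  by (simp add: reflection_def power2_norm_eq_inner)

lemma linear_reflection: "linear (reflection \<alpha>)"
  by (rule linearI) (simp_all add: reflection_eq inner_add_right algebra_simps add_divide_distrib)

lemma inner_reflection_left: "reflection \<alpha> x \<bullet> y = x \<bullet> reflection \<alpha> y"
  by (simp add: reflection_eq inner_diff_left inner_diff_right inner_commute)

lemma reflection_involution: "reflection \<alpha> (reflection \<alpha> x) = x"
  by (cases "\<alpha> = 0") (simp_all add: reflection_eq inner_diff_right algebra_simps)

lemma inner_reflection_reflection: "reflection \<alpha> x \<bullet> reflection \<alpha> y = x \<bullet> y"
  by (simp add: inner_reflection_left reflection_involution)

lemma norm_reflection: "norm (reflection \<alpha> x) = norm x"
  by (simp add: norm_eq_sqrt_inner inner_reflection_reflection)

lemma reflection_self: "reflection \<alpha> \<alpha> = - \<alpha>"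
  by (cases "\<alpha> = 0") (simp_all add: reflection_eq algebra_simps flip: scaleR_2)

lemma reflection_uminus: "reflection (- \<alpha>) x = reflection \<alpha> x"
  by (simp add: reflection_eq)

lemma reflection_reflection_eq:
  "reflection (reflection \<beta> \<alpha>) (reflection \<beta> x) = reflection \<beta> (reflection \<alpha> x)"
  by (simp only: reflection_eq[of "reflection \<beta> \<alpha>"] reflection_eq[of \<alpha> x]
      inner_reflection_reflection linear_diff[OF linear_reflection] linear_cmul[OF linear_reflection])

lemma polyfun_reflection: "polyfun p \<Longrightarrow> polyfun (\<lambda>x. p (reflection \<alpha> x))"
  by (induction rule: polyfun.induct) (auto simp: inner_reflection_left intro: polyfun.intros)

section \<open>Dunkl operators on polynomial functions\<close>

text \<open>A continuous cofactor agrees with the quotient off the hyperplane, hence with its limit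
  on it. The open set \<open>U\<close> allows for functions that are controlled only on a
  domain.\<close>

lemma dunkl_quotient_eqI:
  fixes F :: "'a::euclidean_space \<Rightarrow> 'b::real_normed_vector"
  assumes "open U" "x \<in> U" "\<alpha> \<noteq> 0"
    and eq: "\<And>y. y \<in> U \<Longrightarrow> F y - F (reflection \<alpha> y) = (\<alpha> \<bullet> y) *\<^sub>R Q y"
    and "isCont Q x"
  shows "dunkl_quotient \<alpha> F x = Q x"
proof (cases "\<alpha> \<bullet> x = 0")
  case True
  let ?S = "{y. \<alpha> \<bullet> y \<noteq> 0}"
  have "x islimpt ?S"
    unfolding islimpt_approachable
  proof (intro allI impI)
    fix e :: real assume "e > 0"
    \<comment> \<open>Moving by e / 2 along the normal \<alpha> leaves the hyperplane.\<close>
    then have "x + (e / (2 * norm \<alpha>)) *\<^sub>R \<alpha> \<in> ?S" "dist (x + (e / (2 * norm \<alpha>)) *\<^sub>R \<alpha>) x < e"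
      using True \<open>\<alpha> \<noteq> 0\<close> by (auto simp: inner_add_right dist_norm)
    then show "\<exists>y\<in>?S. y \<noteq> x \<and> dist y x < e" using True by auto
  qed
  then have nt: "at x within ?S \<noteq> bot" by (simp add: trivial_limit_within)
  have "(Q \<longlongrightarrow> Q x) (at x within ?S)"
    using assms(5) by (meson continuous_at_imp_continuous_at_within continuous_within)
  moreover have "\<forall>\<^sub>F y in at x within ?S. Q y = (F y - F (reflection \<alpha> y)) /\<^sub>R (\<alpha> \<bullet> y)"
    using eventually_at_in_open'[OF assms(1,2)] unfolding eventually_at_filter
    by (rule eventually_mono) (auto simp: eq)
  ultimately have "((\<lambda>y. (F y - F (reflection \<alpha> y)) /\<^sub>R (\<alpha> \<bullet> y)) \<longlongrightarrow> Q x) (at x within ?S)"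
    by (rule Lim_transform_eventually)
  then show ?thesis using True tendsto_Lim[OF nt] by (simp add: dunkl_quotient_def)
next
  case False
  then show ?thesis by (simp add: dunkl_quotient_def eq[OF assms(2)])
qed

text \<open>The twisted Leibniz rule of the difference quotient: \<open>e\<close> is the linear form
  at y, \<open>a\<close> is \<open>\<alpha> \<bullet> y\<close>, \<open>q\<close> is the reflected
  value of p, \<open>Q\<close> is the cofactor of p, and \<open>d\<close> is the cofactor of the
  linear form.\<close>

lemma product_difference:
  fixes Q q :: "'b::real_vector"
  shows "e *\<^sub>R (q + a *\<^sub>R Q) - (e - a * d) *\<^sub>R q = a *\<^sub>R (e *\<^sub>R Q + d *\<^sub>R q)"
  by (simp add: algebra_simps)

lemma polyfun_reflection_quotient:
  assumes "polyfun p" "\<alpha> \<noteq> 0"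
  shows "\<exists>Q. polyfun Q \<and> (\<forall>y. p y - p (reflection \<alpha> y) = (\<alpha> \<bullet> y) *\<^sub>R Q y)"
  using assms(1)
proof induction
  case (const c)
  show ?case by (intro exI[of _ "\<lambda>_. 0"]) (simp add: polyfun.const)
next
  case (add p q)
  then obtain P Q where "polyfun P" "polyfun Q" "\<forall>y. p y - p (reflection \<alpha> y) = (\<alpha> \<bullet> y) *\<^sub>R P y"
    "\<forall>y. q y - q (reflection \<alpha> y) = (\<alpha> \<bullet> y) *\<^sub>R Q y" by blast
  then show ?case
    by (intro exI[of _ "\<lambda>y. P y + Q y"]) (simp add: polyfun.add add_diff_add scaleR_add_right)
next
  case (mult p \<eta>)
  then obtain Q where Q: "polyfun Q" "\<And>y. p y - p (reflection \<alpha> y) = (\<alpha> \<bullet> y) *\<^sub>R Q y" by blast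
  let ?Q = "\<lambda>y. (y \<bullet> \<eta>) *\<^sub>R Q y + (2 * (\<alpha> \<bullet> \<eta>) / (\<alpha> \<bullet> \<alpha>)) *\<^sub>R p (reflection \<alpha> y)"
  have "polyfun ?Q"
    by (intro polyfun.add polyfun.mult polyfun_scaleR polyfun_reflection Q mult)
  moreover have "(y \<bullet> \<eta>) *\<^sub>R p y - (reflection \<alpha> y \<bullet> \<eta>) *\<^sub>R p (reflection \<alpha> y) = (\<alpha> \<bullet> y) *\<^sub>R ?Q y" for y
  proof -
    have "p y = p (reflection \<alpha> y) + (\<alpha> \<bullet> y) *\<^sub>R Q y" using Q(2)[of y] by (simp add: algebra_simps)
    moreover have "reflection \<alpha> y \<bullet> \<eta> = y \<bullet> \<eta> - (\<alpha> \<bullet> y) * (2 * (\<alpha> \<bullet> \<eta>) / (\<alpha> \<bullet> \<alpha>))"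
      by (simp add: reflection_eq inner_diff_left)
    ultimately show ?thesis by (simp only: product_difference)
  qed
  ultimately show ?case by blast
qed

lemma
  assumes "polyfun p" "\<alpha> \<noteq> 0"
  shows polyfun_dunkl_quotient: "polyfun (dunkl_quotient \<alpha> p)"
    and dunkl_quotient_mult: "(\<alpha> \<bullet> y) *\<^sub>R dunkl_quotient \<alpha> p y = p y - p (reflection \<alpha> y)"
proof -
  obtain Q where Q: "polyfun Q" "\<And>y. p y - p (reflection \<alpha> y) = (\<alpha> \<bullet> y) *\<^sub>R Q y"
    using polyfun_reflection_quotient[OF assms] by blast
  have "dunkl_quotient \<alpha> p = Q"
    using dunkl_quotient_eqI[OF open_UNIV UNIV_I assms(2) Q(2) polyfun_isCont[OF Q(1)]] by blast
  then show "polyfun (dunkl_quotient \<alpha> p)"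
    and "(\<alpha> \<bullet> y) *\<^sub>R dunkl_quotient \<alpha> p y = p y - p (reflection \<alpha> y)" using Q by auto
qed

lemma dunkl_quotient_polyfun_eqI:
  assumes "polyfun Q" "\<alpha> \<noteq> 0" "\<And>y. F y - F (reflection \<alpha> y) = (\<alpha> \<bullet> y) *\<^sub>R Q y"
  shows "dunkl_quotient \<alpha> F = Q"
  using dunkl_quotient_eqI[OF open_UNIV UNIV_I assms(2) assms(3) polyfun_isCont[OF assms(1)]] by blast

lemma dir_deriv_coordinate_mult:
  assumes "polyfun p"
  shows "dir_deriv \<xi> (\<lambda>x. (x \<bullet> \<eta>) *\<^sub>R p x) x = (x \<bullet> \<eta>) *\<^sub>R dir_deriv \<xi> p x + (\<xi> \<bullet> \<eta>) *\<^sub>R p x"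
proof -
  have *: "((\<lambda>x. x \<bullet> \<eta>) has_derivative (\<lambda>\<xi>. \<xi> \<bullet> \<eta>)) (at x)"
    by (auto intro!: derivative_eq_intros)
  show ?thesis
    by (subst dir_deriv_scaleR)
      (use * polyfun_differentiable[OF assms] in \<open>auto simp: differentiable_def dir_deriv_eqI[OF *]\<close>)
qed

lemma polyfun_dir_deriv: "polyfun p \<Longrightarrow> polyfun (dir_deriv \<xi> p)"
proof (induction rule: polyfun.induct)
  case (const c)
  have "dir_deriv \<xi> (\<lambda>_. c) = (\<lambda>_. 0)" by (simp add: fun_eq_iff)
  then show ?case by (simp add: polyfun.const)
next
  case (add p q)
  then have "dir_deriv \<xi> (\<lambda>x. p x + q x) = (\<lambda>x. dir_deriv \<xi> p x + dir_deriv \<xi> q x)"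
    by (simp add: fun_eq_iff dir_deriv_add polyfun_differentiable)
  then show ?case using add by (simp add: polyfun.add)
next
  case (mult p \<eta>)
  have "dir_deriv \<xi> (\<lambda>x. (x \<bullet> \<eta>) *\<^sub>R p x) = (\<lambda>x. (x \<bullet> \<eta>) *\<^sub>R dir_deriv \<xi> p x + (\<xi> \<bullet> \<eta>) *\<^sub>R p x)"
    by (rule ext) (rule dir_deriv_coordinate_mult[OF mult.hyps])
  then show ?case using mult by (simp add: polyfun.intros polyfun_scaleR)
qed

locale dunkl_setting =
  fixes R Rp :: "'a::euclidean_space set" and \<kappa> :: "'a \<Rightarrow> real"
  assumes root_system: "root_system R"
    and positive: "positive_subsystem R Rp"
    and multiplicity: "multiplicity_function R \<kappa>"
begin

abbreviation "T \<equiv> dunkl_op Rp \<kappa>"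

text \<open>The quotient of the linear form \<open>x \<bullet> \<eta>\<close> is \<open>2 *
  (\<alpha> \<bullet> \<eta>) / (\<alpha> \<bullet> \<alpha>)\<close>; its factor is merged with
  \<kappa> here, since the roots are not normalized.\<close>

definition weight :: "'a \<Rightarrow> real" where
  "weight \<alpha> = 2 * \<kappa> \<alpha> / (\<alpha> \<bullet> \<alpha>)"

text \<open>The commutator of \<open>T \<xi>\<close> and the multiplication by \<open>x \<bullet> \<eta>\<close>.\<close>

definition comm :: "'a \<Rightarrow> 'a \<Rightarrow> ('a \<Rightarrow> 'b::real_normed_vector) \<Rightarrow> 'a \<Rightarrow> 'b" where
  "comm \<xi> \<eta> p x = (\<xi> \<bullet> \<eta>) *\<^sub>R p x +
     (\<Sum>\<alpha>\<in>Rp. (weight \<alpha> * (\<alpha> \<bullet> \<xi>) * (\<alpha> \<bullet> \<eta>)) *\<^sub>R p (reflection \<alpha> x))"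

section \<open>Invariance of sums over the roots\<close>

lemma finite_Rp: "finite Rp" and Rp_subset: "Rp \<subseteq> R"
  and Rp_nonzero: "\<alpha> \<in> Rp \<Longrightarrow> \<alpha> \<noteq> 0"
  using root_system positive by (auto simp: root_system_def positive_subsystem_def)

lemma R_reflection: "\<beta> \<in> R \<Longrightarrow> reflection \<beta> ` R = R"
  using root_system by (simp add: root_system_def)

lemma R_uminus: "\<alpha> \<in> R \<Longrightarrow> - \<alpha> \<in> R"
  using R_reflection[of \<alpha>] reflection_self[of \<alpha>] by (metis imageI)

lemma \<kappa>_reflection:
  assumes "\<beta> \<in> R" "\<alpha> \<in> R"
  shows "\<kappa> (reflection \<beta> \<alpha>) = \<kappa> \<alpha>"
proof -
  have "reflection \<beta> \<circ> id \<in> reflection_group R"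
    by (intro reflection_group.intros assms)
  with multiplicity assms(2) show ?thesis by (auto simp: multiplicity_function_def)
qed

lemma weight_uminus: "\<alpha> \<in> R \<Longrightarrow> weight (- \<alpha>) = weight \<alpha>"
  using \<kappa>_reflection[of \<alpha> \<alpha>] by (simp add: weight_def reflection_self)

lemma weight_reflection: "\<beta> \<in> R \<Longrightarrow> \<alpha> \<in> R \<Longrightarrow> weight (reflection \<beta> \<alpha>) = weight \<alpha>"
  by (simp add: weight_def \<kappa>_reflection inner_reflection_reflection)

text \<open>Reflections permute \<open>R\<close> but not \<open>Rp\<close>. For even summands half
  of the sum over \<open>R\<close> replaces the sum over \<open>Rp\<close>, which makes reindexing
  possible.\<close>

lemma sum_R_even:
  fixes h :: "'a \<Rightarrow> 'b::real_vector"
  assumes "\<And>\<alpha>. \<alpha> \<in> R \<Longrightarrow> h (- \<alpha>) = h \<alpha>"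
  shows "sum h R = 2 *\<^sub>R sum h Rp"
proof -
  obtain \<beta> where \<beta>: "\<forall>\<alpha>\<in>R. \<beta> \<bullet> \<alpha> \<noteq> 0" "Rp = {\<alpha>\<in>R. \<beta> \<bullet> \<alpha> > 0}"
    using positive by (auto simp: positive_subsystem_def)
  have split: "R = Rp \<union> uminus ` Rp"
  proof (intro equalityI subsetI)
    fix \<alpha> assume a: "\<alpha> \<in> R"
    show "\<alpha> \<in> Rp \<union> uminus ` Rp"
    proof (cases "\<beta> \<bullet> \<alpha> > 0")
      case False
      then have "\<beta> \<bullet> (- \<alpha>) > 0" using \<beta>(1) a by (metis inner_minus_right linorder_neqE_linordered_idom neg_0_less_iff_less)
      then have "- \<alpha> \<in> Rp" using R_uminus[OF a] \<beta>(2) by auto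
      then show ?thesis by (metis UnI2 imageI minus_minus)
    qed (use a \<beta> in auto)
  qed (use Rp_subset R_uminus in auto)
  have disj: "Rp \<inter> uminus ` Rp = {}" using \<beta>(2) by auto
  have "sum h R = sum h Rp + sum h (uminus ` Rp)"
    by (subst split, rule sum.union_disjoint) (use finite_Rp disj in auto)
  also have "sum h (uminus ` Rp) = (\<Sum>\<alpha>\<in>Rp. h (- \<alpha>))"
    by (subst sum.reindex) auto
  also have "\<dots> = sum h Rp" using assms Rp_subset by (intro sum.cong) auto
  finally show ?thesis by (simp add: scaleR_2)
qed

lemma sum_Rp_reflection:
  fixes h :: "'a \<Rightarrow> 'b::real_vector"
  assumes "\<And>\<alpha>. \<alpha> \<in> R \<Longrightarrow> h (- \<alpha>) = h \<alpha>" "\<beta> \<in> R"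
  shows "(\<Sum>\<alpha>\<in>Rp. h (reflection \<beta> \<alpha>)) = sum h Rp"
proof -
  have inj: "inj_on (reflection \<beta>) R" by (metis inj_onI reflection_involution)
  have "h (reflection \<beta> (- \<alpha>)) = h (reflection \<beta> \<alpha>)" if "\<alpha> \<in> R" for \<alpha>
    using assms(1)[of "reflection \<beta> \<alpha>"] that R_reflection[OF assms(2)]
    by (auto simp: linear_neg[OF linear_reflection])
  then have "2 *\<^sub>R (\<Sum>\<alpha>\<in>Rp. h (reflection \<beta> \<alpha>)) = (\<Sum>\<alpha>\<in>R. h (reflection \<beta> \<alpha>))"
    using sum_R_even[of "\<lambda>\<alpha>. h (reflection \<beta> \<alpha>)"] by simp
  also have "\<dots> = sum h R"
    using sum.reindex[OF inj, of h] R_reflection[OF assms(2)] by simp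
  also have "\<dots> = 2 *\<^sub>R sum h Rp" using sum_R_even assms(1) by blast
  finally show ?thesis by simp
qed

text \<open>The summands are even in \<alpha>, as the two inner products change sign together; so
  conjugation by \<beta> only permutes them.\<close>

lemma comm_reflection:
  assumes "\<beta> \<in> R"
  shows "comm \<xi> \<eta> (\<lambda>x. p (reflection \<beta> x)) x
    = comm (reflection \<beta> \<xi>) (reflection \<beta> \<eta>) p (reflection \<beta> x)"
proof -
  let ?h = "\<lambda>\<alpha>. (weight \<alpha> * (\<alpha> \<bullet> reflection \<beta> \<xi>) * (\<alpha> \<bullet> reflection \<beta> \<eta>)) *\<^sub>R
    p (reflection \<alpha> (reflection \<beta> x))"
  have "(\<Sum>\<alpha>\<in>Rp. ?h (reflection \<beta> \<alpha>)) = sum ?h Rp"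
    by (rule sum_Rp_reflection[OF _ assms]) (simp add: weight_uminus reflection_uminus)
  moreover have "?h (reflection \<beta> \<alpha>)
      = (weight \<alpha> * (\<alpha> \<bullet> \<xi>) * (\<alpha> \<bullet> \<eta>)) *\<^sub>R p (reflection \<beta> (reflection \<alpha> x))" if "\<alpha> \<in> Rp" for \<alpha>
    using that Rp_subset assms
    by (simp add: weight_reflection inner_reflection_reflection reflection_reflection_eq subset_eq)
  ultimately show ?thesis by (simp add: comm_def inner_reflection_reflection)
qed

section \<open>Product rule, equivariance and commutativity of the Dunkl operators\<close>

lemma polyfun_T: "polyfun p \<Longrightarrow> polyfun (T \<xi> p)"
  unfolding dunkl_op_def[abs_def]
  by (intro polyfun.add polyfun_dir_deriv polyfun_sum polyfun_scaleR polyfun_dunkl_quotient Rp_nonzero)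

lemma polyfun_comm: "polyfun p \<Longrightarrow> polyfun (comm \<xi> \<eta> p)"
  unfolding comm_def[abs_def]
  by (intro polyfun.add polyfun_sum polyfun_scaleR polyfun_reflection)

lemma T_const: "T \<xi> (\<lambda>_. c) x = 0"
proof -
  have "dunkl_quotient \<alpha> (\<lambda>_::'a. c) = (\<lambda>_. 0)" if "\<alpha> \<in> Rp" for \<alpha>
    by (rule dunkl_quotient_polyfun_eqI[OF polyfun.const Rp_nonzero[OF that]]) simp
  then show ?thesis by (simp add: dunkl_op_def)
qed

lemma T_add:
  assumes "polyfun p" "polyfun q"
  shows "T \<xi> (\<lambda>x. p x + q x) x = T \<xi> p x + T \<xi> q x"
proof -
  have "dunkl_quotient \<alpha> (\<lambda>x. p x + q x) = (\<lambda>x. dunkl_quotient \<alpha> p x + dunkl_quotient \<alpha> q x)"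
    if "\<alpha> \<in> Rp" for \<alpha>
    using Rp_nonzero[OF that] assms
    by (intro dunkl_quotient_polyfun_eqI)
      (auto intro: polyfun.add polyfun_dunkl_quotient simp: dunkl_quotient_mult scaleR_add_right)
  then show ?thesis
    by (simp add: dunkl_op_def dir_deriv_add polyfun_differentiable assms scaleR_add_right sum.distrib)
qed

lemma T_bounded_linear:
  assumes "polyfun p" "bounded_linear L"
  shows "T \<xi> (\<lambda>x. L (p x)) x = L (T \<xi> p x)"
proof -
  interpret bounded_linear L by fact
  have "dunkl_quotient \<alpha> (\<lambda>x. L (p x)) = (\<lambda>x. L (dunkl_quotient \<alpha> p x))"
    if "\<alpha> \<in> Rp" for \<alpha>
    using Rp_nonzero[OF that] assms
    by (intro dunkl_quotient_polyfun_eqI polyfun_bounded_linear[OF _ assms(2)] polyfun_dunkl_quotient)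
      (auto simp: dunkl_quotient_mult simp flip: scaleR diff)
  then show ?thesis
    by (simp add: dunkl_op_def dir_deriv_bounded_linear polyfun_differentiable assms add sum scaleR)
qed

lemma T_scaleR: "polyfun p \<Longrightarrow> T \<xi> (\<lambda>x. c *\<^sub>R p x) x = c *\<^sub>R T \<xi> p x"
  using T_bounded_linear bounded_linear_scaleR_right by blast

lemma T_sum:
  assumes "finite I" "\<And>i. i \<in> I \<Longrightarrow> polyfun (f i)"
  shows "T \<xi> (\<lambda>x. \<Sum>i\<in>I. f i x) x = (\<Sum>i\<in>I. T \<xi> (f i) x)"
  using assms by induction (auto simp: T_const T_add polyfun_sum)

lemma T_mult:
  assumes "polyfun p"
  shows "T \<xi> (\<lambda>x. (x \<bullet> \<eta>) *\<^sub>R p x) x = (x \<bullet> \<eta>) *\<^sub>R T \<xi> p x + comm \<xi> \<eta> p x"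
proof -
  have q: "dunkl_quotient \<alpha> (\<lambda>x. (x \<bullet> \<eta>) *\<^sub>R p x) =
      (\<lambda>y. (y \<bullet> \<eta>) *\<^sub>R dunkl_quotient \<alpha> p y + (2 * (\<alpha> \<bullet> \<eta>) / (\<alpha> \<bullet> \<alpha>)) *\<^sub>R p (reflection \<alpha> y))"
    if "\<alpha> \<in> Rp" for \<alpha>
  proof (rule dunkl_quotient_polyfun_eqI[OF _ Rp_nonzero[OF that]])
    show "polyfun (\<lambda>y. (y \<bullet> \<eta>) *\<^sub>R dunkl_quotient \<alpha> p y + (2 * (\<alpha> \<bullet> \<eta>) / (\<alpha> \<bullet> \<alpha>)) *\<^sub>R p (reflection \<alpha> y))"
      by (intro polyfun.add polyfun.mult polyfun_scaleR polyfun_reflection polyfun_dunkl_quotient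
          assms Rp_nonzero[OF that])
    fix y
    have "p y = p (reflection \<alpha> y) + (\<alpha> \<bullet> y) *\<^sub>R dunkl_quotient \<alpha> p y"
      using dunkl_quotient_mult[OF assms Rp_nonzero[OF that]] by simp
    moreover have "reflection \<alpha> y \<bullet> \<eta> = y \<bullet> \<eta> - (\<alpha> \<bullet> y) * (2 * (\<alpha> \<bullet> \<eta>) / (\<alpha> \<bullet> \<alpha>))"
      by (simp add: reflection_eq inner_diff_left)
    ultimately show "(y \<bullet> \<eta>) *\<^sub>R p y - (reflection \<alpha> y \<bullet> \<eta>) *\<^sub>R p (reflection \<alpha> y)
        = (\<alpha> \<bullet> y) *\<^sub>R ((y \<bullet> \<eta>) *\<^sub>R dunkl_quotient \<alpha> p y + (2 * (\<alpha> \<bullet> \<eta>) / (\<alpha> \<bullet> \<alpha>)) *\<^sub>R p (reflection \<alpha> y))"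
      by (simp only: product_difference)
  qed
  have "(\<Sum>\<alpha>\<in>Rp. (\<kappa> \<alpha> * (\<alpha> \<bullet> \<xi>)) *\<^sub>R dunkl_quotient \<alpha> (\<lambda>x. (x \<bullet> \<eta>) *\<^sub>R p x) x)
    = (\<Sum>\<alpha>\<in>Rp. (x \<bullet> \<eta>) *\<^sub>R (\<kappa> \<alpha> * (\<alpha> \<bullet> \<xi>)) *\<^sub>R dunkl_quotient \<alpha> p x
        + (weight \<alpha> * (\<alpha> \<bullet> \<xi>) * (\<alpha> \<bullet> \<eta>)) *\<^sub>R p (reflection \<alpha> x))"
    by (intro sum.cong refl) (simp add: q weight_def algebra_simps)
  then show ?thesis
    by (simp add: dunkl_op_def comm_def dir_deriv_coordinate_mult[OF assms] sum.distrib
        scaleR_add_right scaleR_sum_right)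
qed

lemma T_linear:
  assumes "polyfun p"
  shows "linear (\<lambda>\<xi>. T \<xi> p x)"
proof -
  have *: "linear (\<lambda>\<xi>. dir_deriv \<xi> p x)"
    by (rule has_derivative_linear[OF has_derivative_dir_deriv[OF polyfun_differentiable[OF assms]]])
  then show ?thesis
    unfolding dunkl_op_def
    by (intro linearI)
      (simp_all add: linear_add[OF *] linear_cmul[OF *] inner_add_right sum.distrib scaleR_sum_right algebra_simps)
qed

lemma sum_Basis_T: "polyfun p \<Longrightarrow> (\<Sum>b\<in>Basis. (v \<bullet> b) *\<^sub>R T b p x) = T v p x"
  using linear_sum[OF T_linear, of p "\<lambda>b. (v \<bullet> b) *\<^sub>R b" Basis x]
  by (simp add: linear_cmul[OF T_linear] euclidean_representation)

lemma sum_Basis_T_scaled: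
  "polyfun p \<Longrightarrow> (\<Sum>b\<in>Basis. (c * (v \<bullet> b)) *\<^sub>R T b p x) = c *\<^sub>R T v p x"
  using sum_Basis_T[of p "c *\<^sub>R v" x] by (simp add: linear_cmul[OF T_linear])

text \<open>Equivariance is what moves \<open>T\<close> past the reflected terms in
  \<open>comm\<close>.\<close>

lemma T_reflection:
  assumes "polyfun p" "\<beta> \<in> R"
  shows "T \<xi> (\<lambda>x. p (reflection \<beta> x)) x = T (reflection \<beta> \<xi>) p (reflection \<beta> x)"
  using assms(1)
proof (induction arbitrary: x)
  case (const c)
  show ?case by (simp add: T_const)
next
  case (add p q)
  then show ?case by (simp add: T_add polyfun_reflection)
next
  case (mult p \<eta>)
  then show ?case
    by (simp add: T_mult polyfun_reflection inner_reflection_left comm_reflection[OF assms(2)]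
        reflection_involution)
qed

lemma T_comm:
  assumes "polyfun p"
  shows "T \<zeta> (comm \<xi> \<eta> p) x = (\<xi> \<bullet> \<eta>) *\<^sub>R T \<zeta> p x +
     (\<Sum>\<alpha>\<in>Rp. (weight \<alpha> * (\<alpha> \<bullet> \<xi>) * (\<alpha> \<bullet> \<eta>)) *\<^sub>R T (reflection \<alpha> \<zeta>) p (reflection \<alpha> x))"
  unfolding comm_def[abs_def]
  using Rp_subset
  by (subst T_add)
    (auto intro!: sum.cong simp: assms T_scaleR T_sum finite_Rp T_reflection polyfun_reflection polyfun_scaleR
      polyfun_sum)

text \<open>
  The induction works since the commutator of \<open>T \<xi>\<close> and \<open>T \<eta>\<close> commutes with the multiplication
  by every coordinate, as the Jacobi identity and \<open>T_comm\<close> show.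
\<close>

lemma T_commute:
  assumes "polyfun p"
  shows "T \<xi> (T \<eta> p) x = T \<eta> (T \<xi> p) x"
  using assms
proof (induction arbitrary: x)
  case (const c)
  have "T \<zeta> (\<lambda>_. c) = (\<lambda>_. 0)" for \<zeta> by (simp add: fun_eq_iff T_const)
  then show ?case by (simp add: T_const)
next
  case (add p q)
  have "T \<zeta> (\<lambda>x. p x + q x) = (\<lambda>x. T \<zeta> p x + T \<zeta> q x)" for \<zeta>
    using add by (simp add: fun_eq_iff T_add)
  then show ?case using add by (simp add: T_add polyfun_T)
next
  case (mult p \<zeta>)
  note p = mult.hyps
  \<comment> \<open>Apart from \<open>T \<xi> (T \<eta> p)\<close>, to which the induction
    hypothesis applies, the right side is symmetric in \<xi> and \<eta>. Expanding the reflected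
    direction of the operator is what exposes this symmetry.\<close>
  have expand: "T \<xi> (T \<eta> (\<lambda>x. (x \<bullet> \<zeta>) *\<^sub>R p x)) x =
      (x \<bullet> \<zeta>) *\<^sub>R T \<xi> (T \<eta> p) x + ((\<xi> \<bullet> \<zeta>) *\<^sub>R T \<eta> p x + (\<eta> \<bullet> \<zeta>) *\<^sub>R T \<xi> p x) +
      (\<Sum>\<alpha>\<in>Rp. (weight \<alpha> * (\<alpha> \<bullet> \<zeta>)) *\<^sub>R
        ((\<alpha> \<bullet> \<xi>) *\<^sub>R T \<eta> p (reflection \<alpha> x) + (\<alpha> \<bullet> \<eta>) *\<^sub>R T \<xi> p (reflection \<alpha> x)
          - (2 * (\<alpha> \<bullet> \<xi>) * (\<alpha> \<bullet> \<eta>) / (\<alpha> \<bullet> \<alpha>)) *\<^sub>R T \<alpha> p (reflection \<alpha> x)))" for \<xi> \<eta>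
  proof -
    have T_refl: "T (reflection \<alpha> \<xi>) p y = T \<xi> p y - (2 * (\<alpha> \<bullet> \<xi>) / (\<alpha> \<bullet> \<alpha>)) *\<^sub>R T \<alpha> p y" for \<alpha> y
      by (simp only: reflection_eq linear_diff[OF T_linear[OF p]] linear_cmul[OF T_linear[OF p]])
    have "T \<eta> (\<lambda>x. (x \<bullet> \<zeta>) *\<^sub>R p x) = (\<lambda>x. (x \<bullet> \<zeta>) *\<^sub>R T \<eta> p x + comm \<eta> \<zeta> p x)"
      by (simp add: fun_eq_iff T_mult p)
    then have "T \<xi> (T \<eta> (\<lambda>x. (x \<bullet> \<zeta>) *\<^sub>R p x)) x
        = (x \<bullet> \<zeta>) *\<^sub>R T \<xi> (T \<eta> p) x + comm \<xi> \<zeta> (T \<eta> p) x + T \<xi> (comm \<eta> \<zeta> p) x"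
      by (simp add: T_add T_mult p polyfun.mult polyfun_T polyfun_comm)
    also have "\<dots> = (x \<bullet> \<zeta>) *\<^sub>R T \<xi> (T \<eta> p) x + ((\<xi> \<bullet> \<zeta>) *\<^sub>R T \<eta> p x + (\<eta> \<bullet> \<zeta>) *\<^sub>R T \<xi> p x) +
      (\<Sum>\<alpha>\<in>Rp. (weight \<alpha> * (\<alpha> \<bullet> \<xi>) * (\<alpha> \<bullet> \<zeta>)) *\<^sub>R T \<eta> p (reflection \<alpha> x) +
        (weight \<alpha> * (\<alpha> \<bullet> \<eta>) * (\<alpha> \<bullet> \<zeta>)) *\<^sub>R T (reflection \<alpha> \<xi>) p (reflection \<alpha> x))"
      by (simp add: comm_def[of \<xi>] T_comm[OF p] sum.distrib)
    also have "(\<Sum>\<alpha>\<in>Rp. (weight \<alpha> * (\<alpha> \<bullet> \<xi>) * (\<alpha> \<bullet> \<zeta>)) *\<^sub>R T \<eta> p (reflection \<alpha> x) +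
        (weight \<alpha> * (\<alpha> \<bullet> \<eta>) * (\<alpha> \<bullet> \<zeta>)) *\<^sub>R T (reflection \<alpha> \<xi>) p (reflection \<alpha> x))
      = (\<Sum>\<alpha>\<in>Rp. (weight \<alpha> * (\<alpha> \<bullet> \<zeta>)) *\<^sub>R
        ((\<alpha> \<bullet> \<xi>) *\<^sub>R T \<eta> p (reflection \<alpha> x) + (\<alpha> \<bullet> \<eta>) *\<^sub>R T \<xi> p (reflection \<alpha> x)
          - (2 * (\<alpha> \<bullet> \<xi>) * (\<alpha> \<bullet> \<eta>) / (\<alpha> \<bullet> \<alpha>)) *\<^sub>R T \<alpha> p (reflection \<alpha> x)))"
      by (intro sum.cong refl) (simp add: T_refl algebra_simps)
    finally show ?thesis .
  qed
  show ?case
    unfolding expand[of \<xi> \<eta>] expand[of \<eta> \<xi>] mult.IH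
    by (simp add: ac_simps)
qed

text \<open>Each of the two commutator sums gives \<open>T \<eta> p\<close> and a sum over roots.
  The root sums have opposite signs, because a reflection sends its root to the negative, and they
  cancel.\<close>

lemma laplacian_coordinate_mult:
  assumes p: "polyfun p"
  shows "(\<Sum>b\<in>Basis. T b (T b (\<lambda>x. (x \<bullet> \<eta>) *\<^sub>R p x)) x)
    = (x \<bullet> \<eta>) *\<^sub>R (\<Sum>b\<in>Basis. T b (T b p) x) + 2 *\<^sub>R T \<eta> p x"
proof -
  have "T b (T b (\<lambda>x. (x \<bullet> \<eta>) *\<^sub>R p x)) x
      = (x \<bullet> \<eta>) *\<^sub>R T b (T b p) x + comm b \<eta> (T b p) x + T b (comm b \<eta> p) x" for b
  proof -
    have "T b (\<lambda>x. (x \<bullet> \<eta>) *\<^sub>R p x) = (\<lambda>x. (x \<bullet> \<eta>) *\<^sub>R T b p x + comm b \<eta> p x)"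
      by (simp add: fun_eq_iff T_mult p)
    then show ?thesis by (simp add: T_add T_mult p polyfun.mult polyfun_T polyfun_comm)
  qed
  moreover have "(\<Sum>b\<in>Basis. comm b \<eta> (T b p) x)
      = T \<eta> p x + (\<Sum>\<alpha>\<in>Rp. (weight \<alpha> * (\<alpha> \<bullet> \<eta>)) *\<^sub>R T \<alpha> p (reflection \<alpha> x))"
  proof -
    have "(\<Sum>b\<in>Basis. comm b \<eta> (T b p) x) = (\<Sum>b\<in>Basis. (\<eta> \<bullet> b) *\<^sub>R T b p x)
       + (\<Sum>\<alpha>\<in>Rp. \<Sum>b\<in>Basis. ((weight \<alpha> * (\<alpha> \<bullet> \<eta>)) * (\<alpha> \<bullet> b)) *\<^sub>R T b p (reflection \<alpha> x))"
      unfolding comm_def sum.distrib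
      by (subst sum.swap) (simp add: inner_commute mult_ac)
    then show ?thesis by (simp only: sum_Basis_T sum_Basis_T_scaled p)
  qed
  moreover have "(\<Sum>b\<in>Basis. T b (comm b \<eta> p) x)
      = T \<eta> p x - (\<Sum>\<alpha>\<in>Rp. (weight \<alpha> * (\<alpha> \<bullet> \<eta>)) *\<^sub>R T \<alpha> p (reflection \<alpha> x))"
  proof -
    have refl: "(\<Sum>b\<in>Basis. (c * (\<alpha> \<bullet> b)) *\<^sub>R T (reflection \<alpha> b) p y) = - (c *\<^sub>R T \<alpha> p y)" for \<alpha> y c
    proof -
      have "(\<Sum>b\<in>Basis. (c * (\<alpha> \<bullet> b)) *\<^sub>R T (reflection \<alpha> b) p y)
          = c *\<^sub>R T (\<Sum>b\<in>Basis. (\<alpha> \<bullet> b) *\<^sub>R reflection \<alpha> b) p y"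
        by (simp add: linear_sum[OF T_linear[OF p]] linear_cmul[OF T_linear[OF p]] scaleR_sum_right)
      also have "(\<Sum>b\<in>Basis. (\<alpha> \<bullet> b) *\<^sub>R reflection \<alpha> b) = reflection \<alpha> (\<Sum>b\<in>Basis. (\<alpha> \<bullet> b) *\<^sub>R b)"
        by (simp add: linear_sum[OF linear_reflection] linear_cmul[OF linear_reflection])
      also have "\<dots> = - \<alpha>" by (simp add: euclidean_representation reflection_self)
      finally show ?thesis by (simp add: linear_neg[OF T_linear[OF p]])
    qed
    have "(\<Sum>b\<in>Basis. T b (comm b \<eta> p) x) = (\<Sum>b\<in>Basis. (\<eta> \<bullet> b) *\<^sub>R T b p x)
       + (\<Sum>\<alpha>\<in>Rp. \<Sum>b\<in>Basis. ((weight \<alpha> * (\<alpha> \<bullet> \<eta>)) * (\<alpha> \<bullet> b)) *\<^sub>R T (reflection \<alpha> b) p (reflection \<alpha> x))"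
      unfolding T_comm[OF p] sum.distrib
      by (subst sum.swap) (simp add: inner_commute mult_ac)
    then show ?thesis by (simp only: sum_Basis_T p refl sum_negf diff_conv_add_uminus)
  qed
  ultimately show ?thesis by (simp add: sum.distrib scaleR_sum_right scaleR_2)
qed

text \<open>In the direction of the point itself the factor \<open>\<alpha> \<bullet> x\<close>
  clears the denominator of the quotient.\<close>

lemma T_position:
  assumes "polyfun p"
  shows "T x p x = dir_deriv x p x + (\<Sum>\<alpha>\<in>Rp. \<kappa> \<alpha> *\<^sub>R (p x - p (reflection \<alpha> x)))"
  unfolding dunkl_op_def
  by (simp add: Rp_nonzero dunkl_quotient_mult[OF assms, symmetric])

lemma sum_Basis_comm:
  "(\<Sum>b\<in>Basis. comm b b p x) = real DIM('a) *\<^sub>R p x + (\<Sum>\<alpha>\<in>Rp. (2 * \<kappa> \<alpha>) *\<^sub>R p (reflection \<alpha> x))"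
proof -
  have "(\<Sum>b\<in>Basis. weight \<alpha> * (\<alpha> \<bullet> b) * (\<alpha> \<bullet> b)) = 2 * \<kappa> \<alpha>" if "\<alpha> \<in> Rp" for \<alpha>
    using Rp_nonzero[OF that]
    by (simp add: weight_def mult.assoc sum_distrib_left[symmetric] euclidean_inner[symmetric]
        del: times_divide_eq_left) simp
  then have "(\<Sum>\<alpha>\<in>Rp. \<Sum>b\<in>Basis. (weight \<alpha> * (\<alpha> \<bullet> b) * (\<alpha> \<bullet> b)) *\<^sub>R p (reflection \<alpha> x))
      = (\<Sum>\<alpha>\<in>Rp. (2 * \<kappa> \<alpha>) *\<^sub>R p (reflection \<alpha> x))"
    by (simp flip: scaleR_sum_left)
  then show ?thesis
    unfolding comm_def sum.distrib by (subst sum.swap) (simp add: sum_constant_scaleR)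
qed

text \<open>The reflected values cancel: \<open>T_position\<close> contributes them with factor - 2
  \<kappa>, \<open>sum_Basis_comm\<close> with 2 \<kappa>. This eigenvalue becomes the parameter of
  \<open>lam\<close>.\<close>

lemma euler_operator_sum:
  assumes "polyfun p" "dir_deriv x p x = real k *\<^sub>R p x"
  shows "(\<Sum>b\<in>Basis. T b (\<lambda>x. (x \<bullet> b) *\<^sub>R p x) x + (x \<bullet> b) *\<^sub>R T b p x)
    = (2 * real k + 2 * (\<Sum>\<alpha>\<in>Rp. \<kappa> \<alpha>) + real DIM('a)) *\<^sub>R p x"
proof -
  have "(\<Sum>b\<in>Basis. T b (\<lambda>x. (x \<bullet> b) *\<^sub>R p x) x + (x \<bullet> b) *\<^sub>R T b p x)
      = 2 *\<^sub>R T x p x + (\<Sum>b\<in>Basis. comm b b p x)"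
    by (simp add: T_mult assms(1) sum.distrib sum_Basis_T scaleR_2)
  also have "\<dots> = (2 * real k + 2 * (\<Sum>\<alpha>\<in>Rp. \<kappa> \<alpha>) + real DIM('a)) *\<^sub>R p x"
    by (simp add: T_position assms sum_Basis_comm scaleR_diff_right sum_subtractf scaleR_sum_right
        scaleR_add_left scaleR_add_right flip: scaleR_sum_left scaleR_scaleR)
  finally show ?thesis .
qed

end

section \<open>Homogeneous polynomials\<close>

lemma polyfun_monomial_mult:
  fixes p :: "real ^ 'd \<Rightarrow> 'b::real_normed_vector"
  assumes "polyfun p"
  shows "polyfun (\<lambda>x. (\<Prod>i\<in>I. (x $ i) ^ a i) *\<^sub>R p x)"
proof (induction I rule: infinite_finite_induct)
  case (insert i I)
  have "polyfun (\<lambda>x. (x $ i) ^ k *\<^sub>R (\<Prod>i\<in>I. (x $ i) ^ a i) *\<^sub>R p x)" for k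
  proof (induction k)
    case (Suc k)
    from polyfun.mult[OF this, of "axis i 1"] show ?case by (simp add: inner_axis mult.assoc)
  qed (simp add: insert.IH)
  then show ?case using insert.hyps by (simp flip: scaleR_scaleR)
qed (use assms in auto)

lemma homogeneous_polynomial_polyfun:
  fixes P :: "real ^ 'd \<Rightarrow> 'b::real_normed_vector"
  assumes "homogeneous_polynomial n P"
  shows "polyfun P"
proof -
  obtain c where "P = (\<lambda>x. \<Sum>a | (\<Sum>i\<in>UNIV. a i) = n. (\<Prod>i\<in>UNIV. (x $ i) ^ a i) *\<^sub>R c a)"
    using assms by (auto simp: homogeneous_polynomial_def fun_eq_iff)
  then show ?thesis by (simp add: polyfun_sum polyfun_monomial_mult polyfun.const)
qed

lemma homogeneous_polynomial_scaleR:
  assumes "homogeneous_polynomial n P"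
  shows "P (t *\<^sub>R x) = t ^ n *\<^sub>R P x"
proof -
  obtain c where c: "\<And>x. P x = (\<Sum>a | (\<Sum>i\<in>UNIV. a i) = n. (\<Prod>i\<in>UNIV. (x $ i) ^ a i) *\<^sub>R c a)"
    using assms by (auto simp: homogeneous_polynomial_def)
  show ?thesis
    unfolding c scaleR_sum_right
    by (intro sum.cong refl) (auto simp: power_mult_distrib prod.distrib simp flip: power_sum)
qed

text \<open>Both sides are the derivative of \<open>p (t *\<^sub>R x)\<close> in t at t = 1.\<close>

lemma euler_identity:
  assumes "polyfun p" "\<And>t. p (t *\<^sub>R x) = t ^ k *\<^sub>R p x"
  shows "dir_deriv x p x = real k *\<^sub>R p x"
proof -
  have "((\<lambda>t::real. t *\<^sub>R x) has_vector_derivative x) (at 1)"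
    by (auto intro!: derivative_eq_intros)
  moreover have "(p has_derivative (\<lambda>\<xi>. dir_deriv \<xi> p x)) (at (1 *\<^sub>R x) within range (\<lambda>t. t *\<^sub>R x))"
    using has_derivative_dir_deriv[OF polyfun_differentiable[OF assms(1)]]
    by (simp add: has_derivative_at_withinI)
  ultimately have "((\<lambda>t. p (t *\<^sub>R x)) has_vector_derivative dir_deriv x p x) (at 1)"
    using vector_derivative_diff_chain_within by (fastforce simp: comp_def)
  moreover have "((\<lambda>t. t ^ k *\<^sub>R p x) has_vector_derivative real k *\<^sub>R p x) (at 1)"
    by (auto intro!: derivative_eq_intros simp: has_vector_derivative_def)
  ultimately show ?thesis
    unfolding assms(2) by (rule vector_derivative_unique_at)
qed

section \<open>Clifford-valued polynomial functions\<close>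

lemma bounded_linear_cl_mult_right: "bounded_linear (\<lambda>y. a \<odot> y)"
  by (rule linear_conv_bounded_linear[THEN iffD1])
    (rule bilinear_cl_mult[unfolded bilinear_def, THEN conjunct1, rule_format])

lemma bounded_linear_cl_mult_left: "bounded_linear (\<lambda>y. y \<odot> a)"
  by (rule linear_conv_bounded_linear[THEN iffD1])
    (rule bilinear_cl_mult[unfolded bilinear_def, THEN conjunct2, rule_format])

lemmas cl_mult_right_linear = bounded_linear.linear[OF bounded_linear_cl_mult_right]
lemmas cl_mult_left_linear = bounded_linear.linear[OF bounded_linear_cl_mult_left]

lemmas cl_mult_simps = linear_add[OF cl_mult_right_linear] linear_cmul[OF cl_mult_right_linear]
  linear_add[OF cl_mult_left_linear] linear_cmul[OF cl_mult_left_linear]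

lemma cl_gen_swap:
  "cl_gen i \<odot> (cl_gen j \<odot> y) = - (cl_gen j \<odot> (cl_gen i \<odot> y)) + (if i = j then - 2 else 0) *\<^sub>R y"
proof -
  have "(cl_gen i \<odot> cl_gen j + cl_gen j \<odot> cl_gen i) \<odot> y = (if i = j then - 2 else 0) *\<^sub>R y"
    unfolding cl_gen_anticommute by (simp add: cl_mult_simps cl_mult_unit)
  then show ?thesis
    by (simp only: cl_mult_simps cl_mult_assoc) (simp add: algebra_simps)
qed

text \<open>Anticommutation shows that the double sum equals its own negative minus twice the
  diagonal. This one computation gives both the square of a vector and the square of the Dirac
  operator.\<close>

lemma sum_cl_gen_symmetric:
  fixes a :: "'d::{finite,linorder} \<Rightarrow> 'd \<Rightarrow> 'd clifford"
  assumes "\<And>i j. a i j = a j i"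
  shows "(\<Sum>i\<in>UNIV. \<Sum>j\<in>UNIV. cl_gen i \<odot> (cl_gen j \<odot> a i j)) = - (\<Sum>i\<in>UNIV. a i i)"
proof -
  let ?S = "\<Sum>i\<in>UNIV. \<Sum>j\<in>UNIV. cl_gen i \<odot> (cl_gen j \<odot> a i j)"
  have "?S = (\<Sum>i\<in>UNIV. \<Sum>j\<in>UNIV. - (cl_gen j \<odot> (cl_gen i \<odot> a i j)) + (if i = j then - 2 else 0) *\<^sub>R a i j)"
    by (intro sum.cong refl) (rule cl_gen_swap)
  also have "\<dots> = - (\<Sum>i\<in>UNIV. \<Sum>j\<in>UNIV. cl_gen j \<odot> (cl_gen i \<odot> a i j)) - 2 *\<^sub>R (\<Sum>i\<in>UNIV. a i i)"
    by (simp add: sum.distrib sum_negf sum_subtractf if_distrib[of "\<lambda>c. c *\<^sub>R _"] scaleR_sum_right cong: if_cong)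
  also have "(\<Sum>i\<in>UNIV. \<Sum>j\<in>UNIV. cl_gen j \<odot> (cl_gen i \<odot> a i j)) = ?S"
    by (subst sum.swap) (simp add: assms)
  finally have "2 *\<^sub>R ?S = 2 *\<^sub>R - (\<Sum>i\<in>UNIV. a i i)" by (simp add: scaleR_2)
  then show ?thesis by (simp only: scaleR_cancel_left) simp
qed

lemma cl_vec_mult: "cl_vec x \<odot> y = (\<Sum>i\<in>UNIV. (x $ i) *\<^sub>R (cl_gen i \<odot> y))"
  unfolding cl_vec_def by (simp add: linear_sum[OF cl_mult_left_linear] cl_mult_simps)

lemma cl_vec_squared: "cl_vec x \<odot> (cl_vec x \<odot> y) = - ((x \<bullet> x) *\<^sub>R y)"
proof -
  have "cl_vec x \<odot> (cl_vec x \<odot> y)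
      = (\<Sum>i\<in>UNIV. \<Sum>j\<in>UNIV. cl_gen i \<odot> (cl_gen j \<odot> ((x $ i * x $ j) *\<^sub>R y)))"
    by (simp add: cl_vec_mult linear_sum[OF cl_mult_right_linear] cl_mult_simps scaleR_sum_right)
      (subst sum.swap, simp add: mult.commute)
  also have "\<dots> = - (\<Sum>i\<in>UNIV. (x $ i * x $ i) *\<^sub>R y)"
    by (rule sum_cl_gen_symmetric) (simp add: mult.commute)
  finally show ?thesis by (simp add: inner_vec_def flip: scaleR_sum_left)
qed

lemma sum_Basis_axis:
  fixes g :: "real ^ 'd \<Rightarrow> 'b::comm_monoid_add"
  shows "(\<Sum>b\<in>Basis. g b) = (\<Sum>i\<in>UNIV. g (axis i 1))"
  by (rule sum.reindex_cong[of "\<lambda>i. axis i 1" UNIV])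
    (auto simp: Basis_vec_def inj_on_def axis_eq_axis)

locale clifford_dunkl = dunkl_setting R Rp \<kappa>
  for R Rp :: "(real, 'd::{finite,linorder}) vec set" and \<kappa>
begin

lemma polyfun_cl_mult: "polyfun p \<Longrightarrow> polyfun (\<lambda>x. a \<odot> p x)"
  by (rule polyfun_bounded_linear[OF _ bounded_linear_cl_mult_right])

lemma T_cl_mult: "polyfun p \<Longrightarrow> T \<xi> (\<lambda>x. a \<odot> p x) x = a \<odot> T \<xi> p x"
  by (rule T_bounded_linear[OF _ bounded_linear_cl_mult_right])

lemma cl_vec_mult_polyfun_eq:
  "(\<lambda>x. cl_vec x \<odot> p x) = (\<lambda>x. \<Sum>j\<in>UNIV. (x \<bullet> axis j 1) *\<^sub>R (cl_gen j \<odot> p x))"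
  by (simp add: cl_vec_mult inner_axis)

lemma polyfun_cl_vec_mult: "polyfun p \<Longrightarrow> polyfun (\<lambda>x. cl_vec x \<odot> p x)"
  unfolding cl_vec_mult_polyfun_eq by (intro polyfun_sum polyfun.mult polyfun_cl_mult)

lemma T_cl_vec_mult:
  assumes "polyfun p"
  shows "T \<xi> (\<lambda>x. cl_vec x \<odot> p x) x
    = (\<Sum>j\<in>UNIV. T \<xi> (\<lambda>x. (x \<bullet> axis j 1) *\<^sub>R (cl_gen j \<odot> p x)) x)"
  unfolding cl_vec_mult_polyfun_eq
  by (intro T_sum finite polyfun.mult polyfun_cl_mult assms)

text \<open>Commutativity of the Dunkl operators supplies the symmetry by which the squared Dirac
  operator is minus the Laplacian.\<close>

lemma monogenic_imp_harmonic:
  assumes P: "polyfun P" and mono: "\<And>x. dunkl_dirac Rp \<kappa> P x = 0"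
  shows "(\<Sum>b\<in>Basis. T b (T b P) x) = 0"
proof -
  have "(\<lambda>x. \<Sum>j\<in>UNIV. cl_gen j \<odot> T (axis j 1) P x) = (\<lambda>_. 0)"
    using mono by (simp add: dunkl_dirac_def fun_eq_iff)
  then have "T (axis i 1) (\<lambda>x. \<Sum>j\<in>UNIV. cl_gen j \<odot> T (axis j 1) P x) x = 0" for i
    by (simp add: T_const)
  then have "0 = (\<Sum>i\<in>UNIV. cl_gen i \<odot> T (axis i 1) (\<lambda>x. \<Sum>j\<in>UNIV. cl_gen j \<odot> T (axis j 1) P x) x)"
    by (simp add: linear_0[OF cl_mult_right_linear])
  also have "\<dots> = (\<Sum>i\<in>UNIV. \<Sum>j\<in>UNIV. cl_gen i \<odot> (cl_gen j \<odot> T (axis i 1) (T (axis j 1) P) x))"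
    by (simp add: T_sum T_cl_mult polyfun_T polyfun_cl_mult P linear_sum[OF cl_mult_right_linear])
  also have "\<dots> = - (\<Sum>i\<in>UNIV. T (axis i 1) (T (axis i 1) P) x)"
    by (rule sum_cl_gen_symmetric) (rule T_commute[OF P])
  finally show ?thesis by (simp add: sum_Basis_axis)
qed

text \<open>Coordinatewise, the commutator of the Laplacian with multiplication by the vector x is
  twice the Dirac operator.\<close>

lemma cl_vec_mult_monogenic_harmonic:
  assumes P: "polyfun P" and mono: "\<And>x. dunkl_dirac Rp \<kappa> P x = 0"
  shows "(\<Sum>b\<in>Basis. T b (T b (\<lambda>x. cl_vec x \<odot> P x)) x) = 0"
proof -
  note q = polyfun.mult[OF polyfun_cl_mult[OF P]]
  have "T b (\<lambda>x. cl_vec x \<odot> P x)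
      = (\<lambda>x. \<Sum>j\<in>UNIV. T b (\<lambda>x. (x \<bullet> axis j 1) *\<^sub>R (cl_gen j \<odot> P x)) x)" for b
    by (simp add: fun_eq_iff T_cl_vec_mult P)
  then have "(\<Sum>b\<in>Basis. T b (T b (\<lambda>x. cl_vec x \<odot> P x)) x)
      = (\<Sum>b\<in>Basis. \<Sum>j\<in>UNIV. T b (T b (\<lambda>x. (x \<bullet> axis j 1) *\<^sub>R (cl_gen j \<odot> P x))) x)"
    by (simp add: T_sum polyfun_T q)
  also have "\<dots> = (\<Sum>j\<in>UNIV. (x \<bullet> axis j 1) *\<^sub>R (\<Sum>b\<in>Basis. T b (T b (\<lambda>x. cl_gen j \<odot> P x)) x)
        + 2 *\<^sub>R T (axis j 1) (\<lambda>x. cl_gen j \<odot> P x) x)"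
    by (subst sum.swap) (simp only: laplacian_coordinate_mult[OF polyfun_cl_mult[OF P]])
  also have "\<dots> = (\<Sum>j\<in>UNIV. 2 *\<^sub>R (cl_gen j \<odot> T (axis j 1) P x))"
  proof (intro sum.cong refl)
    fix j :: 'd
    have "T b (\<lambda>x. cl_gen j \<odot> P x) = (\<lambda>x. cl_gen j \<odot> T b P x)" for b
      by (simp add: fun_eq_iff T_cl_mult P)
    then have "(\<Sum>b\<in>Basis. T b (T b (\<lambda>x. cl_gen j \<odot> P x)) x) = cl_gen j \<odot> (\<Sum>b\<in>Basis. T b (T b P) x)"
      by (simp add: T_cl_mult polyfun_T P linear_sum[OF cl_mult_right_linear])
    then show "(x \<bullet> axis j 1) *\<^sub>R (\<Sum>b\<in>Basis. T b (T b (\<lambda>x. cl_gen j \<odot> P x)) x)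
        + 2 *\<^sub>R T (axis j 1) (\<lambda>x. cl_gen j \<odot> P x) x = 2 *\<^sub>R (cl_gen j \<odot> T (axis j 1) P x)"
      by (simp add: monogenic_imp_harmonic[OF assms] T_cl_mult P linear_0[OF cl_mult_right_linear])
  qed
  also have "\<dots> = 2 *\<^sub>R dunkl_dirac Rp \<kappa> P x"
    by (simp add: dunkl_dirac_def scaleR_sum_right)
  finally show ?thesis by (simp add: mono)
qed

text \<open>Moving the Dirac operator past the vector x costs a sign and, from the diagonal, minus
  the sum of the anticommutators of the T_i and x_i; the latter is a number by
  \<open>euler_operator_sum\<close>.\<close>

lemma dirac_cl_vec_mult:
  assumes P: "polyfun P" and mono: "\<And>x. dunkl_dirac Rp \<kappa> P x = 0"
    and deg: "dir_deriv x P x = real n *\<^sub>R P x"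
  shows "dunkl_dirac Rp \<kappa> (\<lambda>x. cl_vec x \<odot> P x) x
    = - ((2 * real n + 2 * (\<Sum>\<alpha>\<in>Rp. \<kappa> \<alpha>) + real CARD('d)) *\<^sub>R P x)"
proof -
  have comm_swap: "comm (axis i 1) (axis j 1) P x = comm (axis j 1) (axis i 1) P x" for i j
    by (simp add: comm_def inner_commute mult_ac)
  have comm_cl: "comm \<xi> \<eta> (\<lambda>x. a \<odot> P x) x = a \<odot> comm \<xi> \<eta> P x" for \<xi> \<eta> a
    by (simp add: comm_def cl_mult_simps linear_sum[OF cl_mult_right_linear])
  have "dunkl_dirac Rp \<kappa> (\<lambda>x. cl_vec x \<odot> P x) x
      = (\<Sum>i\<in>UNIV. \<Sum>j\<in>UNIV. cl_gen i \<odot> (cl_gen j \<odot> ((x $ j) *\<^sub>R T (axis i 1) P x))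
          + cl_gen i \<odot> (cl_gen j \<odot> comm (axis i 1) (axis j 1) P x))"
    by (simp add: dunkl_dirac_def T_cl_vec_mult P T_mult polyfun_cl_mult T_cl_mult comm_cl
        linear_sum[OF cl_mult_right_linear] cl_mult_simps) (simp add: inner_axis)
  \<comment> \<open>The commutator part is symmetric in i and j and reduces to its diagonal; the
    other part is not, and is reordered by \<open>cl_gen_swap\<close>.\<close>
  also have "\<dots> = (\<Sum>i\<in>UNIV. \<Sum>j\<in>UNIV. cl_gen i \<odot> (cl_gen j \<odot> ((x $ j) *\<^sub>R T (axis i 1) P x)))
      - (\<Sum>i\<in>UNIV. comm (axis i 1) (axis i 1) P x)"
    unfolding sum.distrib sum_cl_gen_symmetric[of "\<lambda>i j. comm (axis i 1) (axis j 1) P x", OF comm_swap]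
    by simp
  also have "(\<Sum>i\<in>UNIV. \<Sum>j\<in>UNIV. cl_gen i \<odot> (cl_gen j \<odot> ((x $ j) *\<^sub>R T (axis i 1) P x)))
      = (\<Sum>i\<in>UNIV. \<Sum>j\<in>UNIV. - (cl_gen j \<odot> (cl_gen i \<odot> ((x $ j) *\<^sub>R T (axis i 1) P x)))
          + (if i = j then - 2 else 0) *\<^sub>R (x $ j) *\<^sub>R T (axis i 1) P x)"
    by (intro sum.cong refl) (rule cl_gen_swap)
  also have "\<dots> = - (\<Sum>i\<in>UNIV. \<Sum>j\<in>UNIV. cl_gen j \<odot> (cl_gen i \<odot> ((x $ j) *\<^sub>R T (axis i 1) P x)))
      - (\<Sum>i\<in>UNIV. 2 *\<^sub>R (x $ i) *\<^sub>R T (axis i 1) P x)"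
    by (simp add: sum.distrib sum_negf sum_subtractf if_distrib[of "\<lambda>c. c *\<^sub>R _"]
        del: scaleR_scaleR cong: if_cong)
  also have "(\<Sum>i\<in>UNIV. \<Sum>j\<in>UNIV. cl_gen j \<odot> (cl_gen i \<odot> ((x $ j) *\<^sub>R T (axis i 1) P x)))
      = cl_vec x \<odot> dunkl_dirac Rp \<kappa> P x"
    by (simp add: cl_vec_mult dunkl_dirac_def linear_sum[OF cl_mult_right_linear] cl_mult_simps
        scaleR_sum_right)
  also have "- (cl_vec x \<odot> dunkl_dirac Rp \<kappa> P x) - (\<Sum>i\<in>UNIV. 2 *\<^sub>R (x $ i) *\<^sub>R T (axis i 1) P x)
      - (\<Sum>i\<in>UNIV. comm (axis i 1) (axis i 1) P x)
    = - (\<Sum>i\<in>UNIV. T (axis i 1) (\<lambda>x. (x \<bullet> axis i 1) *\<^sub>R P x) x + (x \<bullet> axis i 1) *\<^sub>R T (axis i 1) P x)"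
  proof -
    have "T (axis i 1) (\<lambda>x. (x \<bullet> axis i 1) *\<^sub>R P x) x
        = (x $ i) *\<^sub>R T (axis i 1) P x + comm (axis i 1) (axis i 1) P x" for i
      by (simp only: T_mult[OF P]) (simp add: inner_axis)
    then show ?thesis
      by (simp only: mono linear_0[OF cl_mult_right_linear] sum.distrib scaleR_2)
        (simp add: inner_axis)
  qed
  finally show ?thesis
    using euler_operator_sum[OF P deg] by (simp add: sum_Basis_axis)
qed

end

section \<open>Axially symmetric functions\<close>

definition lift :: "(complex \<Rightarrow> real) \<Rightarrow> (real ^ 'd \<Rightarrow> 'b::real_normed_vector) \<Rightarrow> real \<times> (real ^ 'd) \<Rightarrow> 'b" where
  "lift \<phi> g w = \<phi> (Complex (fst w) (norm (snd w))) *\<^sub>R g (snd w)"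

text \<open>Lists make the finite sums into data on which each differential operator acts by a list
  transformation, so that iteration stays within one form.\<close>

primrec lifts :: "((complex \<Rightarrow> real) \<times> (real ^ 'd \<Rightarrow> 'b::real_normed_vector)) list \<Rightarrow> real \<times> (real ^ 'd) \<Rightarrow> 'b" where
  "lifts [] w = 0"
| "lifts (a # L) w = lift (fst a) (snd a) w + lifts L w"

lemma lifts_append: "lifts (L @ L') w = lifts L w + lifts L' w"
  by (induction L) (simp_all add: add.assoc)

lemma axial_domain_iff: "w \<in> axial_domain \<Omega> \<longleftrightarrow> Complex (fst w) (norm (snd w)) \<in> \<Omega>"
  by (cases w) (simp add: axial_domain_def)

locale axial_setting = clifford_dunkl R Rp \<kappa> + upper_domain \<Omega>
  for R Rp :: "(real, 'd::{finite,linorder}) vec set" and \<kappa> \<Omega>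
begin

abbreviation "V \<equiv> axial_domain \<Omega> :: (real \<times> (real, 'd) vec) set"

lemma open_V: "open V"
proof -
  have "V = (\<lambda>w. Complex (fst w) (norm (snd w))) -` \<Omega>" by (auto simp: axial_domain_iff)
  moreover have "continuous_on UNIV (\<lambda>w::real \<times> (real, 'd) vec. Complex (fst w) (norm (snd w)))"
    by (intro continuous_intros)
  ultimately show ?thesis using open_dom by (simp add: continuous_on_open_vimage)
qed

lemma norm_snd_pos: "w \<in> V \<Longrightarrow> norm (snd w) > 0"
  using Im_pos by (fastforce simp: axial_domain_iff)

definition good :: "((complex \<Rightarrow> real) \<times> ((real, 'd) vec \<Rightarrow> 'd clifford)) list \<Rightarrow> bool" where
  "good L \<longleftrightarrow> (\<forall>(\<phi>, g)\<in>set L. smooth0 \<phi> \<and> polyfun g)"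

lemma good_Nil: "good []" and good_Cons: "good (a # L) \<longleftrightarrow> smooth0 (fst a) \<and> polyfun (snd a) \<and> good L"
  by (auto simp: good_def)

section \<open>Differential operators as transformations of lists\<close>

definition dt_step where "dt_step L = map (\<lambda>(\<phi>, g). (dt \<phi>, g)) L"

text \<open>The derivative of \<phi>(x0, |x|) along \<xi> is \<open>x \<bullet> \<xi>\<close> times
  \<open>dl\<close> of \<phi>. Using \<open>dl\<close> instead of d_s keeps the second component
  polynomial.\<close>

definition dir_step where
  "dir_step \<xi> L = concat (map (\<lambda>(\<phi>, g). [(dl \<phi>, \<lambda>x. (x \<bullet> \<xi>) *\<^sub>R g x), (\<phi>, dir_deriv \<xi> g)]) L)"

definition quotient_step where "quotient_step \<alpha> L = map (\<lambda>(\<phi>, g). (\<phi>, dunkl_quotient \<alpha> g)) L"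

text \<open>The radial factor is reflection-invariant, so the difference part of \<open>T\<close>
  reaches only \<open>g\<close>.\<close>

definition T_step where
  "T_step \<xi> L = concat (map (\<lambda>(\<phi>, g). [(dl \<phi>, \<lambda>x. (x \<bullet> \<xi>) *\<^sub>R g x), (\<phi>, T \<xi> g)]) L)"

lemmas step_defs = dt_step_def dir_step_def quotient_step_def T_step_def

lemma good_dt_step: "good L \<Longrightarrow> good (dt_step L)"
  by (induction L) (auto simp: step_defs good_Nil good_Cons smooth0_dt)

lemma good_dir_step: "good L \<Longrightarrow> good (dir_step \<xi> L)"
  by (induction L)
    (auto simp: step_defs good_Nil good_Cons smooth0_dl polyfun.mult polyfun_dir_deriv)

lemma good_quotient_step: "good L \<Longrightarrow> \<alpha> \<in> Rp \<Longrightarrow> good (quotient_step \<alpha> L)"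
  by (induction L) (auto simp: step_defs good_Nil good_Cons polyfun_dunkl_quotient Rp_nonzero)

lemma good_T_step: "good L \<Longrightarrow> good (T_step \<xi> L)"
  by (induction L) (auto simp: step_defs good_Nil good_Cons smooth0_dl polyfun.mult polyfun_T)

lemma has_derivative_lift:
  assumes \<phi>: "smooth0 \<phi>" and g: "polyfun g" and w: "w \<in> V"
  shows "(lift \<phi> g has_derivative (\<lambda>h. fst h *\<^sub>R lift (dt \<phi>) g w
    + (lift (dl \<phi>) (\<lambda>x. (x \<bullet> snd h) *\<^sub>R g x) w + lift \<phi> (dir_deriv (snd h) g) w))) (at w)"
proof -
  let ?z = "\<lambda>w::real \<times> (real, 'd) vec. Complex (fst w) (norm (snd w))"
  have z: "?z w \<in> \<Omega>" using w by (simp add: axial_domain_iff)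
  have r: "norm (snd w) > 0" using norm_snd_pos[OF w] .
  have "((\<lambda>w. norm (snd w)) has_derivative (\<lambda>h. snd h \<bullet> sgn (snd w))) (at w)"
    using has_derivative_compose[OF has_derivative_snd[OF has_derivative_ident] has_derivative_norm, of w] r by auto
  then have dz: "(?z has_derivative (\<lambda>h. Complex (fst h) (snd h \<bullet> sgn (snd w)))) (at w)"
    unfolding Complex_eq by (auto intro!: derivative_eq_intros)
  note d\<phi> = has_derivative_dir_deriv[OF smooth0_differentiable[OF \<phi> z]]
  have "dir_deriv (Complex a b) \<phi> (?z w) = a * dt \<phi> (?z w) + b * (norm (snd w) * dl \<phi> (?z w))" for a b
  proof -
    note l = has_derivative_linear[OF d\<phi>]
    have "Complex a b = a *\<^sub>R 1 + b *\<^sub>R \<i>" by (simp add: complex_eq_iff)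
    then have "dir_deriv (Complex a b) \<phi> (?z w) = a * dir_deriv 1 \<phi> (?z w) + b * dir_deriv \<i> \<phi> (?z w)"
      by (simp add: linear_add[OF l] linear_cmul[OF l])
    then show ?thesis using z r by (simp add: dt_def dl_def cutoff_def)
  qed
  with has_derivative_compose[OF dz d\<phi>]
  have 1: "((\<lambda>w. \<phi> (?z w)) has_derivative
      (\<lambda>h. fst h * dt \<phi> (?z w) + (snd h \<bullet> sgn (snd w)) * (norm (snd w) * dl \<phi> (?z w)))) (at w)"
    by simp
  have 2: "((\<lambda>w. g (snd w)) has_derivative (\<lambda>h. dir_deriv (snd h) g (snd w))) (at w)"
    using has_derivative_compose[OF has_derivative_snd[OF has_derivative_ident]
        has_derivative_dir_deriv[OF polyfun_differentiable[OF g]], of w] by auto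
  \<comment> \<open>The 1 / |x| from the gradient of the norm cancels the s in d_s = s
    \<open>dl\<close>; on this domain |x| is positive.\<close>
  have s: "(h \<bullet> sgn (snd w)) * (norm (snd w) * c) = (snd w \<bullet> h) * c" for h c
    using r by (simp add: sgn_div_norm inner_commute)
  show ?thesis
    using has_derivative_scaleR[OF 1 2] unfolding lift_def[abs_def] s
    by (simp add: algebra_simps)
qed

lemma has_derivative_lifts:
  assumes "good L" "w \<in> V"
  shows "(lifts L has_derivative (\<lambda>h. fst h *\<^sub>R lifts (dt_step L) w + lifts (dir_step (snd h) L) w)) (at w)"
  using assms(1)
proof (induction L)
  case Nil
  then show ?case by (simp add: step_defs)
next
  case (Cons a L)
  have eq: "lifts (a # L) = (\<lambda>w. lift (fst a) (snd a) w + lifts L w)" by (simp add: fun_eq_iff)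
  show ?case
    unfolding eq
    by (rule has_derivative_eq_rhs[OF has_derivative_add[OF has_derivative_lift Cons.IH]])
      (use Cons.prems assms(2) in \<open>auto simp: good_Cons step_defs fun_eq_iff split_beta algebra_simps\<close>)
qed

lemma isCont_lifts: "good L \<Longrightarrow> w \<in> V \<Longrightarrow> isCont (lifts L) w"
  using has_derivative_lifts has_derivative_continuous by blast

lemma dunkl_quotient_lifts:
  assumes "good L" "w \<in> V" "\<alpha> \<in> Rp" "\<And>y. y \<in> V \<Longrightarrow> F y = lifts L y"
  shows "dunkl_quotient (0, \<alpha>) F w = lifts (quotient_step \<alpha> L) w"
proof (rule dunkl_quotient_eqI[OF open_V assms(2)])
  show "(0, \<alpha>) \<noteq> 0" using Rp_nonzero[OF assms(3)] by (simp add: zero_prod_def)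
  show "isCont (lifts (quotient_step \<alpha> L)) w"
    by (intro isCont_lifts good_quotient_step assms)
  fix y :: "real \<times> (real, 'd) vec"
  assume y: "y \<in> V"
  have refl: "reflection (0, \<alpha>) y = (fst y, reflection \<alpha> (snd y))"
    by (cases y) (simp add: reflection_eq)
  have "reflection (0, \<alpha>) y \<in> V" using y by (simp add: axial_domain_iff refl norm_reflection)
  then have "F y - F (reflection (0, \<alpha>) y) = lifts L y - lifts L (fst y, reflection \<alpha> (snd y))"
    using assms(4) y refl by simp
  also have "\<dots> = (\<alpha> \<bullet> snd y) *\<^sub>R lifts (quotient_step \<alpha> L) y"
    using assms(1)
  proof (induction L)
    case (Cons a L)
    have "lift (fst a) (snd a) y - lift (fst a) (snd a) (fst y, reflection \<alpha> (snd y))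
        = (\<alpha> \<bullet> snd y) *\<^sub>R lift (fst a) (dunkl_quotient \<alpha> (snd a)) y"
      using Cons.prems Rp_nonzero[OF assms(3)]
      by (simp add: lift_def norm_reflection good_Cons mult.commute
          flip: scaleR_diff_right dunkl_quotient_mult)
    then show ?case using Cons by (simp add: good_Cons step_defs split_beta algebra_simps)
  qed (simp add: step_defs)
  finally show "F y - F (reflection (0, \<alpha>) y) = ((0, \<alpha>) \<bullet> y) *\<^sub>R lifts (quotient_step \<alpha> L) y"
    by (cases y) simp
qed

lemma dir_deriv_lifts:
  assumes "good L" "w \<in> V" "\<And>y. y \<in> V \<Longrightarrow> F y = lifts L y"
  shows "F differentiable (at w)"
    and "dir_deriv h F w = fst h *\<^sub>R lifts (dt_step L) w + lifts (dir_step (snd h) L) w"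
proof -
  have *: "(F has_derivative (\<lambda>h. fst h *\<^sub>R lifts (dt_step L) w + lifts (dir_step (snd h) L) w)) (at w)"
    using has_derivative_transform_open[OF has_derivative_lifts[OF assms(1,2)] open_V assms(2)] assms(3)
    by simp
  then show "F differentiable (at w)"
    and "dir_deriv h F w = fst h *\<^sub>R lifts (dt_step L) w + lifts (dir_step (snd h) L) w"
    using dir_deriv_eqI[OF *] by (auto simp: differentiable_def)
qed

lemma dir_step_0: "good L \<Longrightarrow> lifts (dir_step 0 L) w = 0"
proof (induction L)
  case (Cons a L)
  have "dir_deriv 0 (snd a) (snd w) = 0"
    using Cons.prems
    by (intro linear_0[OF has_derivative_linear[OF has_derivative_dir_deriv[OF polyfun_differentiable]]])
      (simp add: good_Cons)
  then show ?case using Cons by (simp add: good_Cons step_defs split_beta lift_def)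
qed (simp add: step_defs)

lemma dunkl_op1_lifts:
  assumes "good L" "w \<in> V" "\<And>y. y \<in> V \<Longrightarrow> F y = lifts L y"
  shows "dunkl_op1 Rp \<kappa> (0, \<xi>) F w = lifts (T_step \<xi> L) w"
proof -
  have "inj_on (Pair (0::real)) Rp" by (auto simp: inj_on_def)
  then have "dunkl_op1 Rp \<kappa> (0, \<xi>) F w = lifts (dir_step \<xi> L) w
      + (\<Sum>\<alpha>\<in>Rp. (\<kappa> \<alpha> * (\<alpha> \<bullet> \<xi>)) *\<^sub>R lifts (quotient_step \<alpha> L) w)"
    unfolding dunkl_op1_def dunkl_op_def
    by (simp add: dir_deriv_lifts(2)[OF assms] sum.reindex dunkl_quotient_lifts[OF assms(1,2) _ assms(3)])
  also have "\<dots> = lifts (T_step \<xi> L) w"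
  proof (induction L)
    case (Cons a L)
    have "lift (fst a) (T \<xi> (snd a)) w = lift (fst a) (dir_deriv \<xi> (snd a)) w
        + (\<Sum>\<alpha>\<in>Rp. (\<kappa> \<alpha> * (\<alpha> \<bullet> \<xi>)) *\<^sub>R lift (fst a) (dunkl_quotient \<alpha> (snd a)) w)"
      by (simp add: lift_def dunkl_op_def scaleR_add_right scaleR_sum_right mult_ac)
    then show ?case
      using Cons by (simp add: step_defs split_beta scaleR_add_right sum.distrib algebra_simps)
  qed (simp add: step_defs)
  finally show ?thesis .
qed

lemma dir_deriv_t_lifts:
  assumes "good L" "w \<in> V" "\<And>y. y \<in> V \<Longrightarrow> F y = lifts L y"
  shows "dir_deriv (1, 0) F w = lifts (dt_step L) w"
  using dir_deriv_lifts(2)[OF assms] dir_step_0[OF assms(1)] by simp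

lemma Ck_on_1_lifts:
  assumes "good L" "\<And>y. y \<in> V \<Longrightarrow> F y = lifts L y"
  shows "Ck_on 1 F V"
proof -
  have "continuous_on V (dir_deriv b F)" for b
  proof -
    have "continuous_on V (\<lambda>w. fst b *\<^sub>R lifts (dt_step L) w + lifts (dir_step (snd b) L) w)"
      by (intro continuous_intros continuous_at_imp_continuous_on ballI isCont_lifts
          good_dt_step good_dir_step assms)
    then show ?thesis
      by (rule continuous_on_cong[THEN iffD1, rotated 2]) (auto simp: dir_deriv_lifts(2)[OF assms(1) _ assms(2)])
  qed
  then show ?thesis using dir_deriv_lifts(1)[OF assms(1) _ assms(2)] by simp
qed

lemma dt_step_append: "dt_step (L @ L') = dt_step L @ dt_step L'"
  and T_step_append: "T_step \<xi> (L @ L') = T_step \<xi> L @ T_step \<xi> L'"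
  by (simp_all add: step_defs)

lemma dunkl_laplacian_lifts:
  assumes "good L" "w \<in> V" "\<And>y. y \<in> V \<Longrightarrow> F y = lifts L y"
  shows "dunkl_laplacian Rp \<kappa> F w
    = lifts (dt_step (dt_step L)) w + (\<Sum>b\<in>Basis. lifts (T_step b (T_step b L)) w)"
  unfolding dunkl_laplacian_def sum_Basis_axis
  by (intro arg_cong2[where f = "(+)"] sum.cong refl
      dir_deriv_t_lifts[OF good_dt_step[OF assms(1)] assms(2)] dir_deriv_t_lifts[OF assms(1) _ assms(3)]
      dunkl_op1_lifts[OF good_T_step[OF assms(1)] assms(2)] dunkl_op1_lifts[OF assms(1) _ assms(3)])

text \<open>Applying T twice gives s^2 \<open>dl (dl \<phi>)\<close> on g, \<open>dl \<phi>\<close>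
  on the sum of anticommutators, and \<phi> on the Laplacian of g, which is 0. With the
  t-derivatives the first two form \<open>lam\<close> with the eigenvalue as parameter.\<close>

lemma laplacian_lift:
  fixes g :: "(real, 'd) vec \<Rightarrow> 'd clifford"
  assumes "polyfun g" "\<And>x. dir_deriv x g x = real k *\<^sub>R g x"
    and "\<And>x. (\<Sum>b\<in>Basis. T b (T b g) x) = 0"
  shows "lifts (dt_step (dt_step [(\<phi>, g)])) w + (\<Sum>b\<in>Basis. lifts (T_step b (T_step b [(\<phi>, g)])) w)
    = lift (lam (2 * real k + 2 * (\<Sum>\<alpha>\<in>Rp. \<kappa> \<alpha>) + real CARD('d)) \<phi>) g w"
proof -
  let ?z = "Complex (fst w) (norm (snd w))" and ?x = "snd w"
  have "(\<Sum>b\<in>Basis. lifts (T_step b (T_step b [(\<phi>, g)])) w)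
    = dl (dl \<phi>) ?z *\<^sub>R (\<Sum>b\<in>Basis. (?x \<bullet> b) * (?x \<bullet> b)) *\<^sub>R g ?x
      + dl \<phi> ?z *\<^sub>R (\<Sum>b\<in>Basis. T b (\<lambda>x. (x \<bullet> b) *\<^sub>R g x) ?x + (?x \<bullet> b) *\<^sub>R T b g ?x)
      + \<phi> ?z *\<^sub>R (\<Sum>b\<in>Basis. T b (T b g) ?x)"
    by (simp add: step_defs lift_def sum.distrib scaleR_sum_left scaleR_sum_right scaleR_add_right add_ac)
  also have "(\<Sum>b\<in>Basis. (?x \<bullet> b) * (?x \<bullet> b)) = (norm ?x)\<^sup>2"
    by (simp add: power2_norm_eq_inner flip: euclidean_inner)
  finally show ?thesis
    unfolding euler_operator_sum[OF assms(1,2)] assms(3)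
    by (simp add: step_defs lift_def lam_def euler_def algebra_simps)
qed

text \<open>Agreement on \<open>V\<close> is enough at each step: \<open>V\<close> is open and
  stable under the reflections.\<close>

lemma dunkl_laplacian_funpow_lifts:
  fixes g h :: "(real, 'd) vec \<Rightarrow> 'd clifford"
  assumes "polyfun g" "\<And>x. dir_deriv x g x = real k *\<^sub>R g x" "\<And>x. (\<Sum>b\<in>Basis. T b (T b g) x) = 0"
    and "polyfun h" "\<And>x. dir_deriv x h x = real l *\<^sub>R h x" "\<And>x. (\<Sum>b\<in>Basis. T b (T b h) x) = 0"
    and "smooth0 \<phi>" "smooth0 \<psi>" "\<And>y. y \<in> V \<Longrightarrow> F y = lifts [(\<phi>, g), (\<psi>, h)] y" "w \<in> V"
  defines "c \<equiv> 2 * real k + 2 * (\<Sum>\<alpha>\<in>Rp. \<kappa> \<alpha>) + real CARD('d)"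
    and "c' \<equiv> 2 * real l + 2 * (\<Sum>\<alpha>\<in>Rp. \<kappa> \<alpha>) + real CARD('d)"
  shows "(dunkl_laplacian Rp \<kappa> ^^ N) F w = lifts [((lam c ^^ N) \<phi>, g), ((lam c' ^^ N) \<psi>, h)] w"
  using assms(10)
proof (induction N arbitrary: w)
  case 0
  then show ?case using assms(9) by simp
next
  case (Suc N)
  let ?p = "((lam c ^^ N) \<phi>, g)" and ?q = "((lam c' ^^ N) \<psi>, h)"
  have split: "[?p, ?q] = [?p] @ [?q]" by simp
  have good: "good [?p, ?q]" using assms by (simp add: good_Cons good_Nil smooth0_lam_funpow)
  have "(dunkl_laplacian Rp \<kappa> ^^ Suc N) F w
      = lifts (dt_step (dt_step [?p, ?q])) w + (\<Sum>b\<in>Basis. lifts (T_step b (T_step b [?p, ?q])) w)"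
    using dunkl_laplacian_lifts[OF good Suc.prems Suc.IH] by simp
  also have "\<dots>
      = (lifts (dt_step (dt_step [?p])) w + (\<Sum>b\<in>Basis. lifts (T_step b (T_step b [?p])) w))
      + (lifts (dt_step (dt_step [?q])) w + (\<Sum>b\<in>Basis. lifts (T_step b (T_step b [?q])) w))"
    unfolding split dt_step_append T_step_append lifts_append sum.distrib by (simp only: add_ac)
  finally show ?case
    unfolding laplacian_lift[OF assms(1-3)] laplacian_lift[OF assms(4-6)] by (simp add: c_def c'_def)
qed

end

theorem theorem3p1:
  fixes R Rp :: "(real, 'd::{finite,linorder}) vec set"
    and \<kappa> :: "(real, 'd) vec \<Rightarrow> real"
    and m n mu :: nat
    and P :: "(real, 'd) vec \<Rightarrow> 'd clifford"
    and \<Omega> :: "complex set"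
    and f :: "complex \<Rightarrow> complex"
  assumes "root_system R"
    and "positive_subsystem R Rp"
    and "multiplicity_function R \<kappa>"
    and "dunkl_gamma Rp \<kappa> > 0"
    and "homogeneous_polynomial n P"
    and "\<And>x. dunkl_dirac Rp \<kappa> P x = 0"
    and "open \<Omega>"
    and "\<Omega> \<subseteq> {z. Im z > 0}"
    and "Ck_on (2 * m + 1) (\<lambda>z. Re (f z)) \<Omega>"
    and "Ck_on (2 * m + 1) (\<lambda>z. Im (f z)) \<Omega>"
    and "\<And>z. z \<in> \<Omega> \<Longrightarrow> dbar ((laplace_plane ^^ m) f) z = 0"
    and "dunkl_dimension Rp \<kappa> = real mu"
    and "odd mu"
  shows "dunkl_monogenic_on Rp \<kappa>
    ((dunkl_laplacian Rp \<kappa> ^^ (m + n + (mu - 1) div 2)) (\<lambda>x. axial_extension f x \<odot> P (snd x)))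
    (axial_domain \<Omega>)"
proof -
  interpret axial_setting R Rp \<kappa> \<Omega>
    by unfold_locales (use assms in auto)
  note mono = assms(6)
  define k where "k = n + (mu - 1) div 2"
  define xP where "xP = (\<lambda>x. cl_vec x \<odot> P x)"
  have mu: "2 * (\<Sum>\<alpha>\<in>Rp. \<kappa> \<alpha>) + real CARD('d) = real mu"
    using assms(12) by (simp add: dunkl_dimension_def dunkl_gamma_def)
  \<comment> \<open>Oddness makes mu positive and the division by 2 exact.\<close>
  have nu: "real (2 * n) + real mu = 1 + 2 * real k"
    using \<open>odd mu\<close> by (auto simp: k_def elim: oddE)

  have P: "polyfun P" using homogeneous_polynomial_polyfun[OF assms(5)] .
  have degP: "dir_deriv x P x = real n *\<^sub>R P x" for x
    using euler_identity[OF P homogeneous_polynomial_scaleR[OF assms(5)]] .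
  have harmP: "(\<Sum>b\<in>Basis. T b (T b P) x) = 0" for x
    by (rule monogenic_imp_harmonic[OF P mono])
  have xP: "polyfun xP" unfolding xP_def by (rule polyfun_cl_vec_mult[OF P])
  have "xP (t *\<^sub>R x) = t ^ Suc n *\<^sub>R xP x" for t x
    by (simp add: xP_def cl_vec_mult homogeneous_polynomial_scaleR[OF assms(5)] cl_mult_simps
        scaleR_sum_right mult_ac)
  then have degxP: "dir_deriv x xP x = real (Suc n) *\<^sub>R xP x" for x
    by (rule euler_identity[OF xP])
  have harmxP: "(\<Sum>b\<in>Basis. T b (T b xP) x) = 0" for x
    unfolding xP_def by (rule cl_vec_mult_monogenic_harmonic[OF P mono])
  have diracxP: "dunkl_dirac Rp \<kappa> xP x = - ((1 + 2 * real k) *\<^sub>R P x)" for x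
    unfolding xP_def dirac_cl_vec_mult[OF P mono degP] using mu nu by simp

  have "f = (\<lambda>z. Re (f z) *\<^sub>R 1 + Im (f z) *\<^sub>R \<i>)" by (simp add: fun_eq_iff complex_eq_iff)
  then have "Ck_on (2 * m + 1) f \<Omega>"
    using Ck_on_add[OF assms(7) Ck_on_scaleR[OF assms(7,9) Ck_on_const] Ck_on_scaleR[OF assms(7,10) Ck_on_const]]
    by metis
  then have f: "smooth f"
    unfolding smooth_def using dbar_laplace_power_regularity[OF assms(7) _ assms(11)] by blast
  define u v where "u = cutoff (\<lambda>z. Re (f z))" and "v = cutoff (\<lambda>z. Im (f z))"
  have u: "smooth0 u" and v: "smooth0 v"
    unfolding u_def v_def
    by (rule smooth0_cutoff, rule smooth_bounded_linear[OF bounded_linear_Re f],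
        rule smooth0_cutoff, rule smooth_bounded_linear[OF bounded_linear_Im f])
  note cr = dbar_eq_0_imp[OF smooth_laplace_plane_funpow[OF f] assms(11)]
  have cr': "dt ((lam 1 ^^ m) u) = (\<lambda>z. Im z * dl ((lam 1 ^^ m) v) z)"
    "dt ((lam 1 ^^ m) v) = (\<lambda>z. - Im z * dl ((lam 1 ^^ m) u) z)"
    using cr by (simp_all add: u_def v_def lam_1_funpow_component[OF f] bounded_linear_Re bounded_linear_Im)
  define A where "A = (lam (1 + 2 * real k) ^^ (m + k)) u"
  define B where "B = (lam (3 + 2 * real k) ^^ (m + k)) (\<lambda>z. v z / Im z)"
  have AB: "dt A = euler (1 + 2 * real k) B" "\<And>z. dl A z + dt B z = 0"
    using generalized_cauchy_riemann[OF u v cr', of k] by (simp_all add: A_def B_def)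
  have good: "good [(A, P), (B, xP)]"
    using u v P xP by (simp add: good_Cons good_Nil A_def B_def smooth0_lam_funpow lam_div_Im(1))

  let ?F = "\<lambda>x. axial_extension f x \<odot> P (snd x)"
  let ?G = "(dunkl_laplacian Rp \<kappa> ^^ (m + k)) ?F"
  \<comment> \<open>The unit vector times v is x times v / s, so the second profile starts from v /
    s and its polynomial is xP of degree n + 1.\<close>
  have F: "?F w = lifts [(u, P), (\<lambda>z. v z / Im z, xP)] w" if "w \<in> V" for w
  proof -
    have "cl_vec (c *\<^sub>R x) \<odot> y = c *\<^sub>R (cl_vec x \<odot> y)" for c and x :: "(real, 'd) vec" and y
      by (simp add: cl_vec_mult scaleR_sum_right)
    then show ?thesis
      using that
      by (cases w) (simp add: axial_extension_def axial_domain_iff lift_def xP_def u_def v_def cutoff_def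
          cl_mult_simps cl_mult_unit divide_inverse)
  qed
  have "2 * real n + 2 * (\<Sum>\<alpha>\<in>Rp. \<kappa> \<alpha>) + real CARD('d) = 1 + 2 * real k"
    "2 * real (Suc n) + 2 * (\<Sum>\<alpha>\<in>Rp. \<kappa> \<alpha>) + real CARD('d) = 3 + 2 * real k"
    using mu nu by auto
  then have G: "?G w = lifts [(A, P), (B, xP)] w" if "w \<in> V" for w
    using dunkl_laplacian_funpow_lifts[OF P degP harmP xP degxP harmxP u lam_div_Im(1)[OF v] F that, of "m + k"]
    by (simp only: A_def B_def)
  have "dunkl_cauchy_riemann Rp \<kappa> ?G w = 0" if w: "w \<in> V" for w
  proof -
    let ?z = "Complex (fst w) (norm (snd w))" and ?x = "snd w"
    have xxP: "cl_vec ?x \<odot> xP ?x = - ((norm ?x)\<^sup>2 *\<^sub>R P ?x)"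
      by (simp add: xP_def cl_vec_squared power2_norm_eq_inner)
    have "dunkl_cauchy_riemann Rp \<kappa> ?G w
        = lifts (dt_step [(A, P), (B, xP)]) w
          + (\<Sum>i\<in>UNIV. cl_gen i \<odot> lifts (T_step (axis i 1) [(A, P), (B, xP)]) w)"
      unfolding dunkl_cauchy_riemann_def
      by (simp only: dir_deriv_t_lifts[OF good w G] dunkl_op1_lifts[OF good w G])
    also have "\<dots> = dt A ?z *\<^sub>R P ?x + dt B ?z *\<^sub>R xP ?x
        + (dl A ?z *\<^sub>R (cl_vec ?x \<odot> P ?x) + A ?z *\<^sub>R dunkl_dirac Rp \<kappa> P ?x
          + dl B ?z *\<^sub>R (cl_vec ?x \<odot> xP ?x) + B ?z *\<^sub>R dunkl_dirac Rp \<kappa> xP ?x)"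
    proof -
      have "cl_gen i \<odot> lifts (T_step (axis i 1) [(A, P), (B, xP)]) w
          = dl A ?z *\<^sub>R (?x $ i) *\<^sub>R (cl_gen i \<odot> P ?x) + A ?z *\<^sub>R (cl_gen i \<odot> T (axis i 1) P ?x)
            + dl B ?z *\<^sub>R (?x $ i) *\<^sub>R (cl_gen i \<odot> xP ?x) + B ?z *\<^sub>R (cl_gen i \<odot> T (axis i 1) xP ?x)" for i
      proof -
        have "lifts (T_step (axis i 1) [(A, P), (B, xP)]) w
          = dl A ?z *\<^sub>R (?x $ i) *\<^sub>R P ?x + A ?z *\<^sub>R T (axis i 1) P ?x
            + dl B ?z *\<^sub>R (?x $ i) *\<^sub>R xP ?x + B ?z *\<^sub>R T (axis i 1) xP ?x"
          by (simp add: step_defs lift_def inner_axis)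
        then show ?thesis by (simp only: cl_mult_simps)
      qed
      then have "(\<Sum>i\<in>UNIV. cl_gen i \<odot> lifts (T_step (axis i 1) [(A, P), (B, xP)]) w)
        = dl A ?z *\<^sub>R (cl_vec ?x \<odot> P ?x) + A ?z *\<^sub>R dunkl_dirac Rp \<kappa> P ?x
          + dl B ?z *\<^sub>R (cl_vec ?x \<odot> xP ?x) + B ?z *\<^sub>R dunkl_dirac Rp \<kappa> xP ?x"
        by (simp only: sum.distrib cl_vec_mult dunkl_dirac_def scaleR_sum_right)
      then show ?thesis by (simp add: step_defs lift_def)
    qed
    \<comment> \<open>The term in \<open>dl B\<close> gives - s^2 P through the square of the vector
      x, and the Dirac operator on xP gives - (1 + 2 k) P; together they are \<open>euler\<close>
      applied to B.\<close>
    also have "\<dots> = (dt A ?z - euler (1 + 2 * real k) B ?z) *\<^sub>R P ?x + (dl A ?z + dt B ?z) *\<^sub>R xP ?x"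
      unfolding mono diracxP xxP by (simp add: euler_def xP_def algebra_simps)
    finally show ?thesis by (simp add: AB)
  qed
  moreover have "Ck_on 1 ?G V" by (rule Ck_on_1_lifts[OF good G])
  moreover have N: "m + n + (mu - 1) div 2 = m + k" by (simp add: k_def)
  ultimately show ?thesis unfolding dunkl_monogenic_on_def N by blast
qed

end
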